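(* Let $\mathscr H$ be a real separable Hilbert space, let $q,t\in\mathbb R$ with $|q|<t\le1$, and let $\mathscr F_{q,t}$ be the $(q,t)$-Fock space over $\mathscr H$. For $f\in\mathscr H$ define the creation operator $a_{q,t}(f)^\ast$ and the annihilation operator $a_{q,t}(f)$ by linear extension of $$a_{q,t}(f)^\ast\Omega=f,\qquad a_{q,t}(f)^\ast h_1\otimes\cdots\otimes h_n=f\otimes h_1\otimes\cdots\otimes h_n,$$ $$a_{q,t}(f)\Omega=0,\qquad a_{q,t}(f)h_1\otimes\cdots\otimes h_n=\sum_{k=1}^nq^{k-1}t^{n-k}\langle f,h_k\rangle_{\mathscr H}\,h_1\otimes\cdots\otimes\breve h_k\otimes\cdots\otimes h_n,$$ where $\breve h_k$ means that $h_k$ is deleted. Then: 1. $a_{q,t}(f)$ and $a_{q,t}(f)^\ast$ are adjoints of each other with respect to $\langle\cdot,\cdot\rangle_{q,t}$. 2. For all $f,g\in\mathscr H$, $\ a_{q,t}(f)a_{q,t}(g)^\ast-q\,a_{q,t}(g)^\ast a_{q,t}(f)=\langle f,g\rangle_{\mathscr H}\,t^N$, where $t^N$ is the linear extension of $t^N\Omega=\Omega$, $t^Nh_1\otimes\cdots\otimes h_n=t^n\,h_1\otimes\cdots\otimes h_n$. 3. For all $n\in\mathbb N$, $h_1,\dots,h_{2n}\in\mathscr H$ and $\epsilon(1),\dots,\epsilon(2n)\in\{1,\ast\}$, $$\varphi_{q,t}\big(a_{q,t}(h_1)^{\epsilon(1)}\cdots a_{q,t}(h_{2n-1})^{\epsilon(2n-1)}\big)=0,$$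 $$\varphi_{q,t}\big(a_{q,t}(h_1)^{\epsilon(1)}\cdots a_{q,t}(h_{2n})^{\epsilon(2n)}\big)=\sum_{\mathscr V\in\mathscr P_2(2n)}q^{\mathrm{cross}(\mathscr V)}t^{\mathrm{nest}(\mathscr V)}\prod_{i=1}^n\varphi_{q,t}\big(a_{q,t}(h_{w_i})^{\epsilon(w_i)}a_{q,t}(h_{z_i})^{\epsilon(z_i)}\big),$$ where each $\mathscr V$ is written uniquely as $\{(w_1,z_1),\dots,(w_n,z_n)\}$ with $w_1<\cdots<w_n$ and $w_i<z_i$. 4. For every $f\in\mathscr H$, $a_{q,t}(f)$ is bounded on $\mathscr F_{q,t}$, with $$\|a_{q,t}(f)\|=\|a_{q,t}(f)^\ast\|=\begin{cases}\|f\|_{\mathscr H}&0\le-q<t\le1,\\[2pt] \frac1{\sqrt{1-q}}\|f\|_{\mathscr H}&0<q<t=1,\\[2pt] \sqrt{\frac{t^{n_\ast}-q^{n_\ast}}{t-q}}\,\|f\|_{\mathscr H}&0<q<t<1,\end{cases}\qquad n_\ast=\left\lceil\frac{\log(1-q)-\log(1-t)}{\log t-\log q}\right\rceil .$$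
   Context: $\mathscr H_{\mathbb C}$ is the complexification of $\mathscr H$, with inner product extended to be conjugate-linear in the first and linear in the second argument. $\mathscr F=\mathbb C\Omega\oplus\bigoplus_{n\ge1}\mathscr H_{\mathbb C}^{\otimes n}$ (algebraic direct sum and tensor products), $\Omega$ a distinguished unit vector; $\langle\cdot,\cdot\rangle_0$ is the usual full Fock space inner product on $\mathscr F$ (different degrees orthogonal, $\langle\Omega,\Omega\rangle_0=1$, $\langle g_1\otimes\cdots\otimes g_n,h_1\otimes\cdots\otimes h_n\rangle_0=\prod_i\langle g_i,h_i\rangle$). For $\pi\in S_n$, $\mathrm{inv}(\pi)$ is the number of pairs $i<j$ with $\pi(i)>\pi(j)$, $\mathrm{cinv}(\pi)$ the number of pairs $i<j$ with $\pi(i)<\pi(j)$, and $U_\pi^{(n)}h_1\otimes\cdots\otimes h_n=h_{\pi(1)}\otimes\cdots\otimes h_{\pi(n)}$. Put $P_{q,t}=\bigoplus_{n\ge0}P_{q,t}^{(n)}$, $P_{q,t}^{(n)}=\sum_{\pi\in S_n}q^{\mathrm{inv}(\pi)}t^{\mathrm{cinv}(\pi)}U^{(n)}_\pi$ (identity for $n=0$) and $\langle\eta,\xi\rangle_{q,t}=\langle\eta,P_{q,t}\xi\rangle_0$, which is an inner product on $\mathscr F$ when $|q|<t$. The $(q,t)$-Fock space $\mathscr F_{q,t}$ is the completion of $\mathscr F$ for $\langle\cdot,\cdot\rangle_{q,t}$. Operators are defined on the dense subspace $\mathscr F$ and, when bounded, extended to $\mathscr F_{q,t}$. The vacuum state is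 $\varphi_{q,t}(b)=\langle\Omega,b\Omega\rangle_{q,t}$. For $\epsilon=1$, $a^{\epsilon}=a$. $\mathscr P_2(2n)$ is the set of pair partitions of $\{1,\dots,2n\}$. For $\mathscr V=\{(w_1,z_1),\dots,(w_n,z_n)\}$ with $w_i<z_i$: $\mathrm{cross}(\mathscr V)$ is the number of pairs of blocks with $w_i<w_j<z_i<z_j$ (crossings), $\mathrm{nest}(\mathscr V)$ the number of pairs of blocks with $w_i<w_j<z_j<z_i$ (nestings). Convention: $0^0=1$. *)

theory Defs
  imports
    "HOL-Analysis.Analysis"
    "HOL-Library.Poly_Mapping"
    "HOL-Library.Disjoint_Sets"
    "HOL-Combinatorics.Permutations"
begin

section \<open>Complex vector spaces\<close>

class complex_vector = ab_group_add +
  fixes scaleC :: "complex \<Rightarrow> 'a \<Rightarrow> 'a" (infixr "*\<^sub>C" 75)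
  assumes scaleC_add_right: "a *\<^sub>C (x + y) = a *\<^sub>C x + a *\<^sub>C y"
    and scaleC_add_left: "(a + b) *\<^sub>C x = a *\<^sub>C x + b *\<^sub>C x"
    and scaleC_scaleC: "a *\<^sub>C b *\<^sub>C x = (a * b) *\<^sub>C x"
    and scaleC_one: "1 *\<^sub>C x = x"

global_interpretation complex_vector:
  vector_space "scaleC :: complex \<Rightarrow> 'a \<Rightarrow> 'a :: complex_vector"
  by unfold_locales (auto simp: scaleC_add_right scaleC_add_left scaleC_scaleC scaleC_one)

abbreviation clinear :: "('a :: complex_vector \<Rightarrow> 'b :: complex_vector) \<Rightarrow> bool"
  where "clinear \<equiv> Vector_Spaces.linear scaleC scaleC"

lemma clinear_iff:
  "clinear f \<longleftrightarrow> (\<forall>x y. f (x + y) = f x + f y) \<and> (\<forall>c x. f (c *\<^sub>C x) = c *\<^sub>C f x)"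
  by (auto simp: Vector_Spaces.linear_iff intro: complex_vector.vector_space_axioms)

instantiation complex :: complex_vector
begin

definition scaleC_complex :: "complex \<Rightarrow> complex \<Rightarrow> complex"
  where "scaleC_complex a b = a * b"

instance
  by standard (auto simp: scaleC_complex_def algebra_simps)

end


section \<open>The complexification of a real inner product space\<close>

text \<open>\<open>Cplx x y\<close> stands for \<open>x + i y\<close>.\<close>

datatype 'a cplx = Cplx (re_part: 'a) (im_part: 'a)

instantiation cplx :: (real_vector) complex_vector
begin

definition "0 = Cplx 0 0"
definition "u + v = Cplx (re_part u + re_part v) (im_part u + im_part v)"
definition "u - v = Cplx (re_part u - re_part v) (im_part u - im_part v)"
definition "- u = Cplx (- re_part u) (- im_part u)"
definition "c *\<^sub>C u = Cplx (Re c *\<^sub>R re_part u - Im c *\<^sub>R im_part u)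
                         (Re c *\<^sub>R im_part u + Im c *\<^sub>R re_part u)"

instance
  by standard
    (auto simp: zero_cplx_def plus_cplx_def minus_cplx_def uminus_cplx_def scaleC_cplx_def
      algebra_simps scaleR_add_left scaleR_diff_left)

end

definition cinner :: "'a :: real_inner cplx \<Rightarrow> 'a cplx \<Rightarrow> complex"
  where "cinner u v =
    Complex (inner (re_part u) (re_part v) + inner (im_part u) (im_part v))
            (inner (re_part u) (im_part v) - inner (im_part u) (re_part v))"

definition emb_cplx :: "'a :: real_vector \<Rightarrow> 'a cplx"
  where "emb_cplx f = Cplx f 0"

lemma cinner_add_right: "cinner u (v + w) = cinner u v + cinner u w"
  by (auto simp: cinner_def plus_cplx_def complex_eq_iff inner_add_right)

lemma cinner_scaleC_right: "cinner u (c *\<^sub>C v) = c * cinner u v"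
  by (auto simp: cinner_def scaleC_cplx_def complex_eq_iff inner_add_right inner_diff_right
      algebra_simps)

lemma cinner_commute: "cinner u v = cnj (cinner v u)"
  by (auto simp: cinner_def complex_eq_iff inner_commute)

lemma cinner_add_left: "cinner (u + v) w = cinner u w + cinner v w"
  by (metis cinner_add_right cinner_commute complex_cnj_add)

lemma cinner_scaleC_left: "cinner (c *\<^sub>C u) v = cnj c * cinner u v"
  by (metis cinner_scaleC_right cinner_commute complex_cnj_mult)

lemma cinner_emb_cplx: "cinner (emb_cplx f) (emb_cplx g) = complex_of_real (inner f g)"
  by (simp add: cinner_def emb_cplx_def complex_eq_iff)


section \<open>The algebraic Fock space\<close>

text \<open>
  The complex vector space freely generated by all finite lists \<open>[h\<^sub>1, \<dots>, h\<^sub>n]\<close> of vectors of the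
  complexification, modulo the multilinearity relations in each length, is the algebraic direct
  sum over \<open>n\<close> of the algebraic \<open>n\<close>-fold tensor powers. No relation involves the empty
  list, whose class is the vacuum vector.
\<close>

instantiation poly_mapping :: (type, complex_vector) complex_vector
begin

lift_definition scaleC_poly_mapping :: "complex \<Rightarrow> ('a \<Rightarrow>\<^sub>0 'b) \<Rightarrow> 'a \<Rightarrow>\<^sub>0 'b"
  is "\<lambda>c f k. c *\<^sub>C f k"
  by (rule finite_subset[rotated], assumption) auto

instance
  by standard
    (transfer; simp add: fun_eq_iff scaleC_add_right scaleC_add_left scaleC_scaleC scaleC_one)+

end

abbreviation free_tensor :: "'a cplx list \<Rightarrow> ('a cplx list \<Rightarrow>\<^sub>0 complex)"
  where "free_tensor hs \<equiv> Poly_Mapping.single hs 1"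

definition tensor_relations :: "('a :: real_vector cplx list \<Rightarrow>\<^sub>0 complex) set"
  where "tensor_relations = complex_vector.span
    ({free_tensor (us @ [x + y] @ vs) - free_tensor (us @ [x] @ vs) - free_tensor (us @ [y] @ vs)
        | us x y vs. True} \<union>
     {free_tensor (us @ [c *\<^sub>C x] @ vs) - c *\<^sub>C free_tensor (us @ [x] @ vs)
        | us c x vs. True})"

definition tensor_equiv ::
    "('a :: real_vector cplx list \<Rightarrow>\<^sub>0 complex) \<Rightarrow> ('a cplx list \<Rightarrow>\<^sub>0 complex) \<Rightarrow> bool"
  where "tensor_equiv p p' \<longleftrightarrow> p - p' \<in> tensor_relations"

lemma tensor_relations_add:
  "p \<in> tensor_relations \<Longrightarrow> p' \<in> tensor_relations \<Longrightarrow> p + p' \<in> tensor_relations"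
  unfolding tensor_relations_def by (rule complex_vector.span_add)

lemma tensor_relations_diff:
  "p \<in> tensor_relations \<Longrightarrow> p' \<in> tensor_relations \<Longrightarrow> p - p' \<in> tensor_relations"
  unfolding tensor_relations_def by (rule complex_vector.span_diff)

lemma tensor_relations_scale: "p \<in> tensor_relations \<Longrightarrow> c *\<^sub>C p \<in> tensor_relations"
  unfolding tensor_relations_def by (rule complex_vector.span_scale)

lemma tensor_relations_zero: "0 \<in> tensor_relations"
  unfolding tensor_relations_def by (rule complex_vector.span_zero)

lemma equivp_tensor_equiv:
  "equivp (tensor_equiv :: ('a :: real_vector cplx list \<Rightarrow>\<^sub>0 complex) \<Rightarrow> _)"
proof (rule equivpI)
  show "reflp (tensor_equiv :: ('a cplx list \<Rightarrow>\<^sub>0 complex) \<Rightarrow> _)"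
    by (simp add: reflp_def tensor_equiv_def tensor_relations_zero)
  show "symp (tensor_equiv :: ('a cplx list \<Rightarrow>\<^sub>0 complex) \<Rightarrow> _)"
  proof (rule sympI)
    fix p p' :: "'a cplx list \<Rightarrow>\<^sub>0 complex" assume "tensor_equiv p p'"
    then show "tensor_equiv p' p"
      using tensor_relations_diff[OF tensor_relations_zero, of "p - p'"]
      by (simp add: tensor_equiv_def)
  qed
  show "transp (tensor_equiv :: ('a cplx list \<Rightarrow>\<^sub>0 complex) \<Rightarrow> _)"
  proof (rule transpI)
    fix p p' p'' :: "'a cplx list \<Rightarrow>\<^sub>0 complex"
    assume "tensor_equiv p p'" "tensor_equiv p' p''"
    then show "tensor_equiv p p''"
      using tensor_relations_add[of "p - p'" "p' - p''"]
      by (simp add: tensor_equiv_def)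
  qed
qed

quotient_type (overloaded) 'a fock = "'a :: real_vector cplx list \<Rightarrow>\<^sub>0 complex" / tensor_equiv
  by (rule equivp_tensor_equiv)

instantiation fock :: (real_vector) complex_vector
begin

lift_definition zero_fock :: "'a fock" is 0 .

lift_definition plus_fock :: "'a fock \<Rightarrow> 'a fock \<Rightarrow> 'a fock" is "(+)"
  unfolding tensor_equiv_def by (drule (1) tensor_relations_add) (simp add: algebra_simps)

lift_definition minus_fock :: "'a fock \<Rightarrow> 'a fock \<Rightarrow> 'a fock" is "(-)"
  unfolding tensor_equiv_def by (drule (1) tensor_relations_diff) (simp add: algebra_simps)

lift_definition uminus_fock :: "'a fock \<Rightarrow> 'a fock" is uminus
  unfolding tensor_equiv_def
  by (drule tensor_relations_diff[OF tensor_relations_zero]) (simp add: algebra_simps)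

lift_definition scaleC_fock :: "complex \<Rightarrow> 'a fock \<Rightarrow> 'a fock" is scaleC
  unfolding tensor_equiv_def
  by (drule tensor_relations_scale) (simp add: complex_vector.scale_right_diff_distrib)

instance
  by standard
    (transfer; simp add: tensor_equiv_def tensor_relations_zero algebra_simps
      complex_vector.scale_right_distrib complex_vector.scale_left_distrib)+

end

text \<open>\<open>tensor [h\<^sub>1, \<dots>, h\<^sub>n]\<close> is the simple tensor of \<open>h\<^sub>1, \<dots>, h\<^sub>n\<close>.\<close>

lift_definition tensor :: "'a :: real_vector cplx list \<Rightarrow> 'a fock" is free_tensor .

definition vacuum :: "'a :: real_vector fock" ("\<Omega>")
  where "\<Omega> = tensor []"


subsection \<open>Linear extension from simple tensors\<close>

definition multilinear :: "('a :: real_vector cplx list \<Rightarrow> 'b :: complex_vector) \<Rightarrow> bool"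
  where "multilinear \<phi> \<longleftrightarrow>
    (\<forall>us x y vs. \<phi> (us @ [x + y] @ vs) = \<phi> (us @ [x] @ vs) + \<phi> (us @ [y] @ vs)) \<and>
    (\<forall>us c x vs. \<phi> (us @ [c *\<^sub>C x] @ vs) = c *\<^sub>C \<phi> (us @ [x] @ vs))"

definition free_ext ::
    "('a cplx list \<Rightarrow> 'b :: complex_vector) \<Rightarrow> ('a cplx list \<Rightarrow>\<^sub>0 complex) \<Rightarrow> 'b"
  where "free_ext \<phi> p = (\<Sum>hs\<in>Poly_Mapping.keys p. Poly_Mapping.lookup p hs *\<^sub>C \<phi> hs)"

text \<open>
  For multilinear \<open>\<phi>\<close>, the following is the unique linear map with values \<open>\<phi>\<close> on
  simple tensors (see the lemmas below); \<open>rep_fock\<close> chooses a representative, on which the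
  result then does not depend.
\<close>

definition lin_ext :: "('a :: real_vector cplx list \<Rightarrow> 'b :: complex_vector) \<Rightarrow> 'a fock \<Rightarrow> 'b"
  where "lin_ext \<phi> \<xi> = free_ext \<phi> (rep_fock \<xi>)"

lemma free_ext_superset:
  assumes "finite A" "Poly_Mapping.keys p \<subseteq> A"
  shows "free_ext \<phi> p = (\<Sum>hs\<in>A. Poly_Mapping.lookup p hs *\<^sub>C \<phi> hs)"
  unfolding free_ext_def
  by (rule sum.mono_neutral_left) (use assms in \<open>auto simp: in_keys_iff\<close>)

lemma free_ext_add: "free_ext \<phi> (p + p') = free_ext \<phi> p + free_ext \<phi> p'"
proof -
  let ?A = "Poly_Mapping.keys p \<union> Poly_Mapping.keys p'"
  have "free_ext \<phi> r = (\<Sum>hs\<in>?A. Poly_Mapping.lookup r hs *\<^sub>C \<phi> hs)"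
    if "r \<in> {p, p', p + p'}" for r
    by (rule free_ext_superset) (use that keys_add[of p p'] in auto)
  then show ?thesis
    by (simp add: lookup_add complex_vector.scale_left_distrib sum.distrib)
qed

lemma free_ext_scale: "free_ext \<phi> (c *\<^sub>C p) = c *\<^sub>C free_ext \<phi> p"
proof -
  have "Poly_Mapping.keys (c *\<^sub>C p) \<subseteq> Poly_Mapping.keys p"
    by (auto simp: in_keys_iff scaleC_poly_mapping.rep_eq)
  then have "free_ext \<phi> (c *\<^sub>C p)
      = (\<Sum>hs\<in>Poly_Mapping.keys p. Poly_Mapping.lookup (c *\<^sub>C p) hs *\<^sub>C \<phi> hs)"
    by (rule free_ext_superset[rotated]) simp
  then show ?thesis
    by (simp add: free_ext_def scaleC_poly_mapping.rep_eq complex_vector.scale_sum_right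
        scaleC_complex_def)
qed

lemma clinear_free_ext: "clinear (free_ext \<phi>)"
  by (simp add: clinear_iff free_ext_add free_ext_scale)

lemma free_ext_diff: "free_ext \<phi> (p - p') = free_ext \<phi> p - free_ext \<phi> p'"
  using free_ext_add[of \<phi> "p - p'" p'] by simp

lemma free_ext_free_tensor: "free_ext \<phi> (free_tensor hs) = \<phi> hs"
  by (simp add: free_ext_def)

lemma free_ext_tensor_relations:
  assumes "multilinear \<phi>" "p \<in> tensor_relations"
  shows "free_ext \<phi> p = 0"
  using assms(2) unfolding tensor_relations_def
proof (induction rule: complex_vector.span_induct)
  case base
  show ?case
    by (auto simp: complex_vector.subspace_def free_ext_add free_ext_scale)
      (simp add: free_ext_def)
next
  case (step p)
  then show ?case
    using assms(1)
    by (auto simp: free_ext_diff free_ext_scale free_ext_free_tensor multilinear_def)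
qed

lemma lin_ext_abs_fock:
  assumes "multilinear \<phi>"
  shows "lin_ext \<phi> (abs_fock p) = free_ext \<phi> p"
proof -
  have "tensor_equiv (rep_fock (abs_fock p)) p"
    by (simp add: Quotient_rep_abs[OF Quotient_fock] equivp_reflp[OF fock_equivp])
  then show ?thesis
    using free_ext_tensor_relations[OF assms, of "rep_fock (abs_fock p) - p"]
    by (simp add: lin_ext_def tensor_equiv_def free_ext_diff)
qed

lemma clinear_lin_ext:
  assumes "multilinear \<phi>"
  shows "clinear (lin_ext \<phi>)"
proof -
  have "lin_ext \<phi> (\<xi> + \<eta>) = lin_ext \<phi> \<xi> + lin_ext \<phi> \<eta>" for \<xi> \<eta>
    by (induction \<xi>; induction \<eta>)
      (simp add: lin_ext_abs_fock[OF assms] plus_fock.abs_eq free_ext_add)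
  moreover have "lin_ext \<phi> (c *\<^sub>C \<xi>) = c *\<^sub>C lin_ext \<phi> \<xi>" for c \<xi>
    by (induction \<xi>) (simp add: lin_ext_abs_fock[OF assms] scaleC_fock.abs_eq free_ext_scale)
  ultimately show ?thesis
    by (simp add: clinear_iff)
qed

lemma lin_ext_tensor:
  assumes "multilinear \<phi>"
  shows "lin_ext \<phi> (tensor hs) = \<phi> hs"
  by (simp add: tensor.abs_eq lin_ext_abs_fock[OF assms] free_ext_free_tensor)


lemma multilinear_iff_update:
  "multilinear \<phi> \<longleftrightarrow>
    (\<forall>hs i x y. i < length hs \<longrightarrow> \<phi> (hs[i := x + y]) = \<phi> (hs[i := x]) + \<phi> (hs[i := y])) \<and>
    (\<forall>hs i c x. i < length hs \<longrightarrow> \<phi> (hs[i := c *\<^sub>C x]) = c *\<^sub>C \<phi> (hs[i := x]))"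
    (is "_ \<longleftrightarrow> ?R")
proof
  assume "multilinear \<phi>"
  then show ?R
    by (simp add: multilinear_def upd_conv_take_nth_drop)
next
  assume R: ?R
  have upd: "us @ [z] @ vs = (us @ [0] @ vs)[length us := z]" for us vs and z :: "'a cplx"
    by simp
  have len: "length us < length (us @ [0 :: 'a cplx] @ vs)" for us vs
    by simp
  note R = R[THEN conjunct1, rule_format, OF len] R[THEN conjunct2, rule_format, OF len]
  show "multilinear \<phi>"
    unfolding multilinear_def upd[of _ "_ + _"] upd[of _ "_ *\<^sub>C _"] R by simp
qed

lemma multilinear_tensor: "multilinear tensor"
proof -
  have "tensor (us @ [x + y] @ vs) = tensor (us @ [x] @ vs) + tensor (us @ [y] @ vs)"
    for us vs and x y :: "'a cplx"
  proof -
    have "free_tensor (us @ [x + y] @ vs) - free_tensor (us @ [x] @ vs) - free_tensor (us @ [y] @ vs)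
        \<in> tensor_relations"
      unfolding tensor_relations_def by (rule complex_vector.span_base, rule UnI1, rule CollectI,
          rule exI[of _ us], rule exI[of _ x], rule exI[of _ y], rule exI[of _ vs]) simp
    then have "tensor_equiv (free_tensor (us @ [x + y] @ vs))
        (free_tensor (us @ [x] @ vs) + free_tensor (us @ [y] @ vs))"
      by (simp only: tensor_equiv_def diff_diff_eq)
    then show ?thesis
      by (simp only: tensor.abs_eq plus_fock.abs_eq fock.abs_eq_iff)
  qed
  moreover have "tensor (us @ [c *\<^sub>C x] @ vs) = c *\<^sub>C tensor (us @ [x] @ vs)"
    for us vs c and x :: "'a cplx"
  proof -
    have "free_tensor (us @ [c *\<^sub>C x] @ vs) - c *\<^sub>C free_tensor (us @ [x] @ vs)
        \<in> tensor_relations"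
      unfolding tensor_relations_def by (rule complex_vector.span_base, rule UnI2, rule CollectI,
          rule exI[of _ us], rule exI[of _ c], rule exI[of _ x], rule exI[of _ vs]) simp
    then show ?thesis
      by (simp only: tensor.abs_eq scaleC_fock.abs_eq fock.abs_eq_iff tensor_equiv_def)
  qed
  ultimately show ?thesis
    by (simp add: multilinear_def)
qed

lemmas tensor_add = multilinear_tensor[unfolded multilinear_def, THEN conjunct1, rule_format]
lemmas tensor_scale = multilinear_tensor[unfolded multilinear_def, THEN conjunct2, rule_format]
lemmas tensor_update_add =
  multilinear_tensor[unfolded multilinear_iff_update, THEN conjunct1, rule_format]
lemmas tensor_update_scale =
  multilinear_tensor[unfolded multilinear_iff_update, THEN conjunct2, rule_format]

lemma fock_tensor_expansion:
  "\<xi> = (\<Sum>hs\<in>Poly_Mapping.keys (rep_fock \<xi>). Poly_Mapping.lookup (rep_fock \<xi>) hs *\<^sub>C tensor hs)"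
proof -
  have free: "(\<Sum>hs\<in>Poly_Mapping.keys p. Poly_Mapping.lookup p hs *\<^sub>C free_tensor hs) = p"
    for p :: "'a cplx list \<Rightarrow>\<^sub>0 complex"
    by (rule poly_mapping_eqI)
      (auto simp: lookup_sum scaleC_poly_mapping.rep_eq lookup_single when_def if_distrib
        scaleC_complex_def in_keys_iff cong: if_cong)
  have sum: "(\<Sum>hs\<in>A. c hs *\<^sub>C tensor hs) = abs_fock (\<Sum>hs\<in>A. c hs *\<^sub>C free_tensor hs)"
    if "finite A" for A and c :: "'a cplx list \<Rightarrow> complex"
    using that
    by (induction) (simp_all add: zero_fock.abs_eq tensor.abs_eq plus_fock.abs_eq scaleC_fock.abs_eq)
  show ?thesis
    using Quotient_abs_rep[OF Quotient_fock, of \<xi>] by (simp add: sum free)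
qed

lemma clinear_sum: "clinear f \<Longrightarrow> f (sum g A) = (\<Sum>x\<in>A. f (g x))"
  by (rule module_hom.sum) (rule Vector_Spaces.linear_iff_module_hom[THEN iffD1])

lemma clinear_fock_eqI:
  fixes f g :: "'a :: real_vector fock \<Rightarrow> 'b :: complex_vector"
  assumes "clinear f" "clinear g" "\<And>hs. f (tensor hs) = g (tensor hs)"
  shows "f = g"
proof
  fix \<xi> :: "'a fock"
  obtain A c where \<xi>: "\<xi> = (\<Sum>hs\<in>A. c hs *\<^sub>C tensor hs)"
    by (rule that[OF fock_tensor_expansion])
  have scale: "f (a *\<^sub>C \<eta>) = a *\<^sub>C f \<eta>" "g (a *\<^sub>C \<eta>) = a *\<^sub>C g \<eta>" for a \<eta>
    using assms(1,2) by (simp_all add: clinear_iff)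
  show "f \<xi> = g \<xi>"
    unfolding \<xi> clinear_sum[OF assms(1)] clinear_sum[OF assms(2)] scale assms(3) ..
qed


section \<open>The \<open>(q,t)\<close>-inner product\<close>

definition simple_inner :: "'a :: real_inner cplx list \<Rightarrow> 'a cplx list \<Rightarrow> complex"
  where "simple_inner gs hs =
    (if length gs = length hs then \<Prod>i<length hs. cinner (gs ! i) (hs ! i) else 0)"

text \<open>The sesquilinear (conjugate-linear in the first argument) extension of \<open>simple_inner\<close>.\<close>

definition fock_inner0 :: "'a :: real_inner fock \<Rightarrow> 'a fock \<Rightarrow> complex"
  where "fock_inner0 \<eta> \<xi> =
    lin_ext (\<lambda>hs. cnj (lin_ext (\<lambda>gs. cnj (simple_inner gs hs)) \<eta>)) \<xi>"

lemma prod_update: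
  assumes "i < n" "n = length hs"
  shows "(\<Prod>k<n. f k (hs[i := x] ! k)) = f i x * (\<Prod>k\<in>{..<n} - {i}. f k (hs ! k))"
proof -
  have "(\<Prod>k<n. f k (hs[i := x] ! k))
      = f i (hs[i := x] ! i) * (\<Prod>k\<in>{..<n} - {i}. f k (hs[i := x] ! k))"
    by (rule prod.remove) (use assms in auto)
  also have "(\<Prod>k\<in>{..<n} - {i}. f k (hs[i := x] ! k)) = (\<Prod>k\<in>{..<n} - {i}. f k (hs ! k))"
    by (rule prod.cong) auto
  finally show ?thesis
    using assms by simp
qed

lemma multilinear_simple_inner_right: "multilinear (simple_inner gs)"
proof -
  have upd: "simple_inner gs (hs[i := x]) = (if length gs = length hs
      then cinner (gs ! i) x * (\<Prod>k\<in>{..<length hs} - {i}. cinner (gs ! k) (hs ! k)) else 0)"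
    if "i < length hs" for hs i x
    unfolding simple_inner_def using prod_update[OF that refl, of "\<lambda>k. cinner (gs ! k)" x] by simp
  show ?thesis
    unfolding multilinear_iff_update
    by (auto simp: upd cinner_add_right cinner_scaleC_right scaleC_complex_def algebra_simps)
qed

lemma simple_inner_commute: "simple_inner gs hs = cnj (simple_inner hs gs)"
  by (auto simp: simple_inner_def intro!: prod.cong cinner_commute)

lemma multilinear_simple_inner_left: "multilinear (\<lambda>gs. cnj (simple_inner gs hs))"
  using multilinear_simple_inner_right[of hs] by (simp flip: simple_inner_commute)

lemma multilinear_fock_inner0:
  "multilinear (\<lambda>hs. cnj (lin_ext (\<lambda>gs. cnj (simple_inner gs hs)) \<eta>))"
proof -
  have add: "simple_inner gs (us @ [x + y] @ vs)
        = simple_inner gs (us @ [x] @ vs) + simple_inner gs (us @ [y] @ vs)"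
    and scale: "simple_inner gs (us @ [c *\<^sub>C x] @ vs) = c * simple_inner gs (us @ [x] @ vs)"
    for gs us vs c and x y :: "'a cplx"
    using multilinear_simple_inner_right[of gs]
    unfolding multilinear_def scaleC_complex_def by blast+
  show ?thesis
    unfolding multilinear_def lin_ext_def free_ext_def scaleC_complex_def add scale
    by (auto simp: sum_distrib_left distrib_left sum.distrib mult_ac intro!: sum.cong)
qed

lemma fock_inner0_tensor: "fock_inner0 (tensor gs) (tensor hs) = simple_inner gs hs"
  unfolding fock_inner0_def lin_ext_tensor[OF multilinear_fock_inner0]
    lin_ext_tensor[OF multilinear_simple_inner_left] complex_cnj_cnj
    lin_ext_tensor[OF multilinear_simple_inner_right] ..

definition inversions :: "nat \<Rightarrow> (nat \<Rightarrow> nat) \<Rightarrow> nat"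
  where "inversions n \<pi> = card {(i, j). i < j \<and> j < n \<and> \<pi> i > \<pi> j}"

definition coinversions :: "nat \<Rightarrow> (nat \<Rightarrow> nat) \<Rightarrow> nat"
  where "coinversions n \<pi> = card {(i, j). i < j \<and> j < n \<and> \<pi> i < \<pi> j}"

text \<open>\<open>permute_list \<pi> [h\<^sub>0, \<dots>, h\<^sub>n\<^sub>-\<^sub>1]\<close> is \<open>[h\<^bsub>\<pi>(0)\<^esub>, \<dots>, h\<^bsub>\<pi>(n-1)\<^esub>]\<close>; permutations act on \<open>{0, \<dots>, n-1}\<close>.\<close>

definition qt_operator :: "real \<Rightarrow> real \<Rightarrow> 'a :: real_vector fock \<Rightarrow> 'a fock"
  where "qt_operator q t = lin_ext (\<lambda>hs. \<Sum>\<pi> | \<pi> permutes {..<length hs}.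
    complex_of_real (q ^ inversions (length hs) \<pi> * t ^ coinversions (length hs) \<pi>)
      *\<^sub>C tensor (permute_list \<pi> hs))"

definition fock_inner :: "real \<Rightarrow> real \<Rightarrow> 'a :: real_inner fock \<Rightarrow> 'a fock \<Rightarrow> complex"
  where "fock_inner q t \<eta> \<xi> = fock_inner0 \<eta> (qt_operator q t \<xi>)"

definition fock_norm :: "real \<Rightarrow> real \<Rightarrow> 'a :: real_inner fock \<Rightarrow> real"
  where "fock_norm q t \<xi> = sqrt (Re (fock_inner q t \<xi> \<xi>))"

lemma permute_list_update:
  assumes "\<pi> permutes {..<length hs}" "i < length hs"
  shows "permute_list \<pi> (hs[i := x]) = (permute_list \<pi> hs)[inv \<pi> i := x]"
proof (rule nth_equalityI)
  fix k assume "k < length (permute_list \<pi> (hs[i := x]))"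
  then have "k < length hs" by simp
  moreover have "\<pi> k < length hs"
    using permutes_in_image[OF assms(1)] \<open>k < length hs\<close> by auto
  moreover have "\<pi> k = i \<longleftrightarrow> inv \<pi> i = k"
    using permutes_inverses[OF assms(1)] by metis
  ultimately show "permute_list \<pi> (hs[i := x]) ! k = (permute_list \<pi> hs)[inv \<pi> i := x] ! k"
    using assms by (auto simp: permute_list_def nth_list_update)
qed simp

lemma multilinear_qt_operator:
  "multilinear (\<lambda>hs. \<Sum>\<pi> | \<pi> permutes {..<length hs}.
    complex_of_real (q ^ inversions (length hs) \<pi> * t ^ coinversions (length hs) \<pi>)
      *\<^sub>C tensor (permute_list \<pi> hs))"
proof -
  have lt: "inv \<pi> i < length (permute_list \<pi> hs)"
    if "\<pi> permutes {..<length hs}" "i < length hs" for \<pi> i and hs :: "'a cplx list"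
    using permutes_in_image[OF permutes_inv[OF that(1)]] that(2) by simp
  have add: "tensor (permute_list \<pi> (hs[i := x + y]))
        = tensor (permute_list \<pi> (hs[i := x])) + tensor (permute_list \<pi> (hs[i := y]))"
    and scale: "tensor (permute_list \<pi> (hs[i := c *\<^sub>C x]))
        = c *\<^sub>C tensor (permute_list \<pi> (hs[i := x]))"
    if "\<pi> permutes {..<length hs}" "i < length hs" for \<pi> i hs c and x y :: "'a cplx"
    unfolding permute_list_update[OF that]
    by (rule tensor_update_add[OF lt[OF that]], rule tensor_update_scale[OF lt[OF that]])
  show ?thesis
    unfolding multilinear_iff_update length_list_update complex_vector.scale_sum_right
      sum.distrib[symmetric]
  proof (intro conjI allI impI sum.cong refl)
    fix hs :: "'a cplx list" and i x y \<pi>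
    assume "i < length hs" "\<pi> \<in> {\<pi>. \<pi> permutes {..<length hs}}"
    then show "complex_of_real (q ^ inversions (length hs) \<pi> * t ^ coinversions (length hs) \<pi>)
          *\<^sub>C tensor (permute_list \<pi> (hs[i := x + y]))
      = complex_of_real (q ^ inversions (length hs) \<pi> * t ^ coinversions (length hs) \<pi>)
          *\<^sub>C tensor (permute_list \<pi> (hs[i := x]))
        + complex_of_real (q ^ inversions (length hs) \<pi> * t ^ coinversions (length hs) \<pi>)
          *\<^sub>C tensor (permute_list \<pi> (hs[i := y]))"
      by (simp only: add mem_Collect_eq complex_vector.scale_right_distrib)
  next
    fix hs :: "'a cplx list" and i c x \<pi>
    assume "i < length hs" "\<pi> \<in> {\<pi>. \<pi> permutes {..<length hs}}"
    then show "complex_of_real (q ^ inversions (length hs) \<pi> * t ^ coinversions (length hs) \<pi>)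
          *\<^sub>C tensor (permute_list \<pi> (hs[i := c *\<^sub>C x]))
      = c *\<^sub>C complex_of_real (q ^ inversions (length hs) \<pi> * t ^ coinversions (length hs) \<pi>)
          *\<^sub>C tensor (permute_list \<pi> (hs[i := x]))"
      by (simp only: scale mem_Collect_eq scaleC_scaleC mult.commute)
  qed
qed

lemma qt_operator_tensor:
  "qt_operator q t (tensor hs) = (\<Sum>\<pi> | \<pi> permutes {..<length hs}.
    complex_of_real (q ^ inversions (length hs) \<pi> * t ^ coinversions (length hs) \<pi>)
      *\<^sub>C tensor (permute_list \<pi> hs))"
  unfolding qt_operator_def by (rule lin_ext_tensor[OF multilinear_qt_operator])


section \<open>Creation, annihilation and \<open>t\<^sup>N\<close>\<close>

definition creation :: "'a :: real_vector \<Rightarrow> 'a fock \<Rightarrow> 'a fock"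
  where "creation f = lin_ext (\<lambda>hs. tensor (emb_cplx f # hs))"

text \<open>The index \<open>k\<close> below is \<open>k - 1\<close> in the usual one-based numbering.\<close>

definition annihilation :: "real \<Rightarrow> real \<Rightarrow> 'a :: real_inner \<Rightarrow> 'a fock \<Rightarrow> 'a fock"
  where "annihilation q t f = lin_ext (\<lambda>hs. \<Sum>k<length hs.
    (complex_of_real (q ^ k * t ^ (length hs - Suc k)) * cinner (emb_cplx f) (hs ! k))
      *\<^sub>C tensor (take k hs @ drop (Suc k) hs))"

definition t_power_N :: "real \<Rightarrow> 'a :: real_vector fock \<Rightarrow> 'a fock"
  where "t_power_N t = lin_ext (\<lambda>hs. complex_of_real (t ^ length hs) *\<^sub>C tensor hs)"

lemma multilinear_creation: "multilinear (\<lambda>hs. tensor (emb_cplx f # hs))"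
  unfolding multilinear_def append_Cons[symmetric] tensor_add tensor_scale by blast

lemma multilinear_annihilation:
  fixes f :: "'a :: real_inner"
  shows "multilinear (\<lambda>hs. \<Sum>k<length hs.
    (complex_of_real (q ^ k * t ^ (length hs - Suc k)) * cinner (emb_cplx f) (hs ! k))
      *\<^sub>C tensor (take k hs @ drop (Suc k) hs))"
proof -
  define T where "T hs k = cinner (emb_cplx f) (hs ! k) *\<^sub>C tensor (take k hs @ drop (Suc k) hs)"
    for hs k
  have split: "k < length us \<or> k = length us \<or> (\<exists>j. k = length us + Suc j)"
    for k and us :: "'a cplx list"
    by (cases "k > length us") (auto dest: less_imp_Suc_add)
  have T_add: "T (us @ [x + y] @ vs) k = T (us @ [x] @ vs) k + T (us @ [y] @ vs) k" for us x y vs k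
    using split[of k us]
  proof (elim disjE exE)
    assume "k < length us"
    then show ?thesis
      using tensor_add[of "take k us @ drop (Suc k) us" x y vs]
      by (simp add: T_def nth_append complex_vector.scale_right_distrib)
  next
    assume "k = length us"
    then show ?thesis
      by (simp add: T_def cinner_add_right complex_vector.scale_left_distrib)
  next
    fix j assume "k = length us + Suc j"
    then show ?thesis
      using tensor_add[of us x y "take j vs @ drop (Suc j) vs"]
      by (simp add: T_def nth_append complex_vector.scale_right_distrib)
  qed
  have T_scale: "T (us @ [c *\<^sub>C x] @ vs) k = c *\<^sub>C T (us @ [x] @ vs) k" for us c x vs k
    using split[of k us]
  proof (elim disjE exE)
    assume "k < length us"
    then show ?thesis
      using tensor_scale[of "take k us @ drop (Suc k) us" c x vs]
      by (simp add: T_def nth_append mult.commute)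
  next
    assume "k = length us"
    then show ?thesis
      by (simp add: T_def cinner_scaleC_right scaleC_scaleC)
  next
    fix j assume "k = length us + Suc j"
    then show ?thesis
      using tensor_scale[of us c x "take j vs @ drop (Suc j) vs"]
      by (simp add: T_def nth_append scaleC_scaleC mult.commute)
  qed
  have "multilinear (\<lambda>hs. \<Sum>k<length hs. complex_of_real (q ^ k * t ^ (length hs - Suc k)) *\<^sub>C T hs k)"
    unfolding multilinear_def T_add T_scale
    by (auto simp: complex_vector.scale_sum_right complex_vector.scale_right_distrib
        sum.distrib mult.commute intro!: sum.cong)
  then show ?thesis
    by (simp add: T_def scaleC_scaleC)
qed

lemma multilinear_t_power_N: "multilinear (\<lambda>hs. complex_of_real (t ^ length hs) *\<^sub>C tensor hs)"
  unfolding multilinear_def tensor_add tensor_scale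
  by (simp add: complex_vector.scale_right_distrib mult.commute)

lemma creation_tensor: "creation f (tensor hs) = tensor (emb_cplx f # hs)"
  unfolding creation_def by (rule lin_ext_tensor[OF multilinear_creation])

lemma annihilation_tensor:
  "annihilation q t f (tensor hs) = (\<Sum>k<length hs.
    (complex_of_real (q ^ k * t ^ (length hs - Suc k)) * cinner (emb_cplx f) (hs ! k))
      *\<^sub>C tensor (take k hs @ drop (Suc k) hs))"
  unfolding annihilation_def by (rule lin_ext_tensor[OF multilinear_annihilation])

lemma t_power_N_tensor: "t_power_N t (tensor hs) = complex_of_real (t ^ length hs) *\<^sub>C tensor hs"
  unfolding t_power_N_def by (rule lin_ext_tensor[OF multilinear_t_power_N])

datatype exponent = One | Star

fun ladder :: "real \<Rightarrow> real \<Rightarrow> 'a :: real_inner \<Rightarrow> exponent \<Rightarrow> 'a fock \<Rightarrow> 'a fock"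
  where
    "ladder q t f One = annihilation q t f"
  | "ladder q t f Star = creation f"

text \<open>\<open>ladder_word q t h \<epsilon> m\<close> is the product of the operators with indices \<open>1, \<dots>, m\<close>, in this order.\<close>

definition ladder_word ::
    "real \<Rightarrow> real \<Rightarrow> (nat \<Rightarrow> 'a :: real_inner) \<Rightarrow> (nat \<Rightarrow> exponent) \<Rightarrow> nat \<Rightarrow> 'a fock \<Rightarrow> 'a fock"
  where "ladder_word q t h \<epsilon> m = foldr (\<circ>) (map (\<lambda>i. ladder q t (h i) (\<epsilon> i)) [1..<Suc m]) id"

definition vacuum_state :: "real \<Rightarrow> real \<Rightarrow> ('a :: real_inner fock \<Rightarrow> 'a fock) \<Rightarrow> complex"
  where "vacuum_state q t b = fock_inner q t \<Omega> (b \<Omega>)"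


section \<open>Pair partitions\<close>

text \<open>A block \<open>{w, z}\<close> with \<open>w < z\<close> has \<open>w = Min B\<close> and \<open>z = Max B\<close>.\<close>

definition pair_partitions :: "nat \<Rightarrow> nat set set set"
  where "pair_partitions m = {V. partition_on {1..m} V \<and> (\<forall>B\<in>V. card B = 2)}"

definition crossings :: "nat set set \<Rightarrow> nat"
  where "crossings V =
    card {(B, C). B \<in> V \<and> C \<in> V \<and> Min B < Min C \<and> Min C < Max B \<and> Max B < Max C}"

definition nestings :: "nat set set \<Rightarrow> nat"
  where "nestings V =
    card {(B, C). B \<in> V \<and> C \<in> V \<and> Min B < Min C \<and> Min C < Max C \<and> Max C < Max B}"


section \<open>The completion and bounded operators\<close>

text \<open>The \<open>(q,t)\<close>-Fock space consists of Cauchy sequences modulo null sequences.\<close>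

definition fock_Cauchy :: "real \<Rightarrow> real \<Rightarrow> (nat \<Rightarrow> 'a :: real_inner fock) \<Rightarrow> bool"
  where "fock_Cauchy q t x \<longleftrightarrow>
    (\<forall>e>0. \<exists>M. \<forall>m\<ge>M. \<forall>n\<ge>M. fock_norm q t (x m - x n) < e)"

definition fock_null_rel ::
    "real \<Rightarrow> real \<Rightarrow> ((nat \<Rightarrow> 'a :: real_inner fock) \<times> (nat \<Rightarrow> 'a fock)) set"
  where "fock_null_rel q t = {(x, y). fock_Cauchy q t x \<and> fock_Cauchy q t y \<and>
    (\<lambda>n. fock_norm q t (x n - y n)) \<longlonglongrightarrow> 0}"

definition fock_space :: "real \<Rightarrow> real \<Rightarrow> (nat \<Rightarrow> 'a :: real_inner fock) set set"
  where "fock_space q t = {x. fock_Cauchy q t x} // fock_null_rel q t"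

definition fock_space_norm :: "real \<Rightarrow> real \<Rightarrow> (nat \<Rightarrow> 'a :: real_inner fock) set \<Rightarrow> real"
  where "fock_space_norm q t X =
    (THE l. \<forall>x\<in>X. (\<lambda>n. fock_norm q t (x n)) \<longlonglongrightarrow> l)"

definition fock_space_inner ::
    "real \<Rightarrow> real \<Rightarrow> (nat \<Rightarrow> 'a :: real_inner fock) set \<Rightarrow> (nat \<Rightarrow> 'a fock) set \<Rightarrow> complex"
  where "fock_space_inner q t X Y =
    (THE l. \<forall>x\<in>X. \<forall>y\<in>Y. (\<lambda>n. fock_inner q t (x n) (y n)) \<longlonglongrightarrow> l)"

definition fock_bounded :: "real \<Rightarrow> real \<Rightarrow> ('a :: real_inner fock \<Rightarrow> 'a fock) \<Rightarrow> bool"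
  where "fock_bounded q t T \<longleftrightarrow> (\<exists>C. \<forall>\<xi>. fock_norm q t (T \<xi>) \<le> C * fock_norm q t \<xi>)"

text \<open>
  For a linear map that is bounded on the algebraic Fock space, this is its continuous extension
  to the completion: the class of \<open>x\<close> is sent to the class of \<open>T \<circ> x\<close>.
\<close>

definition fock_extension ::
    "real \<Rightarrow> real \<Rightarrow> ('a :: real_inner fock \<Rightarrow> 'a fock) \<Rightarrow>
      (nat \<Rightarrow> 'a fock) set \<Rightarrow> (nat \<Rightarrow> 'a fock) set"
  where "fock_extension q t T X = (\<Union>x\<in>X. fock_null_rel q t `` {T \<circ> x})"

definition fock_space_bounded ::
    "real \<Rightarrow> real \<Rightarrow> ((nat \<Rightarrow> 'a :: real_inner fock) set \<Rightarrow> (nat \<Rightarrow> 'a fock) set) \<Rightarrow> bool"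
  where "fock_space_bounded q t S \<longleftrightarrow> S ` fock_space q t \<subseteq> fock_space q t \<and>
    (\<exists>C. \<forall>X\<in>fock_space q t. fock_space_norm q t (S X) \<le> C * fock_space_norm q t X)"

definition fock_space_opnorm ::
    "real \<Rightarrow> real \<Rightarrow> ((nat \<Rightarrow> 'a :: real_inner fock) set \<Rightarrow> (nat \<Rightarrow> 'a fock) set) \<Rightarrow> real"
  where "fock_space_opnorm q t S =
    (SUP X\<in>{X \<in> fock_space q t. fock_space_norm q t X \<le> 1}. fock_space_norm q t (S X))"

end

(*
  The weight q^inv t^cinv of a permutation is a product over pairs of positions. Splitting S_(n+1)
  by the position of the letter 0 gives the recursion that makes annihilation the adjoint of
  creation, and writing the weight of tau sigma^(-1) as a product of two-by-two positive
  semidefinite kernels gives positivity of the form by Schur's theorem.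

  The moment formula follows by applying the last annihilation operator of a word to the simple
  tensor built by the creation operators to its right: this removes one block of the pairing
  together with its crossings and nestings.

  For the norms, <a* x, a* x> = q <a x, a x> + |f|^2 t^n <x, x> in degree n. For q <= 0 this bounds
  a* by |f|; for q > 0 it gives by induction on n the bound [n+1] |f|^2 with
  [n] = (t^n - q^n) / (t - q), attained at the tensor powers of f.
*)
theory Submission
  imports Defs
begin

text \<open>Only semidefiniteness of the form is established, so \<open>fock_norm\<close> is handled
  as a seminorm: Cauchy-Schwarz treats null vectors separately, and the quotient by null sequences
  in \<open>fock_space\<close> absorbs them. The operator norm is never computed on the completion.
  \<open>fock_space_opnorm_le_iff\<close> turns each estimate into inequalities on the algebraic
  Fock space. There a and a* admit the same constants, and a bound for a* may be checked degree by
  degree, since different degrees are orthogonal and remain so under a*. The three cases of the norm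
  formula are the three ways in which the supremum of [n] over n \<ge> 1 arises: at n = 1, in the
  limit, or at the index n_*. For the moments, an induction confined to the index sets {1, ..., 2n}
  does not close, because removing a block leaves gaps. Hence words are indexed by arbitrary
  strictly increasing lists and pairings live on arbitrary finite sets of naturals.\<close>

section \<open>Linearity of the operators and sesquilinearity of the form\<close>

lemma fock_induct [case_names tensor add scale]:
  fixes \<xi> :: "'a :: real_vector fock"
  assumes tensor: "\<And>hs. P (tensor hs)"
    and add: "\<And>x y. P x \<Longrightarrow> P y \<Longrightarrow> P (x + y)"
    and scale: "\<And>c x. P x \<Longrightarrow> P (c *\<^sub>C x)"
  shows "P \<xi>"
proof -
  have zero: "P 0"
    using scale[OF tensor, of 0 "[]"] by simp
  have "P (\<Sum>hs\<in>A. c hs *\<^sub>C tensor hs)" if "finite A" for A c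
    using that by (induction A) (auto intro: assms zero)
  then show ?thesis
    by (subst fock_tensor_expansion) simp
qed

lemma clinear_fock_inner0: "clinear (fock_inner0 \<eta>)"
  using clinear_lin_ext[OF multilinear_fock_inner0, of \<eta>]
  by (simp add: fock_inner0_def[abs_def])

lemma clinear_qt_operator: "clinear (qt_operator q t)"
  unfolding qt_operator_def by (rule clinear_lin_ext[OF multilinear_qt_operator])

lemma clinear_creation: "clinear (creation f)"
  unfolding creation_def by (rule clinear_lin_ext[OF multilinear_creation])

lemma clinear_annihilation: "clinear (annihilation q t f)"
  unfolding annihilation_def by (rule clinear_lin_ext[OF multilinear_annihilation])

lemma clinear_t_power_N: "clinear (t_power_N t)"
  unfolding t_power_N_def by (rule clinear_lin_ext[OF multilinear_t_power_N])

lemma clinearD: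
  assumes "clinear f"
  shows "f (x + y) = f x + f y" "f (c *\<^sub>C x) = c *\<^sub>C f x" "f 0 = 0" "f (x - y) = f x - f y"
proof -
  show add: "f (x + y) = f x + f y" for x y
    using assms by (simp add: clinear_iff)
  show scale: "f (c *\<^sub>C x) = c *\<^sub>C f x" for c x
    using assms by (simp add: clinear_iff)
  show "f 0 = 0"
    using scale[of 0 0] by simp
  show "f (x - y) = f x - f y"
    using add[of "x - y" y] by (simp add: algebra_simps)
qed

lemma fock_inner_add_right: "fock_inner q t \<eta> (\<xi> + \<xi>') = fock_inner q t \<eta> \<xi> + fock_inner q t \<eta> \<xi>'"
  by (simp add: fock_inner_def clinearD[OF clinear_fock_inner0] clinearD[OF clinear_qt_operator])

lemma fock_inner_scale_right: "fock_inner q t \<eta> (c *\<^sub>C \<xi>) = c * fock_inner q t \<eta> \<xi>"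
  by (simp add: fock_inner_def clinearD[OF clinear_fock_inner0] clinearD[OF clinear_qt_operator]
      scaleC_complex_def)

text \<open>The left argument of \<open>fock_inner0\<close> sits inside the function being extended,
  so linearity on the left rests on linearity of \<open>lin_ext\<close> in that function. Both sides
  use the same representative of \<open>\<xi>\<close>, which makes this termwise.\<close>

lemma lin_ext_fun_add: "lin_ext (\<lambda>hs. \<phi> hs + \<psi> hs) \<xi> = lin_ext \<phi> \<xi> + lin_ext \<psi> \<xi>"
  by (simp add: lin_ext_def free_ext_def scaleC_add_right sum.distrib)

lemma lin_ext_fun_mult: "lin_ext (\<lambda>hs. c * \<phi> hs :: complex) \<xi> = c * lin_ext \<phi> \<xi>"
  by (simp add: lin_ext_def free_ext_def scaleC_complex_def sum_distrib_left mult_ac)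

lemmas clinear_simple_inner_left = clinear_lin_ext[OF multilinear_simple_inner_left]

lemma fock_inner_add_left: "fock_inner q t (\<eta> + \<eta>') \<xi> = fock_inner q t \<eta> \<xi> + fock_inner q t \<eta>' \<xi>"
  by (simp add: fock_inner_def fock_inner0_def clinearD[OF clinear_simple_inner_left] lin_ext_fun_add)

lemma fock_inner_scale_left: "fock_inner q t (c *\<^sub>C \<eta>) \<xi> = cnj c * fock_inner q t \<eta> \<xi>"
  by (simp add: fock_inner_def fock_inner0_def clinearD[OF clinear_simple_inner_left]
      scaleC_complex_def lin_ext_fun_mult)


section \<open>The weight of a permutation\<close>

definition pair_set :: "nat \<Rightarrow> (nat \<times> nat) set"
  where "pair_set n = {(i, j). i < j \<and> j < n}"

definition qt_weight :: "real \<Rightarrow> real \<Rightarrow> nat \<Rightarrow> (nat \<Rightarrow> nat) \<Rightarrow> real"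
  where "qt_weight q t n \<pi> = (\<Prod>(i, j)\<in>pair_set n. if \<pi> j < \<pi> i then q else t)"

lemma finite_pair_set [simp]: "finite (pair_set n)"
  by (rule finite_subset[of _ "{..<n} \<times> {..<n}"]) (auto simp: pair_set_def)

text \<open>A permutation has no ties, so the pairs that fall into the \<open>else\<close> branch of
  \<open>qt_weight\<close> are exactly the coinversions.\<close>

lemma qt_weight_eq:
  assumes "\<pi> permutes {..<n}"
  shows "q ^ inversions n \<pi> * t ^ coinversions n \<pi> = qt_weight q t n \<pi>"
proof -
  let ?I = "{p. \<pi> (snd p) < \<pi> (fst p)}"
  have "pair_set n \<inter> ?I = {(i, j). i < j \<and> j < n \<and> \<pi> i > \<pi> j}"
    by (auto simp: pair_set_def)
  moreover have "pair_set n \<inter> - ?I = {(i, j). i < j \<and> j < n \<and> \<pi> i < \<pi> j}"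
  proof -
    have "\<not> \<pi> j < \<pi> i \<longleftrightarrow> \<pi> i < \<pi> j" if "i < j" for i j
      using that inj_eq[OF permutes_inj[OF assms], of i j] by auto
    then show ?thesis
      by (auto simp: pair_set_def)
  qed
  ultimately show ?thesis
    by (simp add: qt_weight_def case_prod_beta prod.If_cases inversions_def coinversions_def)
qed

text \<open>Every pair of positions of \<open>\<tau> \<circ> inv \<sigma>\<close> is the image under
  \<open>\<sigma>\<close> of a unique pair \<open>a, b\<close>, and it is an inversion exactly when
  \<open>\<sigma>\<close> and \<open>\<tau>\<close> order \<open>a\<close> and \<open>b\<close>
  oppositely. The resulting expression is symmetric in the two permutations and sees only one bit of
  each per factor, which serves both hermitian symmetry and positivity.\<close>

lemma qt_weight_compose_inv:
  assumes \<sigma>: "\<sigma> permutes {..<n}" and \<tau>: "\<tau> permutes {..<n}"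
  shows "qt_weight q t n (\<tau> \<circ> inv \<sigma>)
    = (\<Prod>(a, b)\<in>pair_set n. if (\<sigma> a < \<sigma> b) = (\<tau> a < \<tau> b) then t else q)"
proof -
  \<comment> \<open>The image pair under \<open>\<sigma>\<close> has to be sorted again to lie in
    \<open>pair_set n\<close>. Being an injective self-map of a finite set, \<open>F\<close> is
    onto.\<close>
  define F where "F = (\<lambda>(a, b). if \<sigma> a < \<sigma> b then (\<sigma> a, \<sigma> b) else (\<sigma> b, \<sigma> a))"
  have in_n: "\<sigma> k < n \<longleftrightarrow> k < n" for k
    using permutes_in_image[OF \<sigma>, of k] by simp
  have inj: "\<sigma> a = \<sigma> b \<longleftrightarrow> a = b" "\<tau> a = \<tau> b \<longleftrightarrow> a = b" for a b
    using permutes_inj[OF \<sigma>] permutes_inj[OF \<tau>] by (auto dest: injD)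
  have "inj_on F (pair_set n)"
    by (auto simp: inj_on_def F_def pair_set_def inj split: if_splits)
  moreover have "F ` pair_set n \<subseteq> pair_set n"
  proof (rule image_subsetI, clarify)
    fix a b assume "(a, b) \<in> pair_set n"
    then have "\<sigma> a \<noteq> \<sigma> b" "\<sigma> a < n" "\<sigma> b < n"
      by (auto simp: pair_set_def inj in_n)
    then show "F (a, b) \<in> pair_set n"
      by (auto simp: F_def pair_set_def)
  qed
  ultimately have bij: "bij_betw F (pair_set n) (pair_set n)"
    unfolding bij_betw_def using endo_inj_surj[OF finite_pair_set] by blast
  have "qt_weight q t n (\<tau> \<circ> inv \<sigma>)
      = (\<Prod>p\<in>pair_set n. case F p of (i, j) \<Rightarrow> if (\<tau> \<circ> inv \<sigma>) j < (\<tau> \<circ> inv \<sigma>) i then q else t)"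
    unfolding qt_weight_def by (rule prod.reindex_bij_betw[OF bij, symmetric])
  also have "\<dots> = (\<Prod>(a, b)\<in>pair_set n. if (\<sigma> a < \<sigma> b) = (\<tau> a < \<tau> b) then t else q)"
  proof (rule prod.cong[OF refl], clarify)
    fix a b assume "(a, b) \<in> pair_set n"
    then have "a \<noteq> b" by (auto simp: pair_set_def)
    then have "\<tau> a \<noteq> \<tau> b" "\<sigma> a \<noteq> \<sigma> b"
      by (simp_all add: inj)
    then show "(case F (a, b) of (i, j) \<Rightarrow> if (\<tau> \<circ> inv \<sigma>) j < (\<tau> \<circ> inv \<sigma>) i then q else t)
        = (if (\<sigma> a < \<sigma> b) = (\<tau> a < \<tau> b) then t else q)"
      by (auto simp: F_def permutes_inverses[OF \<sigma>])
  qed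
  finally show ?thesis .
qed

text \<open>This is the symmetry of \<open>qt_weight_compose_inv\<close>, used with one of the two
  permutations equal to the identity.\<close>

lemma qt_weight_inv:
  assumes "\<sigma> permutes {..<n}"
  shows "qt_weight q t n (inv \<sigma>) = qt_weight q t n \<sigma>"
proof -
  have "qt_weight q t n (id \<circ> inv \<sigma>) = qt_weight q t n (\<sigma> \<circ> inv id)"
    unfolding qt_weight_compose_inv[OF assms permutes_id] qt_weight_compose_inv[OF permutes_id assms]
    by (rule prod.cong) auto
  then show ?thesis by simp
qed

lemma fock_inner_tensor:
  "fock_inner q t (tensor gs) (tensor hs) =
    (if length gs = length hs
     then \<Sum>\<pi> | \<pi> permutes {..<length hs}.
       complex_of_real (qt_weight q t (length hs) \<pi>) * (\<Prod>k<length hs. cinner (gs ! k) (hs ! \<pi> k))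
     else 0)"
proof -
  have "fock_inner q t (tensor gs) (tensor hs) = (\<Sum>\<pi> | \<pi> permutes {..<length hs}.
      complex_of_real (qt_weight q t (length hs) \<pi>) * simple_inner gs (permute_list \<pi> hs))"
    unfolding fock_inner_def qt_operator_tensor clinear_sum[OF clinear_fock_inner0]
      clinearD(2)[OF clinear_fock_inner0] fock_inner0_tensor scaleC_complex_def
    by (intro sum.cong refl) (simp add: qt_weight_eq)
  then show ?thesis
    by (auto simp: simple_inner_def permute_list_nth intro!: sum.cong)
qed

text \<open>Summing over inverse permutations leaves the weights unchanged and, once the product is
  reindexed by \<open>\<pi>\<close>, exchanges the roles of the two tensors.\<close>

lemma fock_inner_tensor_commute:
  "fock_inner q t (tensor gs) (tensor hs) = cnj (fock_inner q t (tensor hs) (tensor gs))"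
proof (cases "length gs = length hs")
  case True
  let ?n = "length hs"
  have "fock_inner q t (tensor gs) (tensor hs) = (\<Sum>\<pi> | \<pi> permutes {..<?n}.
      complex_of_real (qt_weight q t ?n (inv \<pi>)) * (\<Prod>k<?n. cinner (gs ! k) (hs ! inv \<pi> k)))"
    unfolding fock_inner_tensor
    using True sum_permutations_inverse[of "\<lambda>\<pi>. complex_of_real (qt_weight q t ?n \<pi>)
      * (\<Prod>k<?n. cinner (gs ! k) (hs ! \<pi> k))" "{..<?n}"] by simp
  also have "\<dots> = cnj (fock_inner q t (tensor hs) (tensor gs))"
  proof -
    have "(\<Prod>k<?n. cinner (gs ! k) (hs ! inv \<pi> k)) = (\<Prod>k<?n. cnj (cinner (hs ! k) (gs ! \<pi> k)))"
      if \<pi>: "\<pi> permutes {..<?n}" for \<pi>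
    proof -
      have "(\<Prod>k<?n. cinner (gs ! k) (hs ! inv \<pi> k))
          = (\<Prod>k<?n. cinner (gs ! \<pi> k) (hs ! inv \<pi> (\<pi> k)))"
        by (rule prod.reindex_bij_betw[OF permutes_imp_bij[OF \<pi>], symmetric])
      then show ?thesis
        by (simp add: permutes_inverses[OF \<pi>] cinner_commute[of "gs ! _"])
    qed
    then show ?thesis
      using True by (auto simp: fock_inner_tensor qt_weight_inv intro!: sum.cong)
  qed
  finally show ?thesis .
qed (simp add: fock_inner_tensor)

lemma fock_inner_commute: "fock_inner q t \<eta> \<xi> = cnj (fock_inner q t \<xi> \<eta>)"
proof (induction \<xi> rule: fock_induct)
  case (tensor hs)
  show ?case
    by (induction \<eta> rule: fock_induct)
      (simp_all add: fock_inner_add_left fock_inner_add_right fock_inner_scale_left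
        fock_inner_scale_right flip: fock_inner_tensor_commute)
qed (simp_all add: fock_inner_add_left fock_inner_add_right fock_inner_scale_left
        fock_inner_scale_right)


section \<open>Adjointness\<close>

text \<open>Splits \<open>S\<^sub>n\<^sub>+\<^sub>1\<close> according to the position of \<open>0\<close>.\<close>

definition skip :: "nat \<Rightarrow> nat \<Rightarrow> nat"
  where "skip m k = (if k < m then k else Suc k)"

definition lift_perm :: "nat \<Rightarrow> (nat \<Rightarrow> nat) \<Rightarrow> nat \<Rightarrow> nat"
  where "lift_perm m \<sigma> k = (if k < m then Suc (\<sigma> k) else if k = m then 0 else Suc (\<sigma> (k - 1)))"

lemma lift_perm_skip [simp]: "lift_perm m \<sigma> (skip m k) = Suc (\<sigma> k)"
  by (simp add: lift_perm_def skip_def)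

lemma lift_perm_self [simp]: "lift_perm m \<sigma> m = 0"
  by (simp add: lift_perm_def)

lemma lift_perm_eq_0 [simp]: "lift_perm m \<sigma> k = 0 \<longleftrightarrow> k = m"
  by (simp add: lift_perm_def)

lemma skip_less_iff [simp]: "skip m i < skip m j \<longleftrightarrow> i < j"
  by (auto simp: skip_def)

lemma skip_neq [simp]: "skip m k \<noteq> m" "m \<noteq> skip m k"
  by (auto simp: skip_def)

lemma skip_cases:
  obtains "k = m" | j where "k = skip m j"
proof (cases k m rule: linorder_cases)
  case less
  then show ?thesis using that(2)[of k] by (simp add: skip_def)
next
  case greater
  then show ?thesis using that(2)[of "k - 1"] by (simp add: skip_def)
qed (use that in auto)

lemma inj_skip: "inj (skip m)"
  by (auto simp: inj_def skip_def split: if_splits)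

lemma lift_perm_permutes:
  assumes "\<sigma> permutes {..<n}" "m < Suc n"
  shows "lift_perm m \<sigma> permutes {..<Suc n}"
proof -
  have "inj (lift_perm m \<sigma>)"
  proof (rule injI)
    fix x y assume eq: "lift_perm m \<sigma> x = lift_perm m \<sigma> y"
    show "x = y"
    proof (cases x rule: skip_cases[of _ m]; cases y rule: skip_cases[of _ m])
      fix i j assume "x = skip m i" "y = skip m j"
      then show ?thesis
        using eq inj_eq[OF permutes_inj[OF assms(1)]] by simp
    qed (use eq in auto)
  qed
  moreover have "\<sigma> k < n" if "k < n" for k
    using permutes_in_image[OF assms(1), of k] that by simp
  then have "lift_perm m \<sigma> ` {..<Suc n} \<subseteq> {..<Suc n}"
    using assms(2) by (auto simp: lift_perm_def)
  moreover have "lift_perm m \<sigma> k = k" if "k \<notin> {..<Suc n}" for k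
    using that assms(2) permutes_not_in[OF assms(1), of "k - 1"] by (auto simp: lift_perm_def)
  ultimately show ?thesis
    using endo_inj_surj[of "{..<Suc n}" "lift_perm m \<sigma>"]
    by (intro bij_imp_permutes) (auto simp: bij_betw_def intro: inj_on_subset)
qed

text \<open>The position of the letter 0 recovers \<open>m\<close> and the other letters recover
  \<open>\<sigma>\<close>, which gives injectivity. Surjectivity follows by counting, as
  \<open>(n + 1) * n! = (n + 1)!\<close>.\<close>

lemma bij_betw_lift_perm:
  "bij_betw (\<lambda>(m, \<sigma>). lift_perm m \<sigma>) ({..<Suc n} \<times> {\<sigma>. \<sigma> permutes {..<n}})
    {\<pi>. \<pi> permutes {..<Suc n}}" (is "bij_betw ?f ?A ?B")
proof -
  have inj: "inj_on ?f ?A"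
  proof (rule inj_onI, clarify)
    fix m \<sigma> m' \<sigma>' assume eq: "lift_perm m \<sigma> = lift_perm m' \<sigma>'"
    have "m = m'"
      using lift_perm_eq_0[of m' \<sigma>' m] by (simp flip: eq)
    moreover have "\<sigma> k = \<sigma>' k" for k
      using eq \<open>m = m'\<close> by (metis lift_perm_skip nat.inject)
    ultimately show "m = m' \<and> \<sigma> = \<sigma>'" by auto
  qed
  moreover have sub: "?f ` ?A \<subseteq> ?B"
    by (auto intro: lift_perm_permutes)
  moreover have "card ?A = card ?B"
    by (simp add: card_permutations[of "{..<n}" n] card_permutations[of "{..<Suc n}" "Suc n"]
        card_cartesian_product)
  ultimately show ?thesis
    by (simp add: bij_betw_def card_image card_subset_eq finite_permutations)
qed

text \<open>The letter 0 at position \<open>m\<close> is the smallest one, so it forms inversions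
  with the \<open>m\<close> positions before it and coinversions with the \<open>n - m\<close>
  positions after it. All other pairs are those of \<open>\<sigma>\<close>, because
  \<open>skip m\<close> preserves order.\<close>

lemma qt_weight_lift_perm:
  assumes "m < Suc n"
  shows "qt_weight q t (Suc n) (lift_perm m \<sigma>) = q ^ m * t ^ (n - m) * qt_weight q t n \<sigma>"
proof -
  define g where "g = (\<lambda>(i, j). if lift_perm m \<sigma> j < lift_perm m \<sigma> i then q else t)"
  define S where "S = (\<lambda>(i, j). (skip m i, skip m j))"
  have eq: "pair_set (Suc n) = (\<lambda>i. (i, m)) ` {..<m} \<union> Pair m ` {m<..n} \<union> S ` pair_set n"
    (is "_ = ?A \<union> ?B \<union> ?C")
  proof (intro equalityI subsetI)
    fix p assume "p \<in> pair_set (Suc n)"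
    then obtain i j where p: "p = (i, j)" "i < j" "j < Suc n"
      by (auto simp: pair_set_def)
    show "p \<in> ?A \<union> ?B \<union> ?C"
    proof (cases i rule: skip_cases[of _ m]; cases j rule: skip_cases[of _ m])
      fix a b assume "i = skip m a" "j = skip m b"
      moreover from this have "(a, b) \<in> pair_set n"
        using p assms by (auto simp: pair_set_def skip_def split: if_splits)
      ultimately have "p \<in> ?C"
        using p by (auto simp: S_def intro!: image_eqI[where x = "(a, b)"])
      then show ?thesis by blast
    qed (use p in auto)
  next
    fix p assume "p \<in> ?A \<union> ?B \<union> ?C"
    then show "p \<in> pair_set (Suc n)"
      using assms by (auto simp: pair_set_def S_def) (auto simp: skip_def)
  qed
  have "inj_on S (pair_set n)"
    using injD[OF inj_skip] by (auto simp: inj_on_def S_def)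
  then have C: "prod g ?C = qt_weight q t n \<sigma>"
    by (subst prod.reindex) (auto simp: qt_weight_def g_def S_def intro!: prod.cong)
  have A: "prod g ?A = q ^ m"
    by (subst prod.reindex) (auto simp: inj_on_def g_def lift_perm_def)
  have B: "prod g ?B = t ^ (n - m)"
    by (subst prod.reindex) (auto simp: inj_on_def g_def lift_perm_def)
  have "qt_weight q t (Suc n) (lift_perm m \<sigma>) = prod g (?A \<union> ?B \<union> ?C)"
    by (simp only: qt_weight_def g_def eq)
  also have "\<dots> = prod g ?A * prod g ?B * prod g ?C"
    by (subst prod.union_disjoint, simp, simp, force simp: S_def)
      (subst prod.union_disjoint, auto)
  finally show ?thesis
    by (simp only: A B C)
qed

text \<open>The sum is a \<open>(q,t)\<close>-deformed permanent of the matrix \<open>F\<close>, and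
  this is its Laplace expansion along column 0.\<close>

lemma sum_permutations_lift:
  fixes F :: "nat \<Rightarrow> nat \<Rightarrow> complex"
  shows "(\<Sum>\<pi> | \<pi> permutes {..<Suc n}. complex_of_real (qt_weight q t (Suc n) \<pi>) * (\<Prod>k<Suc n. F k (\<pi> k)))
    = (\<Sum>m<Suc n. complex_of_real (q ^ m * t ^ (n - m)) * F m 0 *
        (\<Sum>\<sigma> | \<sigma> permutes {..<n}. complex_of_real (qt_weight q t n \<sigma>)
          * (\<Prod>k<n. F (skip m k) (Suc (\<sigma> k)))))"
proof -
  have prod: "(\<Prod>k<Suc n. F k (lift_perm m \<sigma> k)) = F m 0 * (\<Prod>k<n. F (skip m k) (Suc (\<sigma> k)))"
    if "m < Suc n" for m \<sigma>
  proof -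
    have "{..<Suc n} - {m} = skip m ` {..<n}"
    proof (intro equalityI subsetI)
      fix k assume "k \<in> {..<Suc n} - {m}"
      then show "k \<in> skip m ` {..<n}"
        using that by (cases k rule: skip_cases[of _ m]) (auto simp: skip_def split: if_splits)
    next
      fix k assume "k \<in> skip m ` {..<n}"
      then show "k \<in> {..<Suc n} - {m}" by (auto simp: skip_def)
    qed
    then show ?thesis
      using that
      by (subst prod.remove[of _ m]) (simp_all add: prod.reindex inj_on_subset[OF inj_skip])
  qed
  define G where "G \<pi> = complex_of_real (qt_weight q t (Suc n) \<pi>) * (\<Prod>k<Suc n. F k (\<pi> k))" for \<pi>
  have "sum G {\<pi>. \<pi> permutes {..<Suc n}}
      = (\<Sum>(m, \<sigma>)\<in>{..<Suc n} \<times> {\<sigma>. \<sigma> permutes {..<n}}. G (lift_perm m \<sigma>))"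
    by (subst sum.reindex_bij_betw[OF bij_betw_lift_perm, symmetric]) (simp add: case_prod_beta)
  also have "\<dots> = (\<Sum>m<Suc n. \<Sum>\<sigma> | \<sigma> permutes {..<n}. G (lift_perm m \<sigma>))"
    by (rule sum.cartesian_product[symmetric])
  also have "\<dots> = (\<Sum>m<Suc n. complex_of_real (q ^ m * t ^ (n - m)) * F m 0 *
        (\<Sum>\<sigma> | \<sigma> permutes {..<n}. complex_of_real (qt_weight q t n \<sigma>)
          * (\<Prod>k<n. F (skip m k) (Suc (\<sigma> k)))))"
    unfolding sum_distrib_left
    by (intro sum.cong refl) (simp add: G_def prod qt_weight_lift_perm mult_ac del: prod.lessThan_Suc)
  finally show ?thesis
    unfolding G_def .
qed

text \<open>\<open>creation\<close> puts \<open>f\<close> at index 0 of the right-hand tensor.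
  Expanding the deformed permanent along that column deletes one factor of \<open>gs\<close> at a
  time, with exactly the coefficients in the definition of \<open>annihilation\<close>.\<close>

lemma fock_inner_annihilation_tensor:
  "fock_inner q t (annihilation q t f (tensor gs)) (tensor hs)
    = fock_inner q t (tensor gs) (creation f (tensor hs))"
proof -
  let ?d = "\<lambda>k. take k gs @ drop (Suc k) gs"
  have lin: "fock_inner q t (sum x A) \<eta> = (\<Sum>a\<in>A. fock_inner q t (x a) \<eta>)"
    if "finite A" for A \<eta> and x :: "nat \<Rightarrow> 'a fock"
    using that fock_inner_scale_left[of q t 0 0 \<eta>]
    by (induction A) (simp_all add: fock_inner_add_left)
  have len: "length (?d k) = length gs - 1" if "k < length gs" for k
    using that by auto
  have lhs: "fock_inner q t (annihilation q t f (tensor gs)) (tensor hs) = (\<Sum>k<length gs.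
      complex_of_real (q ^ k * t ^ (length gs - Suc k)) * cinner (gs ! k) (emb_cplx f)
        * fock_inner q t (tensor (?d k)) (tensor hs))"
    unfolding annihilation_tensor
    by (simp add: lin fock_inner_scale_left flip: cinner_commute[of "gs ! _" "emb_cplx f"])
  show ?thesis
  proof (cases "length gs = Suc (length hs)")
    case False
    then show ?thesis
      unfolding lhs creation_tensor
      by (auto simp: fock_inner_tensor len intro!: sum.neutral)
  next
    case True
    let ?n = "length hs"
    have nth: "?d m ! k = gs ! skip m k" if "m < Suc ?n" "k < ?n" for m k
      using that True by (auto simp: nth_append skip_def)
    have "fock_inner q t (tensor gs) (creation f (tensor hs)) = (\<Sum>m<Suc ?n.
        complex_of_real (q ^ m * t ^ (?n - m)) * cinner (gs ! m) (emb_cplx f) *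
        (\<Sum>\<sigma> | \<sigma> permutes {..<?n}. complex_of_real (qt_weight q t ?n \<sigma>)
          * (\<Prod>k<?n. cinner (gs ! skip m k) (hs ! \<sigma> k))))"
      using sum_permutations_lift[of q t ?n "\<lambda>k j. cinner (gs ! k) ((emb_cplx f # hs) ! j)"] True
      by (simp add: creation_tensor fock_inner_tensor del: sum.lessThan_Suc prod.lessThan_Suc)
    also have "\<dots> = (\<Sum>k<length gs. complex_of_real (q ^ k * t ^ (length gs - Suc k))
        * cinner (gs ! k) (emb_cplx f) * fock_inner q t (tensor (?d k)) (tensor hs))"
    proof (rule sum.cong)
      fix m assume "m \<in> {..<length gs}"
      then have m: "m < Suc ?n" using True by simp
      then have "length (?d m) = ?n" using len[of m] True by simp
      then show "complex_of_real (q ^ m * t ^ (?n - m)) * cinner (gs ! m) (emb_cplx f) *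
        (\<Sum>\<sigma> | \<sigma> permutes {..<?n}. complex_of_real (qt_weight q t ?n \<sigma>)
          * (\<Prod>k<?n. cinner (gs ! skip m k) (hs ! \<sigma> k)))
        = complex_of_real (q ^ m * t ^ (length gs - Suc m))
        * cinner (gs ! m) (emb_cplx f) * fock_inner q t (tensor (?d m)) (tensor hs)"
        unfolding fock_inner_tensor using True by (simp add: nth[OF m] del: drop_Suc)
    qed (simp add: True)
    finally show ?thesis by (simp only: lhs)
  qed
qed

lemma fock_inner_annihilation:
  "fock_inner q t (annihilation q t f \<xi>) \<eta> = fock_inner q t \<xi> (creation f \<eta>)"
proof (induction \<xi> rule: fock_induct)
  case (tensor hs)
  show ?case
    by (induction \<eta> rule: fock_induct)
      (simp_all add: fock_inner_annihilation_tensor clinearD[OF clinear_creation]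
        fock_inner_add_right fock_inner_scale_right)
qed (simp_all add: clinearD[OF clinear_annihilation] fock_inner_add_left fock_inner_scale_left)

lemma fock_inner_creation:
  "fock_inner q t (creation f \<xi>) \<eta> = fock_inner q t \<xi> (annihilation q t f \<eta>)"
  by (metis fock_inner_annihilation fock_inner_commute)


section \<open>The commutation relation\<close>

text \<open>The term \<open>k = 0\<close> hits the new letter \<open>g\<close> and carries the full
  power of \<open>t\<close>. In every other term the index has moved up by one, which costs a factor
  \<open>q\<close>, while the number of letters to the right is unchanged.\<close>

lemma annihilation_creation_tensor:
  "annihilation q t f (creation g (tensor hs))
    = complex_of_real q *\<^sub>C creation g (annihilation q t f (tensor hs))
      + complex_of_real (inner f g) *\<^sub>C t_power_N t (tensor hs)"
proof -
  have "annihilation q t f (creation g (tensor hs)) =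
      complex_of_real (inner f g * t ^ length hs) *\<^sub>C tensor hs +
      (\<Sum>k<length hs. (complex_of_real (q * (q ^ k * t ^ (length hs - Suc k))) * cinner (emb_cplx f) (hs ! k))
        *\<^sub>C tensor (emb_cplx g # take k hs @ drop (Suc k) hs))"
    unfolding creation_tensor annihilation_tensor
    by (simp add: sum.lessThan_Suc_shift cinner_emb_cplx mult_ac del: sum.lessThan_Suc)
  then show ?thesis
    by (simp add: annihilation_tensor t_power_N_tensor clinear_sum[OF clinear_creation]
        clinearD[OF clinear_creation] creation_tensor complex_vector.scale_sum_right scaleC_scaleC mult_ac)
qed

lemma annihilation_creation:
  "annihilation q t f (creation g \<xi>)
    = complex_of_real q *\<^sub>C creation g (annihilation q t f \<xi>)
      + complex_of_real (inner f g) *\<^sub>C t_power_N t \<xi>"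
proof (induction \<xi> rule: fock_induct)
  case (add x y)
  then show ?case
    by (simp add: clinearD[OF clinear_creation] clinearD[OF clinear_annihilation]
        clinearD[OF clinear_t_power_N] scaleC_add_right)
next
  case (scale c x)
  then show ?case
    by (simp add: clinearD[OF clinear_creation] clinearD[OF clinear_annihilation]
        clinearD[OF clinear_t_power_N] scaleC_add_right mult.commute)
qed (rule annihilation_creation_tensor)


section \<open>Positivity\<close>

definition psd_kernel :: "'i set \<Rightarrow> ('i \<Rightarrow> 'i \<Rightarrow> complex) \<Rightarrow> bool"
  where "psd_kernel I K \<longleftrightarrow> (\<forall>c. 0 \<le> Re (\<Sum>i\<in>I. \<Sum>j\<in>I. cnj (c i) * c j * K i j))"

text \<open>Schur products are phrased as preservation of positivity because such multipliers
  compose: a product of any finite number of them is handled factor by factor, starting from the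
  constant kernel 1.\<close>

definition psd_multiplier :: "'i set \<Rightarrow> ('i \<Rightarrow> 'i \<Rightarrow> complex) \<Rightarrow> bool"
  where "psd_multiplier I G \<longleftrightarrow> (\<forall>K. psd_kernel I K \<longrightarrow> psd_kernel I (\<lambda>i j. K i j * G i j))"

lemma psd_kernel_one: "psd_kernel I (\<lambda>i j. 1)"
proof -
  have eq: "(\<Sum>i\<in>I. \<Sum>j\<in>I. cnj (c i) * c j * 1) = cnj (sum c I) * sum c I" for c
    by (simp add: sum_product)
  have "0 \<le> Re (cnj z * z)" for z
    by simp
  then show ?thesis
    unfolding psd_kernel_def eq by blast
qed

text \<open>The form of the kernel \<open>K * G\<close> at \<open>c\<close> is the sum over
  \<open>e\<close> of \<open>\<alpha> e\<close> times the form of \<open>K\<close> at the pointwise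
  product of \<open>c\<close> and \<open>v e\<close>.\<close>

lemma psd_multiplier_gram:
  assumes "finite E" "\<And>e. e \<in> E \<Longrightarrow> 0 \<le> \<alpha> e"
    and G: "\<And>i j. i \<in> I \<Longrightarrow> j \<in> I \<Longrightarrow> G i j = (\<Sum>e\<in>E. complex_of_real (\<alpha> e) * cnj (v e i) * v e j)"
  shows "psd_multiplier I G"
  unfolding psd_multiplier_def
proof (intro allI impI)
  fix K assume K: "psd_kernel I K"
  show "psd_kernel I (\<lambda>i j. K i j * G i j)"
    unfolding psd_kernel_def
  proof
    fix c
    have "(\<Sum>i\<in>I. \<Sum>j\<in>I. cnj (c i) * c j * (K i j * G i j))
        = (\<Sum>i\<in>I. \<Sum>j\<in>I. \<Sum>e\<in>E. complex_of_real (\<alpha> e) * (cnj (c i * v e i) * (c j * v e j) * K i j))"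
      by (intro sum.cong refl) (simp add: G sum_distrib_left mult_ac)
    also have "\<dots> = (\<Sum>i\<in>I. \<Sum>e\<in>E. \<Sum>j\<in>I. complex_of_real (\<alpha> e) * (cnj (c i * v e i) * (c j * v e j) * K i j))"
      by (intro sum.cong refl sum.swap)
    also have "\<dots> = (\<Sum>e\<in>E. complex_of_real (\<alpha> e) *
        (\<Sum>i\<in>I. \<Sum>j\<in>I. cnj (c i * v e i) * (c j * v e j) * K i j))"
      unfolding sum_distrib_left
      by (rule sum.swap)
    also have "Re \<dots> = (\<Sum>e\<in>E. \<alpha> e *
        Re (\<Sum>i\<in>I. \<Sum>j\<in>I. cnj (c i * v e i) * (c j * v e j) * K i j))"
      by simp
    also have "\<dots> \<ge> 0"
      by (intro sum_nonneg mult_nonneg_nonneg assms(2) K[unfolded psd_kernel_def, rule_format])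
    finally show "0 \<le> Re (\<Sum>i\<in>I. \<Sum>j\<in>I. cnj (c i) * c j * (K i j * G i j))" .
  qed
qed

lemma psd_multiplier_prod:
  assumes "finite A" "\<And>a. a \<in> A \<Longrightarrow> psd_multiplier I (G a)"
  shows "psd_multiplier I (\<lambda>i j. \<Prod>a\<in>A. G a i j)"
  using assms
proof (induction A)
  case empty
  then show ?case by (simp add: psd_multiplier_def)
next
  case (insert a A)
  then have "psd_multiplier I (G a)" "psd_multiplier I (\<lambda>i j. \<Prod>a\<in>A. G a i j)"
    by auto
  then have "psd_kernel I (\<lambda>i j. K i j * G a i j * (\<Prod>a\<in>A. G a i j))" if "psd_kernel I K" for K
    using that by (simp add: psd_multiplier_def)
  then show ?case
    using insert.hyps by (simp add: psd_multiplier_def mult.assoc)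
qed

text \<open>\<open>C\<close> is orthogonal but not normalised, and it may contain the zero vector;
  the convention \<open>inverse 0 = 0\<close> then discards that term.\<close>

lemma inner_orthogonal_expansion:
  fixes x y :: "'a :: real_inner"
  assumes "finite C" "pairwise orthogonal C" "y \<in> span C"
  shows "inner x y = (\<Sum>e\<in>C. inverse (inner e e) * inner x e * inner y e)"
  using assms(3)
proof (induction rule: span_induct)
  case base
  then show ?case
    by (auto simp: subspace_def inner_add_left inner_add_right sum.distrib distrib_left
        distrib_right sum_distrib_left mult_ac)
next
  case (step b)
  have "(\<Sum>e\<in>C. inverse (inner e e) * inner x e * inner b e)
      = (\<Sum>e\<in>C. if e = b then inner x b else 0)"
  proof (rule sum.cong[OF refl])
    fix e assume "e \<in> C"
    then show "inverse (inner e e) * inner x e * inner b e = (if e = b then inner x b else 0)"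
      using step assms(2) by (cases "b = 0") (auto simp: pairwise_def orthogonal_def)
  qed
  then show ?case
    using step assms(1) by simp
qed

text \<open>The real and imaginary parts of finitely many vectors span a finite-dimensional real
  space. In an orthogonal spanning set of it, each vector has complex coordinates, and these exhibit
  the kernel as a Gram matrix with nonnegative weights.\<close>

lemma psd_multiplier_cinner:
  assumes "finite I"
  shows "psd_multiplier I (\<lambda>i j. cinner (x i) (x j :: 'a :: real_inner cplx))"
proof -
  define B where "B = (re_part \<circ> x) ` I \<union> (im_part \<circ> x) ` I"
  have "finite B"
    using assms by (simp add: B_def)
  then obtain C where C: "finite C" "span C = span B" "pairwise orthogonal C"
    using basis_orthogonal by blast
  have mem: "re_part (x i) \<in> span C" "im_part (x i) \<in> span C" if "i \<in> I" for i
    using that by (auto simp: C(2) B_def intro!: span_base)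
  define w where "w e = inverse (inner e e)" for e :: 'a
  note expand = inner_orthogonal_expansion[OF C(1,3), folded w_def]
  show ?thesis
  proof (rule psd_multiplier_gram[OF C(1)])
    fix i j assume "i \<in> I" "j \<in> I"
    then show "cinner (x i) (x j) = (\<Sum>e\<in>C. complex_of_real (w e)
        * cnj (Complex (inner (re_part (x i)) e) (inner (im_part (x i)) e))
        * Complex (inner (re_part (x j)) e) (inner (im_part (x j)) e))"
      by (simp add: cinner_def complex_eq_iff expand[OF mem(1)] expand[OF mem(2)]
          sum.distrib[symmetric] sum_subtractf[symmetric] algebra_simps)
  qed (simp add: w_def)
qed

text \<open>The two-by-two matrix with diagonal \<open>t\<close> and off-diagonal \<open>q\<close>
  has eigenvectors (1, 1) and (1, -1) with eigenvalues \<open>t + q\<close> and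
  \<open>t - q\<close>. The halves in the coefficients come from normalising these vectors.\<close>

lemma psd_multiplier_sign:
  fixes q t :: real and s :: "'i \<Rightarrow> bool"
  assumes "\<bar>q\<bar> \<le> t"
  shows "psd_multiplier I (\<lambda>i j. complex_of_real (if s i = s j then t else q))"
proof (rule psd_multiplier_gram)
  let ?\<alpha> = "\<lambda>b. if b then (t + q) / 2 else (t - q) / 2"
  let ?v = "\<lambda>b i. if b \<or> s i then 1 else - 1 :: complex"
  show "complex_of_real (if s i = s j then t else q)
      = (\<Sum>b\<in>UNIV. complex_of_real (?\<alpha> b) * cnj (?v b i) * ?v b j)" for i j
    by (simp add: UNIV_bool complex_eq_iff field_simps)
  show "0 \<le> ?\<alpha> b" for b
    using assms by auto
qed simp

text \<open>
  For \<open>\<sigma>, \<tau> \<in> S\<^sub>n\<close> the weight of \<open>\<tau> \<sigma>\<^sup>-\<^sup>1\<close> is the product over \<open>a < b\<close> of the entries (\<open>t\<close> or \<open>q\<close>) of a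
  positive semidefinite two-by-two matrix, evaluated at the relative orders of \<open>\<sigma> a, \<sigma> b\<close> and of
  \<open>\<tau> a, \<tau> b\<close>. So positivity is an instance of Schur's product theorem, after averaging over
  \<open>S\<^sub>n\<close>.
\<close>

lemma fock_inner_tensor_average:
  assumes gs: "length gs = n" and hs: "length hs = n"
  shows "fact n * fock_inner q t (tensor gs) (tensor hs) =
    (\<Sum>\<sigma> | \<sigma> permutes {..<n}. \<Sum>\<tau> | \<tau> permutes {..<n}.
      (\<Prod>(a, b)\<in>pair_set n. complex_of_real (if (\<sigma> a < \<sigma> b) = (\<tau> a < \<tau> b) then t else q)) *
      (\<Prod>k<n. cinner (gs ! \<sigma> k) (hs ! \<tau> k)))"
proof -
  let ?w = "\<lambda>\<pi>. complex_of_real (qt_weight q t n \<pi>)"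
  let ?S = "{\<pi>. \<pi> permutes {..<n}}"
  have "(\<Sum>\<tau>\<in>?S. (\<Prod>(a, b)\<in>pair_set n. complex_of_real (if (\<sigma> a < \<sigma> b) = (\<tau> a < \<tau> b) then t else q)) *
      (\<Prod>k<n. cinner (gs ! \<sigma> k) (hs ! \<tau> k))) = fock_inner q t (tensor gs) (tensor hs)"
    (is "?lhs = _") if \<sigma>: "\<sigma> permutes {..<n}" for \<sigma>
  proof -
    have "?lhs = (\<Sum>\<tau>\<in>?S. ?w (\<tau> \<circ> inv \<sigma>) * (\<Prod>k<n. cinner (gs ! k) (hs ! (\<tau> \<circ> inv \<sigma>) k)))"
    proof (rule sum.cong[OF refl])
      fix \<tau> assume "\<tau> \<in> ?S"
      then have w: "?w (\<tau> \<circ> inv \<sigma>)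
          = (\<Prod>(a, b)\<in>pair_set n. complex_of_real (if (\<sigma> a < \<sigma> b) = (\<tau> a < \<tau> b) then t else q))"
        using \<sigma> by (simp add: qt_weight_compose_inv case_prod_beta)
      have "(\<Prod>k<n. cinner (gs ! \<sigma> k) (hs ! (\<tau> \<circ> inv \<sigma>) (\<sigma> k)))
          = (\<Prod>k<n. cinner (gs ! k) (hs ! (\<tau> \<circ> inv \<sigma>) k))"
        by (rule prod.reindex_bij_betw[OF permutes_imp_bij[OF \<sigma>]])
      then show "(\<Prod>(a, b)\<in>pair_set n. complex_of_real (if (\<sigma> a < \<sigma> b) = (\<tau> a < \<tau> b) then t else q)) *
          (\<Prod>k<n. cinner (gs ! \<sigma> k) (hs ! \<tau> k))
        = ?w (\<tau> \<circ> inv \<sigma>) * (\<Prod>k<n. cinner (gs ! k) (hs ! (\<tau> \<circ> inv \<sigma>) k))"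
        by (simp add: permutes_inverses[OF \<sigma>] flip: w)
    qed
    also have "\<dots> = (\<Sum>\<pi>\<in>?S. ?w \<pi> * (\<Prod>k<n. cinner (gs ! k) (hs ! \<pi> k)))"
      by (rule sum_permutations_compose_right[OF permutes_inv[OF \<sigma>], symmetric])
    finally show ?thesis
      by (simp add: fock_inner_tensor gs hs)
  qed
  then have "(\<Sum>\<sigma>\<in>?S. \<Sum>\<tau>\<in>?S.
      (\<Prod>(a, b)\<in>pair_set n. complex_of_real (if (\<sigma> a < \<sigma> b) = (\<tau> a < \<tau> b) then t else q)) *
      (\<Prod>k<n. cinner (gs ! \<sigma> k) (hs ! \<tau> k)))
    = of_nat (card ?S) * fock_inner q t (tensor gs) (tensor hs)"
    by simp
  then show ?thesis
    by (simp add: card_permutations[of "{..<n}" n])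
qed

lemma fock_inner_sum_right: "fock_inner q t \<eta> (sum x A) = (\<Sum>a\<in>A. fock_inner q t \<eta> (x a))"
  using fock_inner_scale_right[of q t \<eta> 0 0]
  by (induction A rule: infinite_finite_induct) (simp_all add: fock_inner_add_right)

lemma fock_inner_sum_left: "fock_inner q t (sum x A) \<eta> = (\<Sum>a\<in>A. fock_inner q t (x a) \<eta>)"
  using fock_inner_scale_left[of q t 0 0 \<eta>]
  by (induction A rule: infinite_finite_induct) (simp_all add: fock_inner_add_left)

lemma Re_of_real_mult: "Re (complex_of_real r * z) = r * Re z"
  by simp

lemma fock_inner_nonneg_homogeneous:
  fixes A :: "'a :: real_inner cplx list set" and c :: "'a cplx list \<Rightarrow> complex"
  assumes "\<bar>q\<bar> \<le> t" "finite A" and len: "\<And>hs. hs \<in> A \<Longrightarrow> length hs = n"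
  defines "\<xi> \<equiv> \<Sum>hs\<in>A. c hs *\<^sub>C tensor hs"
  shows "0 \<le> Re (fock_inner q t \<xi> \<xi>)"
proof -
  let ?S = "{\<pi>. \<pi> permutes {..<n}}"
  \<comment> \<open>Taking pairs of a tensor and a permutation as indices turns the averaged form
    into one kernel. The weight depends on the permutations alone; each position \<open>k\<close>
    contributes the Gram kernel of the vectors \<open>gs ! \<sigma> k\<close>; the coefficients
    ignore the permutation.\<close>
  define I where "I = A \<times> ?S"
  have "finite I"
    using assms(2) by (simp add: I_def finite_permutations)
  define W where "W \<sigma> \<tau> = (\<Prod>(a, b)\<in>pair_set n.
    complex_of_real (if (\<sigma> a < \<sigma> b) = (\<tau> a < \<tau> b) then t else q))" for \<sigma> \<tau> :: "nat \<Rightarrow> nat"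
  define V where "V gs \<sigma> hs \<tau> = (\<Prod>k<n. cinner (gs ! \<sigma> k) (hs ! \<tau> k))"
    for gs hs :: "'a cplx list" and \<sigma> \<tau> :: "nat \<Rightarrow> nat"
  have "psd_multiplier I (\<lambda>i j. \<Prod>p\<in>pair_set n. complex_of_real
      (if (snd i (fst p) < snd i (snd p)) = (snd j (fst p) < snd j (snd p)) then t else q))"
    by (intro psd_multiplier_prod finite_pair_set psd_multiplier_sign assms(1))
  then have W: "psd_multiplier I (\<lambda>i j. W (snd i) (snd j))"
    by (simp add: W_def case_prod_beta)
  have V: "psd_multiplier I (\<lambda>i j. V (fst i) (snd i) (fst j) (snd j))"
    unfolding V_def by (intro psd_multiplier_prod psd_multiplier_cinner \<open>finite I\<close>) simp
  have "psd_kernel I (\<lambda>i j. 1 * W (snd i) (snd j) * V (fst i) (snd i) (fst j) (snd j))"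
    using W V psd_kernel_one unfolding psd_multiplier_def by blast
  then have "0 \<le> Re (\<Sum>i\<in>I. \<Sum>j\<in>I. cnj (c (fst i)) * c (fst j) *
      (W (snd i) (snd j) * V (fst i) (snd i) (fst j) (snd j)))"
    unfolding psd_kernel_def by (elim allE[of _ "c \<circ> fst"]) simp
  also have "(\<Sum>i\<in>I. \<Sum>j\<in>I. cnj (c (fst i)) * c (fst j) *
        (W (snd i) (snd j) * V (fst i) (snd i) (fst j) (snd j)))
      = (\<Sum>gs\<in>A. \<Sum>\<sigma>\<in>?S. \<Sum>hs\<in>A. \<Sum>\<tau>\<in>?S. cnj (c gs) * c hs * (W \<sigma> \<tau> * V gs \<sigma> hs \<tau>))"
    by (simp only: I_def sum.cartesian_product' fst_conv snd_conv)
  also have "\<dots> = (\<Sum>gs\<in>A. \<Sum>hs\<in>A. \<Sum>\<sigma>\<in>?S. \<Sum>\<tau>\<in>?S. cnj (c gs) * c hs * (W \<sigma> \<tau> * V gs \<sigma> hs \<tau>))"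
    by (rule sum.cong[OF refl], rule sum.swap)
  also have "\<dots> = (\<Sum>gs\<in>A. \<Sum>hs\<in>A. cnj (c gs) * c hs * (fact n * fock_inner q t (tensor gs) (tensor hs)))"
  proof (intro sum.cong refl)
    fix gs hs assume "gs \<in> A" "hs \<in> A"
    then have "length gs = n" "length hs = n"
      using len by auto
    then show "(\<Sum>\<sigma>\<in>?S. \<Sum>\<tau>\<in>?S. cnj (c gs) * c hs * (W \<sigma> \<tau> * V gs \<sigma> hs \<tau>))
        = cnj (c gs) * c hs * (fact n * fock_inner q t (tensor gs) (tensor hs))"
      by (simp add: fock_inner_tensor_average W_def V_def sum_distrib_left)
  qed
  also have "\<dots> = complex_of_real (fact n) * fock_inner q t \<xi> \<xi>"
    unfolding \<xi>_def fock_inner_sum_left fock_inner_scale_left fock_inner_sum_right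
      fock_inner_scale_right sum_distrib_left
    by (subst sum.swap) (simp add: mult_ac)
  also have "Re \<dots> = fact n * Re (fock_inner q t \<xi> \<xi>)"
    by (rule Re_of_real_mult)
  finally show ?thesis
    using fact_gt_zero[of n, where ?'a = real] by (simp add: zero_le_mult_iff)
qed


section \<open>The grading by degree\<close>

definition fock_degree :: "nat \<Rightarrow> 'a :: real_vector fock set"
  where "fock_degree n = complex_vector.span {tensor hs | hs. length hs = n}"

lemma tensor_in_fock_degree: "length hs = n \<Longrightarrow> tensor hs \<in> fock_degree n"
  unfolding fock_degree_def by (rule complex_vector.span_base) blast

lemma fock_degree_scale: "x \<in> fock_degree n \<Longrightarrow> c *\<^sub>C x \<in> fock_degree n"
  unfolding fock_degree_def by (rule complex_vector.span_scale)

lemma fock_degree_add: "x \<in> fock_degree n \<Longrightarrow> y \<in> fock_degree n \<Longrightarrow> x + y \<in> fock_degree n"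
  unfolding fock_degree_def by (rule complex_vector.span_add)

lemma fock_degree_sum:
  assumes "\<And>a. a \<in> A \<Longrightarrow> x a \<in> fock_degree n"
  shows "sum x A \<in> fock_degree n"
  using assms unfolding fock_degree_def by (rule complex_vector.span_sum)

lemma fock_degree_induct [consumes 1, case_names tensor add scale]:
  fixes \<xi> :: "'a :: real_vector fock"
  assumes \<xi>: "\<xi> \<in> fock_degree n"
    and tensor: "\<And>hs. length hs = n \<Longrightarrow> P (tensor hs)"
    and add: "\<And>x y. P x \<Longrightarrow> P y \<Longrightarrow> P (x + y)"
    and scale: "\<And>c x. P x \<Longrightarrow> P (c *\<^sub>C x)"
  shows "P \<xi>"
proof -
  have "P 0"
    using scale[OF tensor[OF length_replicate], of 0 0] by simp
  then have "complex_vector.subspace {x. P x}"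
    by (simp add: complex_vector.subspace_def add scale)
  then have "complex_vector.span {tensor hs | hs. length hs = n} \<subseteq> {x. P x}"
    by (intro complex_vector.span_minimal) (use tensor in blast)+
  then show ?thesis
    using \<xi> by (auto simp: fock_degree_def)
qed

lemma creation_degree: "\<xi> \<in> fock_degree n \<Longrightarrow> creation f \<xi> \<in> fock_degree (Suc n)"
proof (induction rule: fock_degree_induct)
  case (tensor hs)
  then show ?case
    by (simp add: creation_tensor tensor_in_fock_degree)
qed (simp_all add: clinearD[OF clinear_creation] fock_degree_add fock_degree_scale)

lemma annihilation_degree:
  "\<xi> \<in> fock_degree (Suc n) \<Longrightarrow> annihilation q t f \<xi> \<in> fock_degree n"
proof (induction rule: fock_degree_induct)
  case (tensor hs)
  then show ?case
    unfolding annihilation_tensor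
    by (intro fock_degree_sum fock_degree_scale tensor_in_fock_degree) simp
qed (simp_all add: clinearD[OF clinear_annihilation] fock_degree_add fock_degree_scale)

lemma annihilation_degree_0: "\<xi> \<in> fock_degree 0 \<Longrightarrow> annihilation q t f \<xi> = 0"
proof (induction rule: fock_degree_induct)
  case (tensor hs)
  then show ?case
    by (simp add: annihilation_tensor)
qed (simp_all add: clinearD[OF clinear_annihilation])

lemma t_power_N_degree: "\<xi> \<in> fock_degree n \<Longrightarrow> t_power_N t \<xi> = complex_of_real (t ^ n) *\<^sub>C \<xi>"
proof (induction rule: fock_degree_induct)
  case (tensor hs)
  then show ?case
    by (simp add: t_power_N_tensor)
next
  case (add x y)
  then show ?case
    by (simp add: clinearD[OF clinear_t_power_N] scaleC_add_right)
next
  case (scale c x)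
  then show ?case
    by (simp add: clinearD[OF clinear_t_power_N] mult.commute)
qed

lemma fock_degree_orthogonal:
  assumes "\<xi> \<in> fock_degree m" "\<eta> \<in> fock_degree n" "m \<noteq> n"
  shows "fock_inner q t \<xi> \<eta> = 0"
  using assms(1)
proof (induction rule: fock_degree_induct)
  case (tensor hs)
  show ?case
    using assms(2)
    by (induction rule: fock_degree_induct)
      (use assms(3) tensor in \<open>auto simp: fock_inner_tensor fock_inner_add_right fock_inner_scale_right\<close>)
qed (simp_all add: fock_inner_add_left fock_inner_scale_left)

text \<open>The degree map \<open>d\<close> is left free so that the lemma also covers the vectors
  \<open>creation f (x n)\<close>, of degree \<open>Suc n\<close>.\<close>

lemma fock_inner_orthogonal_sum:
  fixes x :: "nat \<Rightarrow> 'a :: real_inner fock"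
  assumes "\<And>n. x n \<in> fock_degree (d n)" "inj d"
  shows "fock_inner q t (\<Sum>n<N. x n) (\<Sum>n<N. x n) = (\<Sum>n<N. fock_inner q t (x n) (x n))"
proof -
  have eq: "fock_inner q t (x m) (x n) = (if n = m then fock_inner q t (x m) (x m) else 0)" for m n
    using fock_degree_orthogonal[OF assms(1) assms(1), of m n] inj_eq[OF assms(2)] by auto
  show ?thesis
    unfolding fock_inner_sum_left fock_inner_sum_right
    by (rule sum.cong[OF refl], subst eq) simp
qed

text \<open>The coefficients are kept explicit because \<open>fock_inner_nonneg_homogeneous\<close>
  is stated for them; membership in \<open>fock_degree n\<close> alone would hide them.\<close>

lemma fock_tensor_expansion_by_degree:
  fixes \<xi> :: "'a :: real_vector fock"
  obtains A c N where "finite A"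
    "\<xi> = (\<Sum>n<N. \<Sum>hs | hs \<in> A \<and> length hs = n. c hs *\<^sub>C tensor hs)"
proof -
  define A where "A = Poly_Mapping.keys (rep_fock \<xi>)"
  define N where "N = Suc (Max (length ` A))"
  have "finite A"
    by (simp add: A_def)
  then have "length ` A \<subseteq> {..<N}"
    by (auto simp: N_def less_Suc_eq_le)
  then have "\<xi> = (\<Sum>n<N. \<Sum>hs | hs \<in> A \<and> length hs = n.
      Poly_Mapping.lookup (rep_fock \<xi>) hs *\<^sub>C tensor hs)"
    using \<open>finite A\<close> by (subst sum.group) (auto simp: A_def intro: fock_tensor_expansion)
  then show ?thesis
    by (rule that[OF \<open>finite A\<close>])
qed

lemma fock_degree_decomposition:
  fixes \<xi> :: "'a :: real_vector fock"
  shows "\<exists>x N. (\<forall>n. x n \<in> fock_degree n) \<and> \<xi> = (\<Sum>n<N. x n)"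
proof -
  obtain A c N where \<xi>: "\<xi> = (\<Sum>n<N. \<Sum>hs | hs \<in> A \<and> length hs = n. c hs *\<^sub>C tensor hs)"
    by (rule fock_tensor_expansion_by_degree)
  show ?thesis
    by (rule exI[of _ "\<lambda>n. \<Sum>hs | hs \<in> A \<and> length hs = n. c hs *\<^sub>C tensor hs"])
      (use \<xi> in \<open>auto intro!: fock_degree_sum fock_degree_scale tensor_in_fock_degree\<close>)
qed

lemma fock_inner_nonneg:
  assumes "\<bar>q\<bar> \<le> t"
  shows "0 \<le> Re (fock_inner q t \<xi> \<xi>)"
proof -
  obtain A c N where A: "finite A"
    and \<xi>: "\<xi> = (\<Sum>n<N. \<Sum>hs | hs \<in> A \<and> length hs = n. c hs *\<^sub>C tensor hs)"
    by (rule fock_tensor_expansion_by_degree)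
  define x where "x n = (\<Sum>hs | hs \<in> A \<and> length hs = n. c hs *\<^sub>C tensor hs)" for n
  have x: "x n \<in> fock_degree n" for n
    by (auto simp: x_def intro!: fock_degree_sum fock_degree_scale tensor_in_fock_degree)
  have "fock_inner q t (\<Sum>n<N. x n) (\<Sum>n<N. x n) = (\<Sum>n<N. fock_inner q t (x n) (x n))"
    by (rule fock_inner_orthogonal_sum[of x "\<lambda>n. n", OF x inj_on_id2])
  moreover have "0 \<le> Re (fock_inner q t (x n) (x n))" for n
    unfolding x_def by (rule fock_inner_nonneg_homogeneous[OF assms, where n = n]) (use A in simp_all)
  moreover have "\<xi> = (\<Sum>n<N. x n)"
    by (simp only: \<xi> x_def)
  ultimately show ?thesis
    by (simp add: sum_nonneg)
qed


section \<open>The seminorm on the algebraic Fock space\<close>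

lemma fock_inner_diff_right: "fock_inner q t \<eta> (\<xi> - \<xi>') = fock_inner q t \<eta> \<xi> - fock_inner q t \<eta> \<xi>'"
  using fock_inner_add_right[of q t \<eta> "\<xi> - \<xi>'" \<xi>'] by simp

lemma fock_inner_diff_left: "fock_inner q t (\<eta> - \<eta>') \<xi> = fock_inner q t \<eta> \<xi> - fock_inner q t \<eta>' \<xi>"
  using fock_inner_add_left[of q t "\<eta> - \<eta>'" \<eta>' \<xi>] by simp

lemma fock_norm_nonneg: "\<bar>q\<bar> \<le> t \<Longrightarrow> 0 \<le> fock_norm q t \<xi>"
  by (simp add: fock_norm_def fock_inner_nonneg)

lemma fock_norm_power2: "\<bar>q\<bar> \<le> t \<Longrightarrow> (fock_norm q t \<xi>)\<^sup>2 = Re (fock_inner q t \<xi> \<xi>)"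
  by (simp add: fock_norm_def fock_inner_nonneg)

lemma fock_inner_self: "\<bar>q\<bar> \<le> t \<Longrightarrow> fock_inner q t \<xi> \<xi> = complex_of_real ((fock_norm q t \<xi>)\<^sup>2)"
  using fock_inner_commute[of q t \<xi> \<xi>] by (simp add: fock_norm_power2 complex_eq_iff)

lemma fock_norm_scale: "fock_norm q t (c *\<^sub>C \<xi>) = norm c * fock_norm q t \<xi>"
proof -
  have "fock_inner q t (c *\<^sub>C \<xi>) (c *\<^sub>C \<xi>) = complex_of_real ((norm c)\<^sup>2) * fock_inner q t \<xi> \<xi>"
    by (simp only: fock_inner_scale_left fock_inner_scale_right complex_norm_square mult_ac)
  then show ?thesis
    by (simp add: fock_norm_def real_sqrt_mult)
qed

lemma fock_Cauchy_Schwarz: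
  assumes qt: "\<bar>q\<bar> \<le> t"
  shows "norm (fock_inner q t \<eta> \<xi>) \<le> fock_norm q t \<eta> * fock_norm q t \<xi>"
proof -
  define b where "b = fock_inner q t \<eta> \<xi>"
  have b': "fock_inner q t \<xi> \<eta> = cnj b"
    unfolding b_def by (rule fock_inner_commute)
  have quad: "0 \<le> (fock_norm q t \<eta>)\<^sup>2 - 2 * s * (norm b)\<^sup>2 + s\<^sup>2 * (norm b)\<^sup>2 * (fock_norm q t \<xi>)\<^sup>2"
    for s :: real
  proof -
    \<comment> \<open>The factor \<open>cnj b\<close> aligns the phases: the cross term
      \<open>c * b\<close> becomes the real number \<open>s * (norm b)\<^sup>2\<close>.\<close>
    define c where "c = complex_of_real s * cnj b"
    have "fock_inner q t (\<eta> - c *\<^sub>C \<xi>) (\<eta> - c *\<^sub>C \<xi>)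
        = fock_inner q t \<eta> \<eta> - (c * b + cnj (c * b)) + (c * cnj c) * fock_inner q t \<xi> \<xi>"
      by (simp add: fock_inner_diff_left fock_inner_diff_right fock_inner_scale_left
          fock_inner_scale_right b' b_def[symmetric] algebra_simps)
    also have "c * b = complex_of_real (s * (norm b)\<^sup>2)"
      by (simp add: c_def complex_norm_square mult_ac del: of_real_power)
    also have "c * cnj c = complex_of_real (s\<^sup>2 * (norm b)\<^sup>2)"
      by (simp only: c_def complex_cnj_mult complex_cnj_complex_of_real complex_cnj_cnj of_real_mult
          complex_norm_square power2_eq_square[of s] mult_ac)
    finally have "Re (fock_inner q t (\<eta> - c *\<^sub>C \<xi>) (\<eta> - c *\<^sub>C \<xi>))
        = (fock_norm q t \<eta>)\<^sup>2 - 2 * s * (norm b)\<^sup>2 + s\<^sup>2 * (norm b)\<^sup>2 * (fock_norm q t \<xi>)\<^sup>2"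
      by (simp add: fock_inner_self[OF qt] del: of_real_power of_real_mult flip: of_real_mult)
    then show ?thesis
      using fock_inner_nonneg[OF qt, of "\<eta> - c *\<^sub>C \<xi>"] by simp
  qed
  have "(norm b)\<^sup>2 \<le> (fock_norm q t \<eta>)\<^sup>2 * (fock_norm q t \<xi>)\<^sup>2"
  proof (cases "fock_norm q t \<xi> = 0")
    case True
    have "norm b = 0"
    proof (rule ccontr)
      assume "norm b \<noteq> 0"
      \<comment> \<open>For a null vector \<open>\<xi>\<close> the expression in \<open>quad\<close>
        is affine in \<open>s\<close> with negative slope. The chosen \<open>s\<close> brings it
        down to minus the squared norm of \<open>\<eta>\<close>, minus 2.\<close>
      then have "2 * (((fock_norm q t \<eta>)\<^sup>2 + 1) / (norm b)\<^sup>2) * (norm b)\<^sup>2 = 2 * (fock_norm q t \<eta>)\<^sup>2 + 2"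
        by simp
      then show False
        using quad[of "((fock_norm q t \<eta>)\<^sup>2 + 1) / (norm b)\<^sup>2"] True
          zero_le_power2[of "fock_norm q t \<eta>"] by simp
    qed
    then show ?thesis by simp
  next
    case False
    \<comment> \<open>The quadratic in \<open>s\<close> takes its minimum at
      \<open>s = 1 / y\<close>.\<close>
    define y where "y = (fock_norm q t \<xi>)\<^sup>2"
    have "0 < y"
      using False by (simp add: y_def)
    then have "(1 / y)\<^sup>2 * (norm b)\<^sup>2 * y = (norm b)\<^sup>2 / y"
      by (simp add: power2_eq_square)
    then have "(norm b)\<^sup>2 / y \<le> (fock_norm q t \<eta>)\<^sup>2"
      using quad[of "1 / y"] by (simp flip: y_def)
    then show ?thesis
      using \<open>0 < y\<close> by (simp add: pos_divide_le_eq flip: y_def)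
  qed
  then have "(norm b)\<^sup>2 \<le> (fock_norm q t \<eta> * fock_norm q t \<xi>)\<^sup>2"
    by (simp add: power_mult_distrib)
  then show ?thesis
    unfolding b_def by (rule power2_le_imp_le) (simp add: fock_norm_nonneg[OF qt])
qed

lemma fock_norm_triangle:
  assumes qt: "\<bar>q\<bar> \<le> t"
  shows "fock_norm q t (\<eta> + \<xi>) \<le> fock_norm q t \<eta> + fock_norm q t \<xi>"
proof (rule power2_le_imp_le)
  have "Re (fock_inner q t \<xi> \<eta>) = Re (fock_inner q t \<eta> \<xi>)"
    by (subst fock_inner_commute) simp
  then have "(fock_norm q t (\<eta> + \<xi>))\<^sup>2
      = (fock_norm q t \<eta>)\<^sup>2 + 2 * Re (fock_inner q t \<eta> \<xi>) + (fock_norm q t \<xi>)\<^sup>2"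
    by (simp add: fock_norm_power2[OF qt] fock_inner_add_left fock_inner_add_right)
  also have "Re (fock_inner q t \<eta> \<xi>) \<le> fock_norm q t \<eta> * fock_norm q t \<xi>"
    using fock_Cauchy_Schwarz[OF qt, of \<eta> \<xi>] complex_Re_le_cmod order_trans by blast
  finally show "(fock_norm q t (\<eta> + \<xi>))\<^sup>2 \<le> (fock_norm q t \<eta> + fock_norm q t \<xi>)\<^sup>2"
    by (simp add: power2_sum)
qed (simp add: fock_norm_nonneg[OF qt])

lemma fock_norm_minus_commute: "fock_norm q t (\<eta> - \<xi>) = fock_norm q t (\<xi> - \<eta>)"
  using fock_norm_scale[of q t "-1" "\<eta> - \<xi>"] by simp

lemma fock_norm_0 [simp]: "fock_norm q t 0 = 0"
  using fock_norm_scale[of q t 0 0] by simp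

lemma fock_norm_triangle_diff:
  assumes qt: "\<bar>q\<bar> \<le> t"
  shows "\<bar>fock_norm q t \<eta> - fock_norm q t \<xi>\<bar> \<le> fock_norm q t (\<eta> - \<xi>)"
  using fock_norm_triangle[OF qt, of "\<eta> - \<xi>" \<xi>] fock_norm_triangle[OF qt, of "\<xi> - \<eta>" \<eta>]
    fock_norm_minus_commute[of q t \<eta> \<xi>]
  by simp


section \<open>Norm estimates\<close>

text \<open>The \<open>(q,t)\<close>-integer: for \<open>q \<noteq> t\<close> it equals the sum of
  \<open>q^i * t^(n-1-i)\<close> over \<open>i < n\<close>, and at \<open>t = 1\<close> it is the
  usual \<open>q\<close>-integer.\<close>

definition qt_number :: "real \<Rightarrow> real \<Rightarrow> nat \<Rightarrow> real"
  where "qt_number q t n = (t ^ n - q ^ n) / (t - q)"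

lemma qt_number_1: "q \<noteq> t \<Longrightarrow> qt_number q t (Suc 0) = 1"
  by (simp add: qt_number_def)

lemma qt_number_Suc: "q \<noteq> t \<Longrightarrow> qt_number q t (Suc n) = q * qt_number q t n + t ^ n"
  by (simp add: qt_number_def field_simps)

lemma fock_norm_creation:
  assumes qt: "\<bar>q\<bar> \<le> t"
  shows "(fock_norm q t (creation f \<xi>))\<^sup>2
    = q * (fock_norm q t (annihilation q t f \<xi>))\<^sup>2
      + (norm f)\<^sup>2 * Re (fock_inner q t \<xi> (t_power_N t \<xi>))"
proof -
  have "fock_inner q t (creation f \<xi>) (creation f \<xi>)
      = fock_inner q t \<xi> (annihilation q t f (creation f \<xi>))"
    by (rule fock_inner_creation)
  also have "\<dots> = complex_of_real q * fock_inner q t (annihilation q t f \<xi>) (annihilation q t f \<xi>)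
      + complex_of_real ((norm f)\<^sup>2) * fock_inner q t \<xi> (t_power_N t \<xi>)"
    by (simp add: annihilation_creation fock_inner_add_right fock_inner_scale_right
        fock_inner_annihilation power2_norm_eq_inner del: of_real_power)
  finally show ?thesis
    by (simp add: fock_norm_power2[OF qt] del: of_real_power)
qed

lemma fock_norm_creation_degree:
  assumes qt: "\<bar>q\<bar> \<le> t" and "\<xi> \<in> fock_degree n"
  shows "(fock_norm q t (creation f \<xi>))\<^sup>2
    = q * (fock_norm q t (annihilation q t f \<xi>))\<^sup>2 + (norm f)\<^sup>2 * t ^ n * (fock_norm q t \<xi>)\<^sup>2"
  unfolding fock_norm_creation[OF qt] t_power_N_degree[OF assms(2)] fock_inner_scale_right
    Re_of_real_mult fock_norm_power2[OF qt, of \<xi>]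
  by simp

text \<open>Cauchy-Schwarz bounds the square of the norm of \<open>\<eta>\<close> by
  \<open>C\<close> times the norms of \<open>\<xi>\<close> and \<open>\<eta>\<close>, and one factor
  cancels. In use, \<open>\<eta>\<close> is the image of \<open>\<xi>\<close> under one operator and
  \<open>\<zeta>\<close> the image of \<open>\<eta>\<close> under its adjoint. The bound enters only
  at the vector \<open>\<eta>\<close>, so it may be one that is known in a single degree.\<close>

lemma fock_norm_adjoint_le:
  assumes qt: "\<bar>q\<bar> \<le> t" and "0 \<le> C"
    and adj: "fock_inner q t \<eta> \<eta> = fock_inner q t \<xi> \<zeta>"
    and le: "fock_norm q t \<zeta> \<le> C * fock_norm q t \<eta>"
  shows "fock_norm q t \<eta> \<le> C * fock_norm q t \<xi>"
proof (cases "fock_norm q t \<eta> = 0")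
  case True
  then show ?thesis
    using assms by (simp add: fock_norm_nonneg)
next
  case False
  have "(fock_norm q t \<eta>)\<^sup>2 \<le> fock_norm q t \<xi> * fock_norm q t \<zeta>"
    unfolding fock_norm_power2[OF qt] adj
    using fock_Cauchy_Schwarz[OF qt] complex_Re_le_cmod order_trans by blast
  also have "\<dots> \<le> fock_norm q t \<xi> * (C * fock_norm q t \<eta>)"
    by (rule mult_left_mono[OF le fock_norm_nonneg[OF qt]])
  finally have "fock_norm q t \<eta> * fock_norm q t \<eta> \<le> (C * fock_norm q t \<xi>) * fock_norm q t \<eta>"
    by (simp add: power2_eq_square mult_ac)
  moreover have "0 < fock_norm q t \<eta>"
    using False fock_norm_nonneg[OF qt, of "\<eta>"] by simp
  ultimately show ?thesis
    by (rule mult_right_le_imp_le)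
qed

text \<open>In the induction step \<open>annihilation q t f \<xi>\<close> has degree
  \<open>n\<close>, where the bound for creation is known; adjointness turns it into a bound for
  annihilation at \<open>\<xi>\<close>. Inserted into \<open>fock_norm_creation_degree\<close>, with
  \<open>q \<ge> 0\<close>, it gives the constant q[n+1] + t^(n+1) = [n+2].\<close>

lemma fock_norm_creation_le_degree:
  assumes qt: "\<bar>q\<bar> < t" and "0 \<le> q" and "\<xi> \<in> fock_degree n"
  shows "fock_norm q t (creation f \<xi>) \<le> sqrt (qt_number q t (Suc n)) * norm f * fock_norm q t \<xi>"
  using assms(3)
proof (induction n arbitrary: \<xi>)
  case 0
  have "(fock_norm q t (creation f \<xi>))\<^sup>2 = (norm f * fock_norm q t \<xi>)\<^sup>2"
    using qt 0 by (simp add: fock_norm_creation_degree annihilation_degree_0 power_mult_distrib)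
  then have "fock_norm q t (creation f \<xi>) = norm f * fock_norm q t \<xi>"
    using qt by (simp add: power2_eq_iff_nonneg fock_norm_nonneg)
  then show ?case
    using qt by (simp add: qt_number_1)
next
  case (Suc n)
  let ?K = "\<lambda>n. qt_number q t n"
  have qt': "\<bar>q\<bar> \<le> t" using qt by simp
  have pos: "0 \<le> ?K n" for n
    using assms(2) qt by (auto simp: qt_number_def intro!: divide_nonneg_nonneg power_mono)
  have "fock_norm q t (annihilation q t f \<xi>) \<le> sqrt (?K (Suc n)) * norm f * fock_norm q t \<xi>"
    by (rule fock_norm_adjoint_le[OF qt' _ fock_inner_annihilation
          Suc.IH[OF annihilation_degree[OF Suc.prems]]]) (simp add: pos)
  then have "(fock_norm q t (annihilation q t f \<xi>))\<^sup>2 \<le> (sqrt (?K (Suc n)) * norm f * fock_norm q t \<xi>)\<^sup>2"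
    by (rule power_mono[OF _ fock_norm_nonneg[OF qt']])
  then have "q * (fock_norm q t (annihilation q t f \<xi>))\<^sup>2 \<le> q * (?K (Suc n) * (norm f * fock_norm q t \<xi>)\<^sup>2)"
    using assms(2) pos[of "Suc n"] by (intro mult_left_mono) (auto simp: power_mult_distrib mult_ac)
  then have "(fock_norm q t (creation f \<xi>))\<^sup>2 \<le> ?K (Suc (Suc n)) * (norm f * fock_norm q t \<xi>)\<^sup>2"
    using qt_number_Suc[of q t "Suc n"] qt
    by (simp add: fock_norm_creation_degree[OF qt' Suc.prems] power_mult_distrib algebra_simps)
  also have "\<dots> = (sqrt (?K (Suc (Suc n))) * norm f * fock_norm q t \<xi>)\<^sup>2"
    using pos[of "Suc (Suc n)"] by (simp add: power_mult_distrib)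
  finally show ?case
    by (rule power2_le_imp_le) (simp add: pos fock_norm_nonneg[OF qt'])
qed

text \<open>Both the components of \<open>\<xi>\<close> and their images lie in pairwise different
  degrees, so the squared norms add up on either side and a constant uniform in the degree
  suffices.\<close>

lemma fock_norm_creation_le:
  assumes qt: "\<bar>q\<bar> \<le> t" and "0 \<le> C"
    and le: "\<And>n \<xi>. \<xi> \<in> fock_degree n \<Longrightarrow> fock_norm q t (creation f \<xi>) \<le> C * fock_norm q t \<xi>"
  shows "fock_norm q t (creation f \<xi>) \<le> C * fock_norm q t \<xi>"
proof -
  obtain x N where x: "\<And>n. x n \<in> fock_degree n" and \<xi>: "\<xi> = (\<Sum>n<N. x n)"
    using fock_degree_decomposition[of \<xi>] by auto
  have "fock_inner q t (creation f \<xi>) (creation f \<xi>)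
      = (\<Sum>n<N. fock_inner q t (creation f (x n)) (creation f (x n)))"
    unfolding \<xi> clinear_sum[OF clinear_creation]
    by (rule fock_inner_orthogonal_sum[where d = Suc]) (auto intro: creation_degree x)
  then have "(fock_norm q t (creation f \<xi>))\<^sup>2 = (\<Sum>n<N. (fock_norm q t (creation f (x n)))\<^sup>2)"
    by (simp add: fock_norm_power2[OF qt])
  also have "\<dots> \<le> (\<Sum>n<N. (C * fock_norm q t (x n))\<^sup>2)"
    by (intro sum_mono power_mono le[OF x] fock_norm_nonneg[OF qt])
  also have "\<dots> = (C * fock_norm q t \<xi>)\<^sup>2"
    using fock_inner_orthogonal_sum[of x "\<lambda>n. n" q t N] x
    by (simp add: power_mult_distrib fock_norm_power2[OF qt] \<xi> sum_distrib_left)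
  finally show ?thesis
    by (rule power2_le_imp_le) (simp add: \<open>0 \<le> C\<close> fock_norm_nonneg[OF qt])
qed

text \<open>The tensor powers of \<open>f\<close> are eigenvectors of the product a a*. The
  commutation relation gives their eigenvalues the recursion \<open>qt_number_Suc\<close>.\<close>

lemma annihilation_creation_power:
  assumes "q \<noteq> t"
  shows "annihilation q t f (creation f (tensor (replicate n (emb_cplx f))))
    = complex_of_real (qt_number q t (Suc n) * (norm f)\<^sup>2) *\<^sub>C tensor (replicate n (emb_cplx f))"
proof (induction n)
  case 0
  have "annihilation q t f (tensor []) = 0"
    by (simp add: annihilation_tensor)
  then show ?case
    using assms
    by (simp add: annihilation_creation t_power_N_tensor qt_number_1 power2_norm_eq_inner
        clinearD[OF clinear_creation] del: of_real_power)
next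
  case (Suc n)
  let ?e = "\<lambda>n. tensor (replicate n (emb_cplx f))"
  have step: "creation f (?e n) = ?e (Suc n)"
    by (simp add: creation_tensor)
  have "annihilation q t f (creation f (?e (Suc n)))
      = complex_of_real q *\<^sub>C creation f (annihilation q t f (creation f (?e n)))
        + complex_of_real (inner f f) *\<^sub>C t_power_N t (?e (Suc n))"
    by (simp only: annihilation_creation[of q t f f "?e (Suc n)"] step)
  also have "\<dots> = complex_of_real (q * (qt_number q t (Suc n) * (norm f)\<^sup>2)) *\<^sub>C ?e (Suc n)
        + complex_of_real ((norm f)\<^sup>2 * t ^ Suc n) *\<^sub>C ?e (Suc n)"
    unfolding Suc
    by (simp only: clinearD(2)[OF clinear_creation] step t_power_N_tensor length_replicate
        scaleC_scaleC power2_norm_eq_inner of_real_mult)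
  also have "\<dots> = complex_of_real ((q * qt_number q t (Suc n) + t ^ Suc n) * (norm f)\<^sup>2) *\<^sub>C ?e (Suc n)"
    unfolding scaleC_add_left[symmetric] of_real_add[symmetric]
    by (intro arg_cong2[where f = scaleC] arg_cong[where f = complex_of_real] refl)
      (simp add: algebra_simps)
  finally show ?case
    by (simp only: qt_number_Suc[OF assms, of "Suc n"])
qed

lemma fock_norm_creation_power:
  assumes qt: "\<bar>q\<bar> < t"
  shows "(fock_norm q t (creation f (tensor (replicate n (emb_cplx f)))))\<^sup>2
    = qt_number q t (Suc n) * (norm f)\<^sup>2 * (fock_norm q t (tensor (replicate n (emb_cplx f))))\<^sup>2"
proof -
  have "q \<noteq> t" "\<bar>q\<bar> \<le> t"
    using qt by auto
  then show ?thesis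
    by (simp only: fock_norm_power2 fock_inner_creation annihilation_creation_power[OF \<open>q \<noteq> t\<close>]
        fock_inner_scale_right Re_of_real_mult)
qed

lemma fock_norm_vacuum: "fock_norm q t \<Omega> = 1"
  by (simp add: fock_norm_def vacuum_def fock_inner_tensor qt_weight_def pair_set_def)

lemma qt_number_pos:
  assumes "\<bar>q\<bar> < t"
  shows "0 < qt_number q t (Suc n)"
proof -
  have "q ^ Suc n < t ^ Suc n"
    using power_strict_mono[OF assms, of "Suc n"] by (simp flip: power_abs del: power_Suc)
  then show ?thesis
    using assms by (simp add: qt_number_def del: power_Suc)
qed

lemma creation_bound_ge:
  assumes qt: "\<bar>q\<bar> < t"
    and le: "\<And>\<xi>. fock_norm q t (creation f \<xi>) \<le> C * fock_norm q t \<xi>"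
    and "0 \<le> C"
  shows "sqrt (qt_number q t (Suc n)) * norm f \<le> C"
proof (cases "f = 0")
  case True
  then show ?thesis using \<open>0 \<le> C\<close> by simp
next
  case False
  let ?x = "\<lambda>n. tensor (replicate n (emb_cplx f))"
  have qt': "\<bar>q\<bar> \<le> t" using qt by simp
  \<comment> \<open>The test vectors must not be null before their norm can be cancelled. Each
    squared norm is [n+1] times the square of \<open>norm f\<close> times the previous one, hence
    positive.\<close>
  have pos: "0 < (fock_norm q t (?x n))\<^sup>2"
  proof (induction n)
    case 0
    then show ?case
      by (simp add: fock_norm_vacuum[unfolded vacuum_def])
  next
    case (Suc n)
    then show ?case
      using fock_norm_creation_power[OF qt, of f n] qt_number_pos[OF qt, of n] False
      by (simp add: creation_tensor)
  qed
  have "(fock_norm q t (creation f (?x n)))\<^sup>2 \<le> (C * fock_norm q t (?x n))\<^sup>2"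
    by (rule power_mono[OF le fock_norm_nonneg[OF qt']])
  then have "(qt_number q t (Suc n) * (norm f)\<^sup>2) * (fock_norm q t (?x n))\<^sup>2 \<le> C\<^sup>2 * (fock_norm q t (?x n))\<^sup>2"
    by (simp add: fock_norm_creation_power[OF qt] power_mult_distrib)
  then have "qt_number q t (Suc n) * (norm f)\<^sup>2 \<le> C\<^sup>2"
    using pos by (rule mult_right_le_imp_le)
  then have "(sqrt (qt_number q t (Suc n)) * norm f)\<^sup>2 \<le> C\<^sup>2"
    using qt_number_pos[OF qt, of n] by (simp add: power_mult_distrib)
  then show ?thesis
    using \<open>0 \<le> C\<close> by (rule power2_le_imp_le)
qed

lemma fock_norm_creation_le_nonneg:
  assumes qt: "\<bar>q\<bar> < t" and "0 \<le> q" and K: "\<And>n. qt_number q t (Suc n) \<le> K"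
  shows "fock_norm q t (creation f \<xi>) \<le> sqrt K * norm f * fock_norm q t \<xi>"
proof (rule fock_norm_creation_le)
  have "0 < K"
    using qt_number_pos[OF qt, of 0] K[of 0] by simp
  then show "0 \<le> sqrt K * norm f" by simp
  fix n and \<xi> :: "'a fock" assume "\<xi> \<in> fock_degree n"
  then have "fock_norm q t (creation f \<xi>) \<le> sqrt (qt_number q t (Suc n)) * norm f * fock_norm q t \<xi>"
    by (rule fock_norm_creation_le_degree[OF qt \<open>0 \<le> q\<close>])
  also have "\<dots> \<le> sqrt K * norm f * fock_norm q t \<xi>"
    using qt by (intro mult_right_mono real_sqrt_le_mono K fock_norm_nonneg) auto
  finally show "fock_norm q t (creation f \<xi>) \<le> sqrt K * norm f * fock_norm q t \<xi>" .
qed (use qt in simp)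

lemma fock_norm_creation_le_nonpos:
  assumes qt: "\<bar>q\<bar> < t" and "q \<le> 0" "t \<le> 1"
  shows "fock_norm q t (creation f \<xi>) \<le> norm f * fock_norm q t \<xi>"
proof (rule fock_norm_creation_le)
  fix n and \<xi> :: "'a fock" assume \<xi>: "\<xi> \<in> fock_degree n"
  have "(fock_norm q t (creation f \<xi>))\<^sup>2
      = q * (fock_norm q t (annihilation q t f \<xi>))\<^sup>2 + (norm f)\<^sup>2 * t ^ n * (fock_norm q t \<xi>)\<^sup>2"
    using qt \<xi> by (simp add: fock_norm_creation_degree)
  also have "\<dots> \<le> 0 + (norm f)\<^sup>2 * 1 * (fock_norm q t \<xi>)\<^sup>2"
    using assms by (intro add_mono mult_right_mono mult_left_mono power_le_one)
      (auto simp: mult_nonpos_nonneg)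
  also have "\<dots> = (norm f * fock_norm q t \<xi>)\<^sup>2"
    by (simp add: power_mult_distrib)
  finally show "fock_norm q t (creation f \<xi>) \<le> norm f * fock_norm q t \<xi>"
    by (rule power2_le_imp_le) (use qt in \<open>simp add: fock_norm_nonneg\<close>)
qed (use qt in auto)

lemma qt_number_le_free:
  assumes "0 \<le> q" "q < 1"
  shows "qt_number q 1 n \<le> 1 / (1 - q)"
  using assms by (simp add: qt_number_def divide_right_mono)

text \<open>
  \<open>[n + 1] \<ge> [n]\<close> if and only if \<open>(t / q)\<^sup>n \<le> (1 - q) / (1 - t)\<close>, so \<open>[n]\<close> increases up to \<open>n\<^sub>*\<close> and
  decreases afterwards.
\<close>

lemma qt_number_le_max:
  fixes q t :: real
  assumes "0 < q" "q < t" "t < 1"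
  defines "L \<equiv> (ln (1 - q) - ln (1 - t)) / (ln t - ln q)"
  shows "qt_number q t n \<le> qt_number q t (nat \<lceil>L\<rceil>)"
proof -
  have lnpos: "0 < ln t - ln q"
    using assms by simp
  have diff: "qt_number q t (Suc n) - qt_number q t n = (q ^ n * (1 - q) - t ^ n * (1 - t)) / (t - q)" for n
    unfolding qt_number_def diff_divide_distrib[symmetric] by (simp add: algebra_simps)
  have ln: "ln (t ^ n * (1 - t)) = real n * ln t + ln (1 - t)"
    "ln (q ^ n * (1 - q)) = real n * ln q + ln (1 - q)" for n
    using assms(1-3) by (simp_all add: ln_mult ln_realpow)
  have pos: "0 < t ^ n * (1 - t)" "0 < q ^ n * (1 - q)" for n
    using assms(1-3) by simp_all
  have up: "qt_number q t n \<le> qt_number q t (Suc n)" if "real n \<le> L" for n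
  proof -
    have "real n * (ln t - ln q) \<le> ln (1 - q) - ln (1 - t)"
      using that lnpos by (simp add: L_def pos_le_divide_eq)
    then have "t ^ n * (1 - t) \<le> q ^ n * (1 - q)"
      unfolding ln_le_cancel_iff[OF pos, symmetric] ln by (simp add: algebra_simps)
    then have "0 \<le> qt_number q t (Suc n) - qt_number q t n"
      using assms(2) by (simp add: diff)
    then show ?thesis by simp
  qed
  have down: "qt_number q t (Suc n) \<le> qt_number q t n" if "L \<le> real n" for n
  proof -
    have "ln (1 - q) - ln (1 - t) \<le> real n * (ln t - ln q)"
      using that lnpos by (simp add: L_def pos_divide_le_eq)
    then have "q ^ n * (1 - q) \<le> t ^ n * (1 - t)"
      unfolding ln_le_cancel_iff[OF pos(2,1), symmetric] ln by (simp add: algebra_simps)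
    then have "qt_number q t (Suc n) - qt_number q t n \<le> 0"
      using assms(2) by (simp add: diff divide_le_0_iff)
    then show ?thesis by simp
  qed
  show ?thesis
  proof (cases "n \<le> nat \<lceil>L\<rceil>")
    case True
    then show ?thesis
    proof (induction rule: inc_induct)
      case (step k)
      then have "real k \<le> L" by linarith
      then show ?case
        using up[of k] step.IH by linarith
    qed simp
  next
    case False
    then have "nat \<lceil>L\<rceil> \<le> n"
      using nat_le_linear by blast
    then show ?thesis
    proof (induction rule: dec_induct)
      case (step k)
      then have "L \<le> real k" by linarith
      then show ?case
        using down[of k] step.IH by linarith
    qed simp
  qed
qed


section \<open>The completion\<close>

lemma fock_norm_diff_triangle:
  assumes "\<bar>q\<bar> \<le> t"
  shows "fock_norm q t (\<xi> - \<zeta>) \<le> fock_norm q t (\<xi> - \<eta>) + fock_norm q t (\<eta> - \<zeta>)"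
  using fock_norm_triangle[OF assms, of "\<xi> - \<eta>" "\<eta> - \<zeta>"] by simp

lemma fock_Cauchy_const: "fock_Cauchy q t (\<lambda>n. \<xi>)"
  by (simp add: fock_Cauchy_def)

lemma fock_Cauchy_norm_convergent:
  assumes qt: "\<bar>q\<bar> \<le> t" and x: "fock_Cauchy q t x"
  shows "convergent (\<lambda>n. fock_norm q t (x n))"
proof -
  have "Cauchy (\<lambda>n. fock_norm q t (x n))"
    unfolding Cauchy_def dist_real_def
  proof (intro allI impI)
    fix e :: real assume "0 < e"
    then obtain M where "\<forall>m\<ge>M. \<forall>n\<ge>M. fock_norm q t (x m - x n) < e"
      using x unfolding fock_Cauchy_def by blast
    then have M: "fock_norm q t (x m - x n) < e" if "m \<ge> M" "n \<ge> M" for m n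
      using that by blast
    show "\<exists>M. \<forall>m\<ge>M. \<forall>n\<ge>M. \<bar>fock_norm q t (x m) - fock_norm q t (x n)\<bar> < e"
      using M fock_norm_triangle_diff[OF qt] order_le_less_trans by blast
  qed
  then show ?thesis
    by (rule Cauchy_convergent)
qed

lemma fock_Cauchy_bounded:
  assumes qt: "\<bar>q\<bar> \<le> t" and x: "fock_Cauchy q t x"
  obtains K where "0 < K" "\<And>n. fock_norm q t (x n) \<le> K"
proof -
  have "Bseq (\<lambda>n. fock_norm q t (x n))"
    by (rule convergent_imp_Bseq[OF fock_Cauchy_norm_convergent[OF assms]])
  then obtain K where "0 < K" "\<And>n. norm (fock_norm q t (x n)) \<le> K"
    by (rule BseqE) auto
  then show ?thesis
    using that[of K] by (simp add: fock_norm_nonneg[OF qt])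
qed

lemma fock_null_rel_norm_diff:
  assumes qt: "\<bar>q\<bar> \<le> t" and xy: "(x, y) \<in> fock_null_rel q t"
  shows "(\<lambda>n. fock_norm q t (x n) - fock_norm q t (y n)) \<longlonglongrightarrow> 0"
proof (rule Lim_null_comparison)
  show "(\<lambda>n. fock_norm q t (x n - y n)) \<longlonglongrightarrow> 0"
    using xy by (simp add: fock_null_rel_def)
qed (simp add: fock_norm_triangle_diff[OF qt])

lemma equiv_fock_null_rel:
  assumes qt: "\<bar>q\<bar> \<le> t"
  shows "equiv {x. fock_Cauchy q t x} (fock_null_rel q t :: ((nat \<Rightarrow> 'a :: real_inner fock) \<times> _) set)"
proof (rule equivI)
  show "refl_on {x. fock_Cauchy q t x} (fock_null_rel q t :: ((nat \<Rightarrow> 'a fock) \<times> _) set)"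
    by (auto simp: refl_on_def fock_null_rel_def)
  show "sym (fock_null_rel q t :: ((nat \<Rightarrow> 'a fock) \<times> _) set)"
    by (auto simp: sym_def fock_null_rel_def fock_norm_minus_commute)
  show "trans (fock_null_rel q t :: ((nat \<Rightarrow> 'a fock) \<times> _) set)"
  proof (rule transI)
    fix x y z :: "nat \<Rightarrow> 'a fock"
    assume xy: "(x, y) \<in> fock_null_rel q t" and yz: "(y, z) \<in> fock_null_rel q t"
    have "(\<lambda>n. fock_norm q t (x n - z n)) \<longlonglongrightarrow> 0"
    proof (rule Lim_null_comparison)
      show "(\<lambda>n. fock_norm q t (x n - y n) + fock_norm q t (y n - z n)) \<longlonglongrightarrow> 0"
        using xy yz by (intro tendsto_add_zero) (auto simp: fock_null_rel_def)
    qed (simp add: fock_norm_diff_triangle[OF qt] fock_norm_nonneg[OF qt])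
    then show "(x, z) \<in> fock_null_rel q t"
      using xy yz by (simp add: fock_null_rel_def)
  qed
qed (auto simp: fock_null_rel_def)

lemma fock_space_cases:
  assumes "X \<in> fock_space q t"
  obtains x where "fock_Cauchy q t x" "X = fock_null_rel q t `` {x}"
  using assms by (auto simp: fock_space_def elim!: quotientE)

lemma fock_space_Cauchy: "X \<in> fock_space q t \<Longrightarrow> x \<in> X \<Longrightarrow> fock_Cauchy q t x"
  by (elim fock_space_cases) (auto simp: fock_null_rel_def)

lemma fock_space_rel:
  assumes "\<bar>q\<bar> \<le> t" "X \<in> fock_space q t" "x \<in> X" "y \<in> X"
  shows "(x, y) \<in> fock_null_rel q t"
  using quotient_eq_iff[OF equiv_fock_null_rel[OF assms(1)], of X X x y] assms(2-4)
  by (simp add: fock_space_def)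

lemma fock_space_nonempty:
  assumes "\<bar>q\<bar> \<le> t" "X \<in> fock_space q t"
  obtains x where "x \<in> X"
  using in_quotient_imp_non_empty[OF equiv_fock_null_rel[OF assms(1)]] assms(2)
  by (auto simp: fock_space_def)

lemma fock_class_in_space: "fock_Cauchy q t x \<Longrightarrow> fock_null_rel q t `` {x} \<in> fock_space q t"
  by (auto simp: fock_space_def intro: quotientI)

lemma mem_fock_class:
  assumes "\<bar>q\<bar> \<le> t" "fock_Cauchy q t x"
  shows "x \<in> fock_null_rel q t `` {x}"
  using equiv_class_self[OF equiv_fock_null_rel[OF assms(1)]] assms(2) by blast

text \<open>Equivalent Cauchy sequences have the same limit of norms, so the definite description in
  \<open>fock_space_norm\<close> picks out a unique number and any representative may be used to
  compute it.\<close>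

lemma fock_space_norm_tendsto:
  assumes qt: "\<bar>q\<bar> \<le> t" and X: "X \<in> fock_space q t" and x: "x \<in> X"
  shows "(\<lambda>n. fock_norm q t (x n)) \<longlonglongrightarrow> fock_space_norm q t X"
proof -
  obtain l where l: "(\<lambda>n. fock_norm q t (x n)) \<longlonglongrightarrow> l"
    using fock_Cauchy_norm_convergent[OF qt fock_space_Cauchy[OF X x]] by (auto simp: convergent_def)
  have all: "(\<lambda>n. fock_norm q t (y n)) \<longlonglongrightarrow> l" if "y \<in> X" for y
  proof -
    have "(\<lambda>n. fock_norm q t (y n) - fock_norm q t (x n) + fock_norm q t (x n)) \<longlonglongrightarrow> 0 + l"
      by (intro tendsto_add l fock_null_rel_norm_diff[OF qt] fock_space_rel[OF qt X] that x)
    then show ?thesis by simp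
  qed
  then have "fock_space_norm q t X = l"
    unfolding fock_space_norm_def using x LIMSEQ_unique by (intro the_equality) blast+
  then show ?thesis
    using l by simp
qed

lemma fock_inner_null_tendsto:
  assumes qt: "\<bar>q\<bar> \<le> t" and x: "fock_Cauchy q t x" and y: "(y, y') \<in> fock_null_rel q t"
  shows "(\<lambda>n. fock_inner q t (x n) (y n - y' n)) \<longlonglongrightarrow> 0"
proof -
  obtain K where K: "\<And>n. fock_norm q t (x n) \<le> K"
    using fock_Cauchy_bounded[OF qt x] by blast
  show ?thesis
  proof (rule Lim_null_comparison)
    show "(\<lambda>n. K * fock_norm q t (y n - y' n)) \<longlonglongrightarrow> 0"
      using y by (intro tendsto_mult_right_zero) (simp add: fock_null_rel_def)
    have "norm (fock_inner q t (x n) (y n - y' n)) \<le> K * fock_norm q t (y n - y' n)" for n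
      by (rule order_trans[OF fock_Cauchy_Schwarz[OF qt] mult_right_mono[OF K fock_norm_nonneg[OF qt]]])
    then show "\<forall>\<^sub>F n in sequentially.
        norm (fock_inner q t (x n) (y n - y' n)) \<le> K * fock_norm q t (y n - y' n)"
      by simp
  qed
qed

lemma fock_Cauchy_inner_convergent:
  assumes qt: "\<bar>q\<bar> \<le> t" and x: "fock_Cauchy q t x" and y: "fock_Cauchy q t y"
  shows "convergent (\<lambda>n. fock_inner q t (x n) (y n))"
proof -
  obtain K where K: "0 < K" "\<And>n. fock_norm q t (x n) \<le> K"
    using fock_Cauchy_bounded[OF qt x] by blast
  obtain L where L: "0 < L" "\<And>n. fock_norm q t (y n) \<le> L"
    using fock_Cauchy_bounded[OF qt y] by blast
  have "Cauchy (\<lambda>n. fock_inner q t (x n) (y n))"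
    unfolding Cauchy_def dist_norm
  proof (intro allI impI)
    fix e :: real assume "0 < e"
    then have "0 < e / (2 * K)" "0 < e / (2 * L)"
      using K(1) L(1) by simp_all
    then obtain M N where M: "\<And>m n. m \<ge> M \<Longrightarrow> n \<ge> M \<Longrightarrow> fock_norm q t (y m - y n) < e / (2 * K)"
      and N: "\<And>m n. m \<ge> N \<Longrightarrow> n \<ge> N \<Longrightarrow> fock_norm q t (x m - x n) < e / (2 * L)"
      using x y unfolding fock_Cauchy_def by metis
    have "norm (fock_inner q t (x m) (y m) - fock_inner q t (x n) (y n)) < e"
      if "m \<ge> max M N" "n \<ge> max M N" for m n
    proof -
      have "fock_inner q t (x m) (y m) - fock_inner q t (x n) (y n)
          = fock_inner q t (x m) (y m - y n) + fock_inner q t (x m - x n) (y n)"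
        by (simp add: fock_inner_diff_left fock_inner_diff_right)
      also have "norm \<dots> \<le> K * fock_norm q t (y m - y n) + fock_norm q t (x m - x n) * L"
        by (rule norm_triangle_mono; rule order_trans[OF fock_Cauchy_Schwarz[OF qt]])
          (intro mult_right_mono mult_left_mono K L fock_norm_nonneg[OF qt])+
      also have "\<dots> < K * (e / (2 * K)) + e / (2 * L) * L"
        using M[of m n] N[of m n] that K(1) L(1)
        by (intro add_strict_mono mult_strict_left_mono mult_strict_right_mono) auto
      also have "\<dots> = e"
        using K(1) L(1) by simp
      finally show ?thesis .
    qed
    then show "\<exists>M. \<forall>m\<ge>M. \<forall>n\<ge>M. norm (fock_inner q t (x m) (y m) - fock_inner q t (x n) (y n)) < e"
      by blast
  qed
  then show ?thesis
    by (rule Cauchy_convergent)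
qed

lemma fock_space_inner_tendsto:
  assumes qt: "\<bar>q\<bar> \<le> t" and X: "X \<in> fock_space q t" and Y: "Y \<in> fock_space q t"
    and x: "x \<in> X" and y: "y \<in> Y"
  shows "(\<lambda>n. fock_inner q t (x n) (y n)) \<longlonglongrightarrow> fock_space_inner q t X Y"
proof -
  note Cauchy = fock_space_Cauchy[OF X] fock_space_Cauchy[OF Y]
  obtain l where l: "(\<lambda>n. fock_inner q t (x n) (y n)) \<longlonglongrightarrow> l"
    using fock_Cauchy_inner_convergent[OF qt Cauchy(1)[OF x] Cauchy(2)[OF y]]
    by (auto simp: convergent_def)
  have all: "(\<lambda>n. fock_inner q t (x' n) (y' n)) \<longlonglongrightarrow> l" if "x' \<in> X" "y' \<in> Y" for x' y'
  proof -
    \<comment> \<open>One slot is changed at a time: first \<open>y'\<close> to \<open>y\<close>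
      against the Cauchy, hence bounded, sequence \<open>x'\<close>, then \<open>x'\<close> to
      \<open>x\<close> against \<open>y\<close>.\<close>
    have 1: "(\<lambda>n. fock_inner q t (x' n) (y' n - y n)) \<longlonglongrightarrow> 0"
      by (rule fock_inner_null_tendsto[OF qt Cauchy(1)[OF that(1)] fock_space_rel[OF qt Y that(2) y]])
    have "(\<lambda>n. cnj (fock_inner q t (y n) (x' n - x n))) \<longlonglongrightarrow> cnj 0"
      by (intro tendsto_cnj fock_inner_null_tendsto[OF qt Cauchy(2)[OF y] fock_space_rel[OF qt X that(1) x]])
    then have 2: "(\<lambda>n. fock_inner q t (x' n - x n) (y n)) \<longlonglongrightarrow> 0"
      by (simp flip: fock_inner_commute)
    show ?thesis
      using tendsto_add[OF tendsto_add[OF 1 2] l]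
      by (simp add: fock_inner_diff_left fock_inner_diff_right)
  qed
  then have "fock_space_inner q t X Y = l"
    unfolding fock_space_inner_def using x y LIMSEQ_unique by (intro the_equality) blast+
  then show ?thesis
    using l by simp
qed


subsection \<open>Extension of bounded operators\<close>

text \<open>\<open>fock_bounded\<close> leaves the sign of the constant open, while the Cauchy
  estimates divide by it.\<close>

lemma fock_bounded_pos:
  assumes qt: "\<bar>q\<bar> \<le> t" and "fock_bounded q t T"
  obtains C where "0 < C" "\<And>\<xi>. fock_norm q t (T \<xi>) \<le> C * fock_norm q t \<xi>"
proof -
  obtain C where C: "fock_norm q t (T \<xi>) \<le> C * fock_norm q t \<xi>" for \<xi>
    using assms(2) by (auto simp: fock_bounded_def)
  have "fock_norm q t (T \<xi>) \<le> max C 1 * fock_norm q t \<xi>" for \<xi>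
    using C[of \<xi>] mult_right_mono[OF max.cobounded1[of C 1] fock_norm_nonneg[OF qt, of \<xi>]]
    by (rule order_trans)
  then show ?thesis
    using that[of "max C 1"] by simp
qed

lemma fock_bounded_null_rel:
  assumes qt: "\<bar>q\<bar> \<le> t" and T: "clinear T" "fock_bounded q t T"
    and xy: "(x, y) \<in> fock_null_rel q t"
  shows "(T \<circ> x, T \<circ> y) \<in> fock_null_rel q t"
proof -
  obtain C where C: "0 < C" "\<And>\<xi>. fock_norm q t (T \<xi>) \<le> C * fock_norm q t \<xi>"
    using fock_bounded_pos[OF qt T(2)] by blast
  have Cauchy: "fock_Cauchy q t (T \<circ> z)" if z: "fock_Cauchy q t z" for z
    unfolding fock_Cauchy_def
  proof (intro allI impI)
    fix e :: real assume "0 < e"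
    then have "0 < e / C" using C(1) by simp
    then obtain M where M: "\<And>m n. m \<ge> M \<Longrightarrow> n \<ge> M \<Longrightarrow> fock_norm q t (z m - z n) < e / C"
      using z unfolding fock_Cauchy_def by metis
    have "fock_norm q t ((T \<circ> z) m - (T \<circ> z) n) < e" if "m \<ge> M" "n \<ge> M" for m n
      using C(2)[of "z m - z n"] M[OF that] C(1)
      by (simp add: clinearD[OF T(1)] pos_less_divide_eq mult.commute)
    then show "\<exists>M. \<forall>m\<ge>M. \<forall>n\<ge>M. fock_norm q t ((T \<circ> z) m - (T \<circ> z) n) < e"
      by blast
  qed
  have "(\<lambda>n. fock_norm q t ((T \<circ> x) n - (T \<circ> y) n)) \<longlonglongrightarrow> 0"
  proof (rule Lim_null_comparison)
    show "(\<lambda>n. C * fock_norm q t (x n - y n)) \<longlonglongrightarrow> 0"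
      using xy by (intro tendsto_mult_right_zero) (simp add: fock_null_rel_def)
    have "norm (fock_norm q t ((T \<circ> x) n - (T \<circ> y) n)) \<le> C * fock_norm q t (x n - y n)" for n
      using C(2)[of "x n - y n"] by (simp add: clinearD[OF T(1)] fock_norm_nonneg[OF qt])
    then show "\<forall>\<^sub>F n in sequentially.
        norm (fock_norm q t ((T \<circ> x) n - (T \<circ> y) n)) \<le> C * fock_norm q t (x n - y n)"
      by simp
  qed
  then show ?thesis
    using xy Cauchy by (simp add: fock_null_rel_def)
qed

text \<open>All classes in the union that defines \<open>fock_extension\<close> coincide, since a
  bounded linear map respects null sequences.\<close>

lemma fock_extension_eq:
  assumes qt: "\<bar>q\<bar> \<le> t" and T: "clinear T" "fock_bounded q t T"
    and X: "X \<in> fock_space q t" "x \<in> X"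
  shows "fock_extension q t T X = fock_null_rel q t `` {T \<circ> x}"
proof -
  have eq: "fock_null_rel q t `` {T \<circ> y} = fock_null_rel q t `` {T \<circ> x}" if "y \<in> X" for y
    by (intro equiv_class_eq[OF equiv_fock_null_rel[OF qt]] fock_bounded_null_rel[OF qt T]
        fock_space_rel[OF qt X(1) that X(2)])
  show ?thesis
    unfolding fock_extension_def by (rule UN_constant_eq[OF X(2)]) (intro ballI eq)
qed

lemma fock_extension_mem:
  assumes qt: "\<bar>q\<bar> \<le> t" and T: "clinear T" "fock_bounded q t T"
    and X: "X \<in> fock_space q t" and x: "x \<in> X"
  shows "T \<circ> x \<in> fock_extension q t T X" "fock_extension q t T X \<in> fock_space q t"
proof -
  have "(T \<circ> x, T \<circ> x) \<in> fock_null_rel q t"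
    by (rule fock_bounded_null_rel[OF qt T fock_space_rel[OF qt X x x]])
  then have "fock_Cauchy q t (T \<circ> x)" by (simp add: fock_null_rel_def)
  then show "T \<circ> x \<in> fock_extension q t T X" "fock_extension q t T X \<in> fock_space q t"
    unfolding fock_extension_eq[OF assms]
    by (simp_all add: mem_fock_class[OF qt, simplified] fock_class_in_space)
qed

lemma fock_extension_norm_le:
  assumes qt: "\<bar>q\<bar> \<le> t" and T: "clinear T" and X: "X \<in> fock_space q t"
    and C: "\<And>\<xi>. fock_norm q t (T \<xi>) \<le> C * fock_norm q t \<xi>"
  shows "fock_space_norm q t (fock_extension q t T X) \<le> C * fock_space_norm q t X"
proof -
  obtain x where x: "x \<in> X"
    using fock_space_nonempty[OF qt X] by blast
  have bdd: "fock_bounded q t T"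
    using C by (auto simp: fock_bounded_def)
  note ext = fock_extension_mem[OF qt T bdd X x]
  show ?thesis
  proof (rule LIMSEQ_le)
    show "(\<lambda>n. fock_norm q t ((T \<circ> x) n)) \<longlonglongrightarrow> fock_space_norm q t (fock_extension q t T X)"
      by (rule fock_space_norm_tendsto[OF qt ext(2,1)])
    show "(\<lambda>n. C * fock_norm q t (x n)) \<longlonglongrightarrow> C * fock_space_norm q t X"
      by (intro tendsto_mult_left fock_space_norm_tendsto[OF qt X x])
  qed (use C in auto)
qed

lemma fock_space_norm_nonneg:
  assumes qt: "\<bar>q\<bar> \<le> t" and X: "X \<in> fock_space q t"
  shows "0 \<le> fock_space_norm q t X"
proof -
  obtain x where "x \<in> X"
    using fock_space_nonempty[OF assms] by blast
  then show ?thesis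
    by (rule LIMSEQ_le_const[OF fock_space_norm_tendsto[OF qt X]]) (simp add: fock_norm_nonneg[OF qt])
qed

lemma fock_space_bounded_extension:
  assumes qt: "\<bar>q\<bar> \<le> t" and T: "clinear T" "fock_bounded q t T"
  shows "fock_space_bounded q t (fock_extension q t T)"
proof -
  obtain C where "\<And>\<xi>. fock_norm q t (T \<xi>) \<le> C * fock_norm q t \<xi>"
    using T(2) by (auto simp: fock_bounded_def)
  then show ?thesis
    using fock_extension_mem(2)[OF qt T] fock_space_nonempty[OF qt]
      fock_extension_norm_le[OF qt T(1)]
    unfolding fock_space_bounded_def by (metis image_subsetI)
qed

text \<open>Constant sequences embed the algebraic Fock space isometrically, so lower bounds for
  operator norms can be tested on it.\<close>

lemma fock_space_norm_const:
  assumes qt: "\<bar>q\<bar> \<le> t"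
  shows "fock_space_norm q t (fock_null_rel q t `` {\<lambda>n. \<xi>}) = fock_norm q t \<xi>"
  using fock_space_norm_tendsto[OF qt fock_class_in_space[OF fock_Cauchy_const]
      mem_fock_class[OF qt fock_Cauchy_const], of \<xi>]
  by (simp add: LIMSEQ_const_iff)

lemma fock_space_opnorm_upper:
  fixes T :: "'a :: real_inner fock \<Rightarrow> 'a fock"
  assumes qt: "\<bar>q\<bar> \<le> t" and T: "clinear T" "fock_bounded q t T"
    and X: "X \<in> fock_space q t" "fock_space_norm q t X \<le> 1"
  shows "fock_space_norm q t (fock_extension q t T X) \<le> fock_space_opnorm q t (fock_extension q t T)"
  unfolding fock_space_opnorm_def
proof (rule cSUP_upper)
  obtain K where K: "0 < K" "\<And>\<xi>. fock_norm q t (T \<xi>) \<le> K * fock_norm q t \<xi>"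
    using fock_bounded_pos[OF qt T(2)] by blast
  show "bdd_above ((\<lambda>X. fock_space_norm q t (fock_extension q t T X))
      ` {X \<in> fock_space q t. fock_space_norm q t X \<le> 1})"
  proof (rule bdd_aboveI2)
    fix X :: "(nat \<Rightarrow> 'a fock) set"
    assume X: "X \<in> {X \<in> fock_space q t. fock_space_norm q t X \<le> 1}"
    then have "fock_space_norm q t (fock_extension q t T X) \<le> K * fock_space_norm q t X"
      by (intro fock_extension_norm_le[OF qt T(1) _ K(2)]) simp
    also have "\<dots> \<le> K * 1"
      using X K(1) by (intro mult_left_mono) auto
    finally show "fock_space_norm q t (fock_extension q t T X) \<le> K * 1" .
  qed
qed (use X in simp)

lemma fock_space_opnorm_nonneg:
  assumes qt: "\<bar>q\<bar> \<le> t" and T: "clinear T" "fock_bounded q t T"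
  shows "0 \<le> fock_space_opnorm q t (fock_extension q t T)"
proof -
  let ?X = "fock_null_rel q t `` {\<lambda>n. 0}"
  have X: "?X \<in> fock_space q t"
    by (rule fock_class_in_space[OF fock_Cauchy_const])
  have "0 \<le> fock_space_norm q t (fock_extension q t T ?X)"
    by (rule fock_space_norm_nonneg[OF qt fock_extension_mem(2)[OF qt T X
          mem_fock_class[OF qt fock_Cauchy_const]]])
  also have "\<dots> \<le> fock_space_opnorm q t (fock_extension q t T)"
    by (rule fock_space_opnorm_upper[OF qt T X]) (simp add: fock_space_norm_const[OF qt])
  finally show ?thesis .
qed

text \<open>This bridges the completion and the algebraic Fock space. An estimate on the latter
  passes to limits of representatives; conversely, a normalised vector, viewed as a constant
  sequence, lies in the unit ball over which the supremum is taken.\<close>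

lemma fock_space_opnorm_le_iff:
  fixes T :: "'a :: real_inner fock \<Rightarrow> 'a fock"
  assumes qt: "\<bar>q\<bar> \<le> t" and T: "clinear T" "fock_bounded q t T" and "0 \<le> C"
  shows "fock_space_opnorm q t (fock_extension q t T) \<le> C
    \<longleftrightarrow> (\<forall>\<xi>. fock_norm q t (T \<xi>) \<le> C * fock_norm q t \<xi>)"
proof -
  define S :: "(nat \<Rightarrow> 'a fock) set set"
    where "S = {X \<in> fock_space q t. fock_space_norm q t X \<le> 1}"
  have const: "fock_null_rel q t `` {\<lambda>n. \<xi>} \<in> fock_space q t" for \<xi> :: "'a fock"
    by (rule fock_class_in_space[OF fock_Cauchy_const])
  have "S \<noteq> {}"
    using const[of 0] fock_space_norm_const[OF qt, of "0 :: 'a fock"] by (auto simp: S_def)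
  obtain K where K: "\<And>\<xi>. fock_norm q t (T \<xi>) \<le> K * fock_norm q t \<xi>"
    using T(2) unfolding fock_bounded_def by blast
  show ?thesis
  proof
    assume C: "\<forall>\<xi>. fock_norm q t (T \<xi>) \<le> C * fock_norm q t \<xi>"
    show "fock_space_opnorm q t (fock_extension q t T) \<le> C"
      unfolding fock_space_opnorm_def S_def[symmetric]
    proof (intro cSUP_least \<open>S \<noteq> {}\<close>)
      fix X assume X: "X \<in> S"
      have "fock_space_norm q t (fock_extension q t T X) \<le> C * fock_space_norm q t X"
        using X C by (intro fock_extension_norm_le[OF qt T(1)]) (auto simp: S_def)
      also have "\<dots> \<le> C * 1"
        using X \<open>0 \<le> C\<close> by (intro mult_left_mono) (auto simp: S_def)
      finally show "fock_space_norm q t (fock_extension q t T X) \<le> C" by simp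
    qed
  next
    assume C: "fock_space_opnorm q t (fock_extension q t T) \<le> C"
    show "\<forall>\<xi>. fock_norm q t (T \<xi>) \<le> C * fock_norm q t \<xi>"
    proof
      fix \<xi>
      show "fock_norm q t (T \<xi>) \<le> C * fock_norm q t \<xi>"
      proof (cases "fock_norm q t \<xi> = 0")
        \<comment> \<open>A vector of seminorm zero cannot be normalised, but boundedness with any
          constant \<open>K\<close> forces its image to have seminorm zero too.\<close>
        case True
        then show ?thesis
          using K[of \<xi>] by simp
      next
        case False
        then have pos: "0 < fock_norm q t \<xi>"
          using fock_norm_nonneg[OF qt, of \<xi>] by simp
        define r where "r = inverse (fock_norm q t \<xi>)"
        define \<eta> where "\<eta> = complex_of_real r *\<^sub>C \<xi>"
        let ?X = "fock_null_rel q t `` {\<lambda>n. \<eta>}"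
        have "0 < r"
          using pos by (simp add: r_def)
        have "fock_norm q t \<eta> = r * fock_norm q t \<xi>"
          using \<open>0 < r\<close> by (simp add: \<eta>_def fock_norm_scale)
        then have "?X \<in> S"
          using const pos by (simp add: S_def fock_space_norm_const[OF qt] r_def)
        have "fock_extension q t T ?X = fock_null_rel q t `` {T \<circ> (\<lambda>n. \<eta>)}"
          by (rule fock_extension_eq[OF qt T const mem_fock_class[OF qt fock_Cauchy_const]])
        then have "fock_norm q t (T \<eta>) = fock_space_norm q t (fock_extension q t T ?X)"
          by (simp add: fock_space_norm_const[OF qt] comp_def)
        also have "\<dots> \<le> fock_space_opnorm q t (fock_extension q t T)"
          using \<open>?X \<in> S\<close> by (intro fock_space_opnorm_upper[OF qt T]) (auto simp: S_def)
        also note C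
        finally have "r * fock_norm q t (T \<xi>) \<le> C"
          using \<open>0 < r\<close> by (simp add: \<eta>_def clinearD[OF T(1)] fock_norm_scale)
        then show ?thesis
          using pos by (simp add: r_def field_simps)
      qed
    qed
  qed
qed


section \<open>Pair partitions of finite sets\<close>

text \<open>Arbitrary ground sets are allowed because deleting a block from a pairing of an interval
  leaves gaps.\<close>

definition pair_partitions_on :: "nat set \<Rightarrow> nat set set set"
  where "pair_partitions_on A = {V. partition_on A V \<and> (\<forall>B\<in>V. card B = 2)}"

lemma pair_blockE:
  fixes B :: "nat set"
  assumes "card B = 2"
  obtains "B = {Min B, Max B}" "Min B < Max B"
proof -
  obtain a b where B: "B = {a, b}" "a < b"
    using assms by (metis card_2_iff insert_commute linorder_neqE_nat)
  then have "Min B = a" "Max B = b"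
    by simp_all
  then show ?thesis
    using that B by simp
qed

lemma finite_pair_partitions_on: "finite A \<Longrightarrow> finite (pair_partitions_on A)"
  unfolding pair_partitions_on_def
  by (rule finite_subset[OF _ finitely_many_partition_on]) auto

lemma pair_partitions_on_empty: "pair_partitions_on {} = {{}}"
  by (auto simp: pair_partitions_on_def partition_on_def)

lemma pair_partitionsD:
  assumes "V \<in> pair_partitions_on A"
  shows "\<Union>V = A" "\<And>B. B \<in> V \<Longrightarrow> card B = 2"
    "\<And>B C x. B \<in> V \<Longrightarrow> C \<in> V \<Longrightarrow> x \<in> B \<Longrightarrow> x \<in> C \<Longrightarrow> B = C"
  using assms unfolding pair_partitions_on_def partition_on_def disjoint_def by blast+

lemma pair_partitionsI:
  assumes "\<Union>V = A" "\<And>B. B \<in> V \<Longrightarrow> card B = 2"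
    "\<And>B C x. B \<in> V \<Longrightarrow> C \<in> V \<Longrightarrow> x \<in> B \<Longrightarrow> x \<in> C \<Longrightarrow> B = C"
  shows "V \<in> pair_partitions_on A"
proof -
  have "{} \<notin> V"
    using assms(2)[of "{}"] by auto
  moreover have "disjoint V"
    unfolding disjoint_def using assms(3) by blast
  ultimately show ?thesis
    using assms(1,2) by (simp add: pair_partitions_on_def partition_on_def)
qed

lemma insert_pair_partition:
  assumes "w \<in> A" "z \<in> A - {w}" "V \<in> pair_partitions_on (A - {w, z})"
  shows "insert {w, z} V \<in> pair_partitions_on A"
proof (rule pair_partitionsI)
  note V = pair_partitionsD[OF assms(3)]
  show "\<Union>(insert {w, z} V) = A"
    using V(1) assms(1,2) by auto
  show "card B = 2" if "B \<in> insert {w, z} V" for B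
    using that V(2) assms(2) by auto
  have no: "x \<noteq> w \<and> x \<noteq> z" if "x \<in> C" "C \<in> V" for x C
    using that V(1) by auto
  show "B = C" if "B \<in> insert {w, z} V" "C \<in> insert {w, z} V" "x \<in> B" "x \<in> C" for B C x
    using that V(3)[of B C x] no[of x B] no[of x C] by auto
qed

text \<open>A pairing is determined by the partner \<open>z\<close> of a fixed point
  \<open>w\<close> together with the pairing of the remaining points.\<close>

lemma bij_betw_insert_pair:
  assumes "w \<in> A"
  shows "bij_betw (\<lambda>(z, V). insert {w, z} V)
    (SIGMA z:A - {w}. pair_partitions_on (A - {w, z})) (pair_partitions_on A)"
  unfolding bij_betw_def
proof
  let ?S = "SIGMA z:A - {w}. pair_partitions_on (A - {w, z})"
  have notin: "{w, z} \<notin> V" "{w, z'} \<notin> V" if "V \<in> pair_partitions_on (A - {w, z})" for z z' V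
    using pair_partitionsD(1)[OF that] by blast+
  show "inj_on (\<lambda>(z, V). insert {w, z} V) ?S"
  proof (rule inj_onI)
    fix a b
    assume a: "a \<in> ?S" and b: "b \<in> ?S"
      and ab: "(case a of (z, V) \<Rightarrow> insert {w, z} V) = (case b of (z, V) \<Rightarrow> insert {w, z} V)"
    obtain z V z' V' where zV: "a = (z, V)" "b = (z', V')"
      by (cases a, cases b) blast
    have z: "z \<in> A" "z \<noteq> w" "z' \<in> A" "z' \<noteq> w"
      and V: "V \<in> pair_partitions_on (A - {w, z})" "V' \<in> pair_partitions_on (A - {w, z'})"
      and eq: "insert {w, z} V = insert {w, z'} V'"
      using a b ab by (simp_all add: zV)
    have "{w, z} \<in> insert {w, z'} V'"
      using eq by blast
    then have "{w, z} = {w, z'}"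
      using notin(2)[OF V(2)] by blast
    then have "z = z'"
      using z by (auto simp: doubleton_eq_iff)
    moreover have "V = V'"
      using eq notin(1)[OF V(1)] notin(1)[OF V(2)] unfolding \<open>z = z'\<close> by (metis insert_ident)
    ultimately show "a = b"
      by (simp add: zV)
  qed
  show "(\<lambda>(z, V). insert {w, z} V) ` ?S = pair_partitions_on A"
  proof (intro equalityI subsetI)
    fix V assume "V \<in> (\<lambda>(z, V). insert {w, z} V) ` ?S"
    then show "V \<in> pair_partitions_on A"
      using insert_pair_partition[OF assms] by auto
  next
    fix V assume "V \<in> pair_partitions_on A"
    note V = pair_partitionsD[OF this]
    obtain B where B: "B \<in> V" "w \<in> B"
      using V(1) assms by blast
    obtain z where z: "B = {w, z}" "z \<noteq> w"
      using V(2)[OF B(1)] B(2) by (metis card_2_iff doubleton_eq_iff insertE singletonD)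
    have "z \<in> A"
      using V(1) B z by blast
    have "V - {B} \<in> pair_partitions_on (A - {w, z})"
    proof (rule pair_partitionsI)
      have "x \<notin> B" if "x \<in> C" "C \<in> V - {B}" for x C
        using V(3)[of B C x] that B(1) by blast
      then show "\<Union>(V - {B}) = A - {w, z}"
        using V(1) z(1) by blast
    qed (use V(2,3) in blast)+
    moreover have "V = insert {w, z} (V - {B})"
      using B z by blast
    ultimately show "V \<in> (\<lambda>(z, V). insert {w, z} V) ` ?S"
      using \<open>z \<in> A\<close> z(2) by (intro image_eqI[of _ _ "(z, V - {B})"]) auto
  qed
qed

lemma sum_pair_partitions_remove:
  assumes "finite A" "w \<in> A"
  shows "(\<Sum>V\<in>pair_partitions_on A. G V)
    = (\<Sum>z\<in>A - {w}. \<Sum>V\<in>pair_partitions_on (A - {w, z}). G (insert {w, z} V))"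
proof -
  have "(\<Sum>V\<in>pair_partitions_on A. G V)
      = (\<Sum>(z, V)\<in>(SIGMA z:A - {w}. pair_partitions_on (A - {w, z})). G (insert {w, z} V))"
    by (subst sum.reindex_bij_betw[OF bij_betw_insert_pair[OF assms(2)], symmetric])
      (simp add: case_prod_beta)
  then show ?thesis
    using assms by (simp add: sum.Sigma finite_pair_partitions_on)
qed

section \<open>Weighted sums over pairings\<close>

definition pairing_sum ::
    "real \<Rightarrow> real \<Rightarrow> (nat \<Rightarrow> nat \<Rightarrow> complex) \<Rightarrow> nat set \<Rightarrow> complex"
  where "pairing_sum q t p A = (\<Sum>V\<in>pair_partitions_on A.
    complex_of_real (q ^ crossings V * t ^ nestings V) * (\<Prod>B\<in>V. p (Min B) (Max B)))"

lemma pairing_sum_empty: "pairing_sum q t p {} = 1"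
  by (simp add: pairing_sum_def pair_partitions_on_empty crossings_def nestings_def)

text \<open>The new block has the largest opener, so it can only be the second block of a crossing
  pair. It crosses the blocks that close strictly between \<open>w\<close> and
  \<open>z\<close>.\<close>

lemma crossings_insert:
  assumes "finite V" "w < z" and V: "\<And>B. B \<in> V \<Longrightarrow> Min B < w"
  shows "crossings (insert {w, z} V) = crossings V + card {B \<in> V. w < Max B \<and> Max B < z}"
proof -
  let ?D = "{w, z}"
  have D: "Min ?D = w" "Max ?D = z" "?D \<notin> V"
    using assms(2) V[of ?D] by auto
  let ?X = "{(B, C). B \<in> V \<and> C \<in> V \<and> Min B < Min C \<and> Min C < Max B \<and> Max B < Max C}"
  let ?Y = "(\<lambda>B. (B, ?D)) ` {B \<in> V. w < Max B \<and> Max B < z}"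
  have "crossings (insert ?D V) = card (?X \<union> ?Y)"
    unfolding crossings_def
  proof (rule arg_cong[where f = card], intro equalityI subsetI)
    fix P assume P: "P \<in> {(B, C). B \<in> insert ?D V \<and> C \<in> insert ?D V \<and>
        Min B < Min C \<and> Min C < Max B \<and> Max B < Max C}"
    then obtain B C where BC: "P = (B, C)" "B \<in> insert ?D V" "C \<in> insert ?D V"
        "Min B < Min C" "Min C < Max B" "Max B < Max C"
      by blast
    have "B \<in> V"
      using BC V[of C] D by auto
    then show "P \<in> ?X \<union> ?Y"
      using BC D by auto
  next
    fix P assume "P \<in> ?X \<union> ?Y"
    then show "P \<in> {(B, C). B \<in> insert ?D V \<and> C \<in> insert ?D V \<and>
        Min B < Min C \<and> Min C < Max B \<and> Max B < Max C}"
      using D V by auto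
  qed
  also have "\<dots> = card ?X + card ?Y"
  proof (rule card_Un_disjoint)
    show "finite ?X"
      by (rule finite_subset[of _ "V \<times> V"]) (use assms(1) in auto)
    show "?X \<inter> ?Y = {}"
      using D(3) by blast
  qed (use assms(1) in simp)
  also have "card ?Y = card {B \<in> V. w < Max B \<and> Max B < z}"
    by (rule card_image) (auto simp: inj_on_def)
  finally show ?thesis
    by (simp add: crossings_def)
qed

text \<open>With the largest opener, the new block can only be the inner one of a nesting, and it is
  nested in precisely those blocks that close after \<open>z\<close>.\<close>

lemma nestings_insert:
  assumes "finite V" "w < z" and V: "\<And>B. B \<in> V \<Longrightarrow> Min B < w"
  shows "nestings (insert {w, z} V) = nestings V + card {B \<in> V. z < Max B}"
proof -
  let ?D = "{w, z}"
  have D: "Min ?D = w" "Max ?D = z" "?D \<notin> V"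
    using assms(2) V[of ?D] by auto
  let ?X = "{(B, C). B \<in> V \<and> C \<in> V \<and> Min B < Min C \<and> Min C < Max C \<and> Max C < Max B}"
  let ?Y = "(\<lambda>B. (B, ?D)) ` {B \<in> V. z < Max B}"
  have "nestings (insert ?D V) = card (?X \<union> ?Y)"
    unfolding nestings_def
  proof (rule arg_cong[where f = card], intro equalityI subsetI)
    fix P assume P: "P \<in> {(B, C). B \<in> insert ?D V \<and> C \<in> insert ?D V \<and>
        Min B < Min C \<and> Min C < Max C \<and> Max C < Max B}"
    then obtain B C where BC: "P = (B, C)" "B \<in> insert ?D V" "C \<in> insert ?D V"
        "Min B < Min C" "Min C < Max C" "Max C < Max B"
      by blast
    have "B \<in> V"
      using BC V[of C] D by auto
    then show "P \<in> ?X \<union> ?Y"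
      using BC D by auto
  next
    fix P assume "P \<in> ?X \<union> ?Y"
    then show "P \<in> {(B, C). B \<in> insert ?D V \<and> C \<in> insert ?D V \<and>
        Min B < Min C \<and> Min C < Max C \<and> Max C < Max B}"
      using D V assms(2) by auto
  qed
  also have "\<dots> = card ?X + card ?Y"
  proof (rule card_Un_disjoint)
    show "finite ?X"
      by (rule finite_subset[of _ "V \<times> V"]) (use assms(1) in auto)
    show "?X \<inter> ?Y = {}"
      using D(3) by blast
  qed (use assms(1) in simp)
  also have "card ?Y = card {B \<in> V. z < Max B}"
    by (rule card_image) (auto simp: inj_on_def)
  finally show ?thesis
    by (simp add: nestings_def)
qed

text \<open>
  Splits off the block of the last opener \<open>w\<close>. In a pairing with nonzero contribution all
  elements of \<open>R\<close> are closers, and those other than \<open>z\<close> are paired with openers to the left of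
  \<open>w\<close>; so \<open>{w, z}\<close> crosses the blocks closing before \<open>z\<close> and is nested in those closing after \<open>z\<close>.
\<close>

lemma pairing_sum_last_opener:
  fixes p :: "nat \<Rightarrow> nat \<Rightarrow> complex"
  assumes fin: "finite L" "finite R"
    and L: "\<And>x. x \<in> L \<Longrightarrow> x < w" and R: "\<And>x. x \<in> R \<Longrightarrow> w < x"
    and p: "\<And>x y. p x y \<noteq> 0 \<Longrightarrow> opener x \<and> \<not> opener y"
    and w: "opener w" and closers: "\<And>x. x \<in> R \<Longrightarrow> \<not> opener x"
  shows "pairing_sum q t p (insert w (L \<union> R)) =
    (\<Sum>z\<in>R. complex_of_real (q ^ card {x \<in> R. x < z} * t ^ card {x \<in> R. z < x}) * p w z
      * pairing_sum q t p (L \<union> (R - {z})))"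
proof -
  let ?A = "insert w (L \<union> R)"
  define G where "G V = complex_of_real (q ^ crossings V * t ^ nestings V) * (\<Prod>B\<in>V. p (Min B) (Max B))" for V
  have pairing_sum_G: "pairing_sum q t p B = sum G (pair_partitions_on B)" for B
    unfolding pairing_sum_def by (rule sum.cong[OF refl]) (simp only: G_def)
  have notin: "w \<notin> L" "w \<notin> R" "L \<inter> R = {}"
    using L R by force+
  have finV: "finite V" if "V \<in> pair_partitions_on A" "finite A" for V A
    using that(1) finite_elements[OF that(2)] by (simp add: pair_partitions_on_def)
  have prod: "(\<Prod>B\<in>insert {w, z} V. p (Min B) (Max B))
      = p (min w z) (max w z) * (\<Prod>B\<in>V. p (Min B) (Max B))"
    if "V \<in> pair_partitions_on (?A - {w, z})" for z V
  proof -
    have "{w, z} \<notin> V"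
      using pair_partitionsD(1)[OF that] by blast
    then show ?thesis
      using finV[OF that] fin by (simp add: min_def max_def)
  qed
  have zL: "G (insert {w, z} V) = 0" if "z \<in> L" "V \<in> pair_partitions_on (?A - {w, z})" for z V
  proof -
    \<comment> \<open>A partner to the left would make \<open>w\<close> the closer of its block,
      whereas \<open>w\<close> is an opener.\<close>
    have "p (min w z) (max w z) = 0"
      using p[of z w] w L[OF that(1)] by (auto simp: min_def max_def)
    then show ?thesis
      by (simp add: G_def prod[OF that(2)])
  qed
  have zR: "G (insert {w, z} V)
      = complex_of_real (q ^ card {x \<in> R. x < z} * t ^ card {x \<in> R. z < x}) * p w z * G V"
    if z: "z \<in> R" and V: "V \<in> pair_partitions_on (?A - {w, z})" for z V
  proof (cases "(\<Prod>B\<in>V. p (Min B) (Max B)) = 0")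
    case True
    then show ?thesis
      by (simp add: G_def prod[OF V])
  next
    case False
    note VD = pair_partitionsD[OF V]
    have "finite V"
      using finV[OF V] fin by simp
    have block: "opener (Min B)" "\<not> opener (Max B)" "B = {Min B, Max B}" if "B \<in> V" for B
    proof -
      have "p (Min B) (Max B) \<noteq> 0"
        using False \<open>finite V\<close> that by auto
      then show "opener (Min B)" "\<not> opener (Max B)"
        using p by blast+
      show "B = {Min B, Max B}"
        using VD(2)[OF that] by (rule pair_blockE)
    qed
    have MinL: "Min B < w" if "B \<in> V" for B
    proof -
      have "Min B \<in> ?A - {w, z}"
        using VD(1) that block(3)[OF that] by blast
      then show ?thesis
        using block(1)[OF that] closers L by auto
    qed
    \<comment> \<open>Taking closers maps the blocks that close to the right of \<open>w\<close>
      onto \<open>R - {z}\<close>. The predicate \<open>P\<close> is instantiated twice, once to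
      count crossings and once to count nestings.\<close>
    have MaxR: "Max ` {B \<in> V. P (Max B) \<and> w < Max B} = {x \<in> R. x \<noteq> z \<and> P x}" for P
    proof (intro equalityI subsetI)
      fix x assume "x \<in> Max ` {B \<in> V. P (Max B) \<and> w < Max B}"
      then obtain B where B: "B \<in> V" "x = Max B" "P x" "w < x"
        by auto
      then have "x \<in> ?A - {w, z}"
        using VD(1) block(3)[OF B(1)] by blast
      then show "x \<in> {x \<in> R. x \<noteq> z \<and> P x}"
        using B(3,4) L by force
    next
      fix x assume x: "x \<in> {x \<in> R. x \<noteq> z \<and> P x}"
      then have "x \<in> ?A - {w, z}"
        using notin by auto
      then obtain B where B: "B \<in> V" "x \<in> B"
        using VD(1) by blast
      have "x \<in> {Min B, Max B}"
        using B(2) by (subst block(3)[OF B(1), symmetric])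
      moreover have "x \<noteq> Min B"
        using block(1)[OF B(1)] closers x by auto
      ultimately have "x = Max B" by simp
      then show "x \<in> Max ` {B \<in> V. P (Max B) \<and> w < Max B}"
        using B(1) x R by auto
    qed
    have "inj_on Max V"
    proof (rule inj_onI)
      fix B C assume "B \<in> V" "C \<in> V" "Max B = Max C"
      then show "B = C"
        using VD(3)[of B C "Max B"] block(3)[of B] block(3)[of C] by blast
    qed
    then have card: "card {B \<in> V. P (Max B) \<and> w < Max B} = card {x \<in> R. x \<noteq> z \<and> P x}" for P
      unfolding MaxR[of P, symmetric] by (intro card_image[symmetric]) (auto intro: inj_on_subset)
    have "w < z"
      using R z by simp
    have 1: "{B \<in> V. w < Max B \<and> Max B < z} = {B \<in> V. Max B < z \<and> w < Max B}"
      "{B \<in> V. z < Max B} = {B \<in> V. z < Max B \<and> w < Max B}"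
      "{x \<in> R. x \<noteq> z \<and> x < z} = {x \<in> R. x < z}" "{x \<in> R. x \<noteq> z \<and> z < x} = {x \<in> R. z < x}"
      using \<open>w < z\<close> by auto
    have "crossings (insert {w, z} V) = crossings V + card {x \<in> R. x < z}"
      using crossings_insert[OF \<open>finite V\<close> \<open>w < z\<close> MinL] card[of "\<lambda>x. x < z"]
      by (simp only: 1(1,3))
    moreover have "nestings (insert {w, z} V) = nestings V + card {x \<in> R. z < x}"
      using nestings_insert[OF \<open>finite V\<close> \<open>w < z\<close> MinL] card[of "\<lambda>x. z < x"]
      by (simp only: 1(4) flip: 1(2))
    ultimately show ?thesis
      using \<open>w < z\<close> by (simp add: G_def prod[OF V] power_add mult_ac)
  qed
  have "pairing_sum q t p ?A = (\<Sum>z\<in>L \<union> R. \<Sum>V\<in>pair_partitions_on (?A - {w, z}). G (insert {w, z} V))"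
    unfolding pairing_sum_G
    using sum_pair_partitions_remove[of ?A w G] fin notin by (simp add: Diff_insert_absorb)
  also have "\<dots> = (\<Sum>z\<in>R. \<Sum>V\<in>pair_partitions_on (?A - {w, z}). G (insert {w, z} V))"
    by (rule sum.mono_neutral_right) (use fin zL in \<open>auto intro!: sum.neutral\<close>)
  also have "\<dots> = (\<Sum>z\<in>R. complex_of_real (q ^ card {x \<in> R. x < z} * t ^ card {x \<in> R. z < x}) * p w z
      * pairing_sum q t p (L \<union> (R - {z})))"
  proof (rule sum.cong[OF refl])
    fix z assume z: "z \<in> R"
    have "?A - {w, z} = L \<union> (R - {z})"
      using notin z by auto
    then show "(\<Sum>V\<in>pair_partitions_on (?A - {w, z}). G (insert {w, z} V))
        = complex_of_real (q ^ card {x \<in> R. x < z} * t ^ card {x \<in> R. z < x}) * p w z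
          * pairing_sum q t p (L \<union> (R - {z}))"
      using zR[OF z] by (simp add: pairing_sum_G sum_distrib_left)
  qed
  finally show ?thesis .
qed

text \<open>The set is nonempty, so every pairing has a block and its factor vanishes; for the empty
  set the sum would be 1.\<close>

lemma pairing_sum_no_opener:
  fixes p :: "nat \<Rightarrow> nat \<Rightarrow> complex"
  assumes "finite A" "x \<in> A"
    and p: "\<And>x y. x \<in> A \<Longrightarrow> p x y = 0"
  shows "pairing_sum q t p A = 0"
  unfolding pairing_sum_def
proof (rule sum.neutral, rule ballI)
  fix V assume V: "V \<in> pair_partitions_on A"
  note VD = pair_partitionsD[OF V]
  obtain B where B: "B \<in> V" "x \<in> B"
    using VD(1) assms(2) by blast
  have "Min B \<in> B"
    using pair_blockE[OF VD(2)[OF B(1)]] by blast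
  then have "p (Min B) (Max B) = 0"
    using p VD(1) B(1) by blast
  moreover have "finite V"
    using V finite_elements[OF assms(1)] by (simp add: pair_partitions_on_def)
  ultimately show "complex_of_real (q ^ crossings V * t ^ nestings V) * (\<Prod>B\<in>V. p (Min B) (Max B)) = 0"
    using B(1) by auto
qed

lemma pair_partitions_on_odd:
  assumes "odd (card A)"
  shows "pair_partitions_on A = {}"
proof (rule ccontr)
  assume "pair_partitions_on A \<noteq> {}"
  then obtain V where V: "V \<in> pair_partitions_on A" by blast
  note VD = pair_partitionsD[OF V]
  \<comment> \<open>An infinite set has \<open>card\<close> 0, which is even.\<close>
  have "finite A"
    using assms card.infinite by fastforce
  then have "2 * card V = card (\<Union>V)"
    using V finite_elements[of A V] VD
    by (intro card_partition) (auto simp: pair_partitions_on_def)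
  then show False
    using assms VD(1) by (metis dvd_triv_left)
qed


section \<open>Vacuum expectations\<close>

text \<open>Annihilation kills the vacuum on the right. A creation operator in front moves to the
  other slot of the form and becomes an annihilation operator acting on the vacuum there. Only the
  product a a* survives, and its value is the covariance in the moment formula.\<close>

lemma vacuum_state_ladder_pair:
  fixes f g :: "'a :: real_inner"
  shows "vacuum_state q t (ladder q t f e \<circ> ladder q t g e')
    = (if e = One \<and> e' = Star then complex_of_real (inner f g) else 0)"
proof -
  have zero: "annihilation q t f \<Omega> = 0" for f :: 'a
    by (simp add: vacuum_def annihilation_tensor)
  have "fock_inner q t \<Omega> (\<Omega> :: 'a fock) = 1"
    by (simp add: vacuum_def fock_inner_tensor qt_weight_def pair_set_def)
  then show ?thesis
    using fock_inner_scale_left[of q t 0 0] fock_inner_scale_right[of q t _ 0 0]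
    by (cases e; cases e')
      (simp_all add: vacuum_state_def zero clinearD[OF clinear_annihilation] annihilation_creation
        fock_inner_add_right fock_inner_scale_right vacuum_def[symmetric]
        t_power_N_tensor[of t "[]", folded vacuum_def] clinearD[OF clinear_creation]
        flip: fock_inner_annihilation)
qed

lemma foldr_ladder_linear:
  "clinear (foldr (\<lambda>i. ladder q t (h i) (\<epsilon> i)) xs)"
proof (induction xs)
  case (Cons x xs)
  have "clinear (ladder q t (h x) (\<epsilon> x))"
    by (cases "\<epsilon> x") (simp_all add: clinear_annihilation clinear_creation)
  then show ?case
    using Cons by (simp add: clinear_iff)
qed (simp add: clinear_iff)

lemma ladder_word_eq_foldr:
  "ladder_word q t h \<epsilon> m \<xi> = foldr (\<lambda>i. ladder q t (h i) (\<epsilon> i)) [1..<Suc m] \<xi>"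
proof -
  have "foldr (\<circ>) (map f xs) id \<xi> = foldr f xs \<xi>" for f :: "nat \<Rightarrow> 'b \<Rightarrow> 'b" and xs \<xi>
    by (induction xs) simp_all
  then show ?thesis
    by (simp only: ladder_word_def)
qed

lemma foldr_creation:
  "(\<And>i. i \<in> set xs \<Longrightarrow> \<epsilon> i = Star) \<Longrightarrow>
    foldr (\<lambda>i. ladder q t (h i) (\<epsilon> i)) xs \<Omega> = tensor (map (\<lambda>i. emb_cplx (h i)) xs)"
  by (induction xs) (simp_all add: vacuum_def creation_tensor)

text \<open>To the right of the last annihilation operator only creation operators act, so the
  vector there is a simple tensor. Deleting its \<open>k\<close>-th factor amounts to deleting the
  corresponding creation operator, so each summand is again a word, two letters shorter.\<close>

lemma foldr_last_annihilation:
  assumes w: "\<epsilon> w = One" and rs: "\<And>i. i \<in> set rs \<Longrightarrow> \<epsilon> i = Star"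
  shows "foldr (\<lambda>i. ladder q t (h i) (\<epsilon> i)) (ls @ w # rs) \<Omega>
    = (\<Sum>k<length rs. complex_of_real (q ^ k * t ^ (length rs - Suc k) * inner (h w) (h (rs ! k)))
        *\<^sub>C foldr (\<lambda>i. ladder q t (h i) (\<epsilon> i)) (ls @ take k rs @ drop (Suc k) rs) \<Omega>)"
proof -
  let ?F = "foldr (\<lambda>i. ladder q t (h i) (\<epsilon> i))"
  have "?F (w # rs) \<Omega> = annihilation q t (h w) (tensor (map (\<lambda>i. emb_cplx (h i)) rs))"
    by (simp add: w foldr_creation[OF rs])
  also have "\<dots> = (\<Sum>k<length rs. complex_of_real (q ^ k * t ^ (length rs - Suc k) * inner (h w) (h (rs ! k)))
        *\<^sub>C tensor (map (\<lambda>i. emb_cplx (h i)) (take k rs @ drop (Suc k) rs)))"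
    unfolding annihilation_tensor by (simp add: cinner_emb_cplx take_map drop_map)
  also have "\<dots> = (\<Sum>k<length rs. complex_of_real (q ^ k * t ^ (length rs - Suc k) * inner (h w) (h (rs ! k)))
        *\<^sub>C ?F (take k rs @ drop (Suc k) rs) \<Omega>)"
  proof (rule sum.cong[OF refl])
    fix k
    have "\<epsilon> i = Star" if "i \<in> set (take k rs @ drop (Suc k) rs)" for i
      using that rs by (auto dest: in_set_takeD in_set_dropD)
    then show "complex_of_real (q ^ k * t ^ (length rs - Suc k) * inner (h w) (h (rs ! k)))
        *\<^sub>C tensor (map (\<lambda>i. emb_cplx (h i)) (take k rs @ drop (Suc k) rs))
      = complex_of_real (q ^ k * t ^ (length rs - Suc k) * inner (h w) (h (rs ! k)))
        *\<^sub>C ?F (take k rs @ drop (Suc k) rs) \<Omega>"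
      by (subst foldr_creation) simp_all
  qed
  finally have eq: "?F (w # rs) \<Omega> = \<dots>" .
  have "?F (ls @ w # rs) \<Omega> = ?F ls (?F (w # rs) \<Omega>)"
    by simp
  then show ?thesis
    unfolding eq clinear_sum[OF foldr_ladder_linear] clinearD(2)[OF foldr_ladder_linear]
    by simp
qed

lemma sum_nth_distinct:
  assumes "distinct rs"
  shows "(\<Sum>k<length rs. F (rs ! k)) = (\<Sum>z\<in>set rs. F z)"
  using sum.reindex_bij_betw[OF bij_betw_nth[OF assms refl refl]] by simp

text \<open>This translates the exponents of \<open>annihilation\<close>, which are positions in a
  list, into the counts of closers before and after \<open>z\<close> in
  \<open>pairing_sum_last_opener\<close>.\<close>

lemma card_less_nth:
  fixes rs :: "nat list"
  assumes "sorted_wrt (<) rs" "k < length rs"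
  shows "card {x \<in> set rs. x < rs ! k} = k"
    and "card {x \<in> set rs. rs ! k < x} = length rs - Suc k"
proof -
  have d: "distinct rs"
    using assms(1) by (simp add: strict_sorted_iff)
  have less: "rs ! i < rs ! j \<longleftrightarrow> i < j" if "i < length rs" "j < length rs" for i j
    using that assms(1) sorted_wrt_nth_less[of "(<)" rs]
    by (metis linorder_neqE_nat order.asym order_less_irrefl)
  have eq: "{x \<in> set rs. P x} = (!) rs ` {i. i < length rs \<and> P (rs ! i)}" for P
    by (auto simp: in_set_conv_nth)
  have "{i. i < length rs \<and> rs ! i < rs ! k} = {..<k}"
    "{i. i < length rs \<and> rs ! k < rs ! i} = {Suc k..<length rs}"
    using assms(2) less by auto
  then have "{x \<in> set rs. x < rs ! k} = (!) rs ` {..<k}"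
    "{x \<in> set rs. rs ! k < x} = (!) rs ` {Suc k..<length rs}"
    using eq[of "\<lambda>x. x < rs ! k"] eq[of "\<lambda>x. rs ! k < x"] by simp_all
  moreover have "inj_on ((!) rs) {..<k}" "inj_on ((!) rs) {Suc k..<length rs}"
    using d assms(2) by (auto simp: inj_on_def nth_eq_iff_index_eq)
  ultimately show "card {x \<in> set rs. x < rs ! k} = k"
    "card {x \<in> set rs. rs ! k < x} = length rs - Suc k"
    by (simp_all add: card_image)
qed

text \<open>Both sides satisfy the same recursion: the last annihilation operator is contracted with
  each creation operator to its right, and the last opener is paired with each closer to its
  right.\<close>

lemma vacuum_word_pairing_sum:
  fixes h :: "nat \<Rightarrow> 'a :: real_inner" and \<epsilon> :: "nat \<Rightarrow> exponent" and q t :: real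
  defines "p \<equiv> \<lambda>w z. vacuum_state q t (ladder q t (h w) (\<epsilon> w) \<circ> ladder q t (h z) (\<epsilon> z))"
  shows "sorted_wrt (<) xs \<Longrightarrow>
    fock_inner q t \<Omega> (foldr (\<lambda>i. ladder q t (h i) (\<epsilon> i)) xs \<Omega>) = pairing_sum q t p (set xs)"
proof (induction "length xs" arbitrary: xs rule: less_induct)
  case less
  let ?F = "foldr (\<lambda>i. ladder q t (h i) (\<epsilon> i))"
  have p: "p w z = (if \<epsilon> w = One \<and> \<epsilon> z = Star then complex_of_real (inner (h w) (h z)) else 0)" for w z
    unfolding p_def by (rule vacuum_state_ladder_pair)
  show ?case
  proof (cases "\<exists>i\<in>set xs. \<epsilon> i = One")
    case True
    then obtain ls w rs where xs: "xs = ls @ w # rs" and w: "\<epsilon> w = One"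
      and "\<forall>i\<in>set rs. \<epsilon> i \<noteq> One"
      by (rule split_list_last_propE)
    then have rs: "\<epsilon> i = Star" if "i \<in> set rs" for i
      using that by (cases "\<epsilon> i") auto
    have sorted: "sorted_wrt (<) rs" "sorted_wrt (<) ls" "\<And>x y. x \<in> set ls \<Longrightarrow> y \<in> set rs \<Longrightarrow> x < y"
      "\<And>x. x \<in> set ls \<Longrightarrow> x < w" "\<And>x. x \<in> set rs \<Longrightarrow> w < x"
      using less.prems by (auto simp: xs sorted_wrt_append)
    have distinct: "distinct rs"
      using sorted(1) by (simp add: strict_sorted_iff)
    have "fock_inner q t \<Omega> (?F xs \<Omega>)
        = (\<Sum>k<length rs. complex_of_real (q ^ k * t ^ (length rs - Suc k)) * p w (rs ! k)
            * fock_inner q t \<Omega> (?F (ls @ take k rs @ drop (Suc k) rs) \<Omega>))"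
      unfolding xs
      by (subst foldr_last_annihilation)
        (auto simp: w rs p fock_inner_sum_right fock_inner_scale_right intro!: sum.cong)
    also have "\<dots> = (\<Sum>k<length rs. complex_of_real (q ^ card {x \<in> set rs. x < rs ! k}
          * t ^ card {x \<in> set rs. rs ! k < x}) * p w (rs ! k)
            * pairing_sum q t p (set ls \<union> (set rs - {rs ! k})))"
    proof (intro sum.cong refl)
      fix k assume "k \<in> {..<length rs}"
      then have k: "k < length rs" by simp
      let ?rs = "take k rs @ drop (Suc k) rs"
      have set: "set ?rs = set rs - {rs ! k}"
      proof -
        have "rs = take k rs @ rs ! k # drop (Suc k) rs"
          by (rule id_take_nth_drop[OF k])
        then show ?thesis
          using distinct by (metis Diff_insert_absorb Un_insert_right distinct.simps(2) distinct_append
              list.set(2) not_distinct_conv_prefix set_append UnE)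
      qed
      have "sorted_wrt (<) ?rs"
        using sorted(1) by (subst (asm) id_take_nth_drop[OF k]) (auto simp: sorted_wrt_append)
      then have "sorted_wrt (<) (ls @ ?rs)"
        using sorted(2,3) set unfolding sorted_wrt_append[of _ ls] by blast
      moreover have "length (ls @ ?rs) < length xs"
        using k by (simp add: xs)
      ultimately have "fock_inner q t \<Omega> (?F (ls @ ?rs) \<Omega>) = pairing_sum q t p (set (ls @ ?rs))"
        by (intro less.hyps)
      also have "set (ls @ ?rs) = set ls \<union> (set rs - {rs ! k})"
        using set by simp
      finally show "complex_of_real (q ^ k * t ^ (length rs - Suc k)) * p w (rs ! k)
          * fock_inner q t \<Omega> (?F (ls @ ?rs) \<Omega>)
        = complex_of_real (q ^ card {x \<in> set rs. x < rs ! k} * t ^ card {x \<in> set rs. rs ! k < x})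
          * p w (rs ! k) * pairing_sum q t p (set ls \<union> (set rs - {rs ! k}))"
        by (simp only: card_less_nth[OF sorted(1) k])
    qed
    also have "\<dots> = (\<Sum>z\<in>set rs. complex_of_real (q ^ card {x \<in> set rs. x < z}
          * t ^ card {x \<in> set rs. z < x}) * p w z * pairing_sum q t p (set ls \<union> (set rs - {z})))"
      by (rule sum_nth_distinct[OF distinct])
    also have "\<dots> = pairing_sum q t p (insert w (set ls \<union> set rs))"
      by (rule pairing_sum_last_opener[where opener = "\<lambda>x. \<epsilon> x = One", symmetric])
        (auto simp: sorted w rs p split: if_splits)
    finally show ?thesis
      by (simp add: xs)
  next
    \<comment> \<open>Without annihilation operators the word creates a tensor of degree
      \<open>length xs\<close>, orthogonal to the vacuum unless \<open>xs\<close> is empty; likewise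
      no pairing of a nonempty set contributes.\<close>
    case False
    then have star: "\<epsilon> i = Star" if "i \<in> set xs" for i
      using that by (cases "\<epsilon> i") auto
    show ?thesis
    proof (cases xs)
      case Nil
      then show ?thesis
        by (simp add: pairing_sum_empty vacuum_def fock_inner_tensor qt_weight_def pair_set_def)
    next
      case (Cons x ys)
      have "fock_inner q t \<Omega> (?F xs \<Omega>) = 0"
        by (subst foldr_creation) (simp_all add: star Cons vacuum_def fock_inner_tensor)
      moreover have "pairing_sum q t p (set xs) = 0"
        by (rule pairing_sum_no_opener[of _ x]) (auto simp: Cons p star)
      ultimately show ?thesis by simp
    qed
  qed
qed

lemma vacuum_state_ladder_word:
  "vacuum_state q t (ladder_word q t h \<epsilon> m) = (\<Sum>V\<in>pair_partitions_on {1..m}.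
    complex_of_real (q ^ crossings V * t ^ nestings V) *
    (\<Prod>B\<in>V. vacuum_state q t
      (ladder q t (h (Min B)) (\<epsilon> (Min B)) \<circ> ladder q t (h (Max B)) (\<epsilon> (Max B)))))"
proof -
  have "set [1..<Suc m] = {1..m}"
    by auto
  then show ?thesis
    using vacuum_word_pairing_sum[of "[1..<Suc m]" q t h \<epsilon>]
    by (simp add: vacuum_state_def[of q t "ladder_word q t h \<epsilon> m"] ladder_word_eq_foldr pairing_sum_def
        del: upt_Suc)
qed


section \<open>Operator norms\<close>

lemma annihilation_bound_iff:
  assumes qt: "\<bar>q\<bar> \<le> t" and "0 \<le> C"
  shows "(\<forall>\<xi>. fock_norm q t (annihilation q t f \<xi>) \<le> C * fock_norm q t \<xi>)
    \<longleftrightarrow> (\<forall>\<xi>. fock_norm q t (creation f \<xi>) \<le> C * fock_norm q t \<xi>)"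
  using fock_norm_adjoint_le[OF assms fock_inner_creation, of f]
    fock_norm_adjoint_le[OF assms fock_inner_annihilation, of f]
  by blast

text \<open>Both differences of logarithms are positive. This permits reading \<open>powi\<close> as
  a natural power and writing the index as a successor, the form in which degrees enter the
  bounds.\<close>

lemma qt_number_argmax_pos:
  fixes q t :: real
  assumes "0 < q" "q < t" "t < 1"
  shows "0 < \<lceil>(ln (1 - q) - ln (1 - t)) / (ln t - ln q)\<rceil>"
  using assms by simp

lemma creation_bound_exists:
  assumes qt: "\<bar>q\<bar> < t" and "t \<le> 1"
  shows "\<exists>C\<ge>0. \<forall>\<xi>. fock_norm q t (creation f \<xi>) \<le> C * fock_norm q t \<xi>"
proof -
  consider "q \<le> 0" | "0 < q" "t = 1" | "0 < q" "t < 1"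
    using assms by linarith
  then show ?thesis
  proof cases
    case 1
    then show ?thesis
      using fock_norm_creation_le_nonpos[OF qt 1 assms(2), of f] by (intro exI[of _ "norm f"]) simp
  next
    case 2
    have "qt_number q t (Suc n) \<le> 1 / (1 - q)" for n
      using qt_number_le_free[of q "Suc n"] 2 qt by simp
    then have "fock_norm q t (creation f \<xi>) \<le> sqrt (1 / (1 - q)) * norm f * fock_norm q t \<xi>" for \<xi>
      by (rule fock_norm_creation_le_nonneg[OF qt less_imp_le[OF 2(1)]])
    moreover have "0 \<le> sqrt (1 / (1 - q)) * norm f"
      using 2 qt by simp
    ultimately show ?thesis by blast
  next
    case 3
    let ?m = "nat \<lceil>(ln (1 - q) - ln (1 - t)) / (ln t - ln q)\<rceil>"
    have "qt_number q t (Suc n) \<le> qt_number q t ?m" for n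
      using qt_number_le_max[of q t "Suc n"] 3 qt by simp
    then have "fock_norm q t (creation f \<xi>) \<le> sqrt (qt_number q t ?m) * norm f * fock_norm q t \<xi>" for \<xi>
      by (rule fock_norm_creation_le_nonneg[OF qt less_imp_le[OF 3(1)]])
    moreover have "0 \<le> sqrt (qt_number q t ?m) * norm f"
      using 3 qt by (simp add: qt_number_def power_mono)
    ultimately show ?thesis by blast
  qed
qed

lemma fock_bounded_creation:
  assumes "\<bar>q\<bar> < t" "t \<le> 1"
  shows "fock_bounded q t (creation f)"
  unfolding fock_bounded_def using creation_bound_exists[OF assms, of f] by blast

lemma fock_bounded_annihilation:
  assumes "\<bar>q\<bar> < t" "t \<le> 1"
  shows "fock_bounded q t (annihilation q t f)"
  unfolding fock_bounded_def
  using creation_bound_exists[OF assms, of f] annihilation_bound_iff[of q t _ f] assms(1) by fastforce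

text \<open>The assumption \<open>lower\<close> places \<open>C\<close> below every upper bound of
  the values obtained from the tensor powers of \<open>f\<close>. This form covers a maximum as well
  as a supremum that is only approached.\<close>

lemma fock_space_opnorm_creation_eqI:
  fixes f :: "'a :: real_inner"
  assumes qt: "\<bar>q\<bar> < t" "t \<le> 1"
    and upper: "\<And>\<xi> :: 'a fock. fock_norm q t (creation f \<xi>) \<le> C * fock_norm q t \<xi>"
    and "0 \<le> C"
    and lower: "\<And>D. 0 \<le> D \<Longrightarrow> (\<And>n. sqrt (qt_number q t (Suc n)) * norm f \<le> D) \<Longrightarrow> C \<le> D"
  shows "fock_space_opnorm q t (fock_extension q t (creation f)) = C"
proof (rule antisym)
  have qt': "\<bar>q\<bar> \<le> t" using qt by simp
  note bdd = clinear_creation fock_bounded_creation[OF qt, of f]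
  note iff = fock_space_opnorm_le_iff[OF qt' bdd]
  note nonneg = fock_space_opnorm_nonneg[OF qt' bdd]
  show "fock_space_opnorm q t (fock_extension q t (creation f)) \<le> C"
    using iff[OF \<open>0 \<le> C\<close>] upper by blast
  have "\<forall>\<xi>. fock_norm q t (creation f \<xi>)
      \<le> fock_space_opnorm q t (fock_extension q t (creation f)) * fock_norm q t \<xi>"
    using iff[OF nonneg] by simp
  then show "C \<le> fock_space_opnorm q t (fock_extension q t (creation f))"
    by (intro lower nonneg creation_bound_ge[OF qt(1)]) auto
qed

text \<open>Two nonnegative reals with the same nonnegative upper bounds are equal, so it suffices
  to compare the admissible constants of the two operators.\<close>

lemma fock_space_opnorm_annihilation:
  assumes qt: "\<bar>q\<bar> < t" "t \<le> 1"
  shows "fock_space_opnorm q t (fock_extension q t (annihilation q t f))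
    = fock_space_opnorm q t (fock_extension q t (creation f))" (is "?a = ?c")
proof -
  have qt': "\<bar>q\<bar> \<le> t" using qt by simp
  note c = clinear_creation fock_bounded_creation[OF qt, of f]
  note a = clinear_annihilation fock_bounded_annihilation[OF qt, of f]
  have "?a \<le> C \<longleftrightarrow> ?c \<le> C" if "0 \<le> C" for C
    unfolding fock_space_opnorm_le_iff[OF qt' a that] fock_space_opnorm_le_iff[OF qt' c that]
    by (rule annihilation_bound_iff[OF qt' that])
  from this[OF fock_space_opnorm_nonneg[OF qt' c]] this[OF fock_space_opnorm_nonneg[OF qt' a]]
  show ?thesis by simp
qed

lemma fock_space_opnorm_creation_nonpos:
  assumes qt: "\<bar>q\<bar> < t" "t \<le> 1" and "q \<le> 0"
  shows "fock_space_opnorm q t (fock_extension q t (creation f)) = norm f"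
proof (rule fock_space_opnorm_creation_eqI[OF qt])
  fix D assume "\<And>n. sqrt (qt_number q t (Suc n)) * norm f \<le> D"
  \<comment> \<open>The case \<open>n = 0\<close> is the vacuum as test vector, where [1] =
    1.\<close>
  from this[of 0] show "norm f \<le> D"
    using qt by (simp add: qt_number_1)
qed (simp_all add: fock_norm_creation_le_nonpos[OF qt(1) assms(3) qt(2)])

lemma fock_space_opnorm_creation_free:
  assumes "0 < q" "q < 1"
  shows "fock_space_opnorm q 1 (fock_extension q 1 (creation f)) = 1 / sqrt (1 - q) * norm f"
proof (rule fock_space_opnorm_creation_eqI)
  fix D assume D: "\<And>n. sqrt (qt_number q 1 (Suc n)) * norm f \<le> D"
  \<comment> \<open>At \<open>t = 1\<close> the values [n+1] increase to \<open>1 / (1 - q)\<close>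
    without reaching it, so the lower bound needs a limit instead of a single test vector.\<close>
  have "(\<lambda>n. q ^ Suc n) \<longlonglongrightarrow> 0"
    using assms by (intro LIMSEQ_Suc LIMSEQ_power_zero) simp
  then have "(\<lambda>n. sqrt ((1 - q ^ Suc n) / (1 - q)) * norm f) \<longlonglongrightarrow> sqrt ((1 - 0) / (1 - q)) * norm f"
    using assms by (intro tendsto_intros) auto
  then show "1 / sqrt (1 - q) * norm f \<le> D"
    using LIMSEQ_le_const2[of _ "sqrt ((1 - 0) / (1 - q)) * norm f" D] D
    by (auto simp: qt_number_def real_sqrt_divide)
next
  fix \<xi>
  have "fock_norm q 1 (creation f \<xi>) \<le> sqrt (1 / (1 - q)) * norm f * fock_norm q 1 \<xi>"
    using assms by (intro fock_norm_creation_le_nonneg qt_number_le_free) auto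
  then show "fock_norm q 1 (creation f \<xi>) \<le> 1 / sqrt (1 - q) * norm f * fock_norm q 1 \<xi>"
    by (simp add: real_sqrt_divide)
qed (use assms in auto)

lemma fock_space_opnorm_creation_max:
  assumes "0 < q" "q < t" "t < 1"
  defines "n \<equiv> \<lceil>(ln (1 - q) - ln (1 - t)) / (ln t - ln q)\<rceil>"
  shows "fock_space_opnorm q t (fock_extension q t (creation f))
    = sqrt ((t powi n - q powi n) / (t - q)) * norm f"
proof -
  have "0 < n"
    unfolding n_def by (rule qt_number_argmax_pos[OF assms(1-3)])
  \<comment> \<open>Creation raises the degree by one: the value [n] at the optimal index is
    attained at the tensor power of \<open>f\<close> of degree \<open>m\<close>, one less than that
    index.\<close>
  then obtain m where m: "nat n = Suc m"
    using gr0_implies_Suc[of "nat n"] by auto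
  have eq: "(t powi n - q powi n) / (t - q) = qt_number q t (Suc m)"
    using \<open>0 < n\<close> by (simp add: power_int_def qt_number_def m del: power_Suc)
  have le: "qt_number q t k \<le> qt_number q t (Suc m)" for k
    using qt_number_le_max[OF assms(1-3), of k] by (simp add: n_def[symmetric] m)
  show ?thesis
    unfolding eq
  proof (rule fock_space_opnorm_creation_eqI)
    show "fock_norm q t (creation f \<xi>)
        \<le> sqrt (qt_number q t (Suc m)) * norm f * fock_norm q t \<xi>" for \<xi>
      using assms(1-3) by (intro fock_norm_creation_le_nonneg le) auto
    show "0 \<le> sqrt (qt_number q t (Suc m)) * norm f"
      using qt_number_pos[of q t m] assms(1-3) by simp
  qed (use assms(1-3) in auto)
qed

text \<open>For chosen representatives the two inner products agree term by term, so their limits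
  agree.\<close>

lemma fock_space_inner_adjoint:
  assumes qt: "\<bar>q\<bar> \<le> t"
    and S: "clinear S" "fock_bounded q t S" and T: "clinear T" "fock_bounded q t T"
    and adj: "\<And>\<xi> \<eta>. fock_inner q t (S \<xi>) \<eta> = fock_inner q t \<xi> (T \<eta>)"
    and X: "X \<in> fock_space q t" and Y: "Y \<in> fock_space q t"
  shows "fock_space_inner q t (fock_extension q t S X) Y
    = fock_space_inner q t X (fock_extension q t T Y)"
proof -
  obtain x y where x: "x \<in> X" and y: "y \<in> Y"
    using fock_space_nonempty[OF qt X] fock_space_nonempty[OF qt Y] by metis
  note Sx = fock_extension_mem[OF qt S X x] and Ty = fock_extension_mem[OF qt T Y y]
  have "(\<lambda>n. fock_inner q t ((S \<circ> x) n) (y n)) \<longlonglongrightarrow> fock_space_inner q t (fock_extension q t S X) Y"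
    by (rule fock_space_inner_tendsto[OF qt Sx(2) Y Sx(1) y])
  moreover have "(\<lambda>n. fock_inner q t (x n) ((T \<circ> y) n))
      \<longlonglongrightarrow> fock_space_inner q t X (fock_extension q t T Y)"
    by (rule fock_space_inner_tendsto[OF qt X Ty(2) x Ty(1)])
  ultimately show ?thesis
    by (intro LIMSEQ_unique) (simp_all add: adj)
qed

theorem mainTheorem2:
  fixes q t :: real
  assumes "separable_space (euclidean :: 'a :: {real_inner, complete_space} topology)"
    and "\<bar>q\<bar> < t" and "t \<le> 1"
  shows
    "(\<forall>f :: 'a.
        (\<forall>\<xi> \<eta>. fock_inner q t (annihilation q t f \<xi>) \<eta> = fock_inner q t \<xi> (creation f \<eta>)) \<and>
        (\<forall>\<xi> \<eta>. fock_inner q t (creation f \<xi>) \<eta> = fock_inner q t \<xi> (annihilation q t f \<eta>)) \<and>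
        (\<forall>X \<in> fock_space q t. \<forall>Y \<in> fock_space q t.
          fock_space_inner q t (fock_extension q t (annihilation q t f) X) Y =
            fock_space_inner q t X (fock_extension q t (creation f) Y)) \<and>
        (\<forall>X \<in> fock_space q t. \<forall>Y \<in> fock_space q t.
          fock_space_inner q t (fock_extension q t (creation f) X) Y =
            fock_space_inner q t X (fock_extension q t (annihilation q t f) Y))) \<and>
     (\<forall>(f :: 'a) (g :: 'a) \<xi>.
        annihilation q t f (creation g \<xi>)
          - complex_of_real q *\<^sub>C creation g (annihilation q t f \<xi>)
        = complex_of_real (inner f g) *\<^sub>C t_power_N t \<xi>) \<and>
     (\<forall>n \<ge> 1. \<forall>(h :: nat \<Rightarrow> 'a) (\<epsilon> :: nat \<Rightarrow> exponent).
        vacuum_state q t (ladder_word q t h \<epsilon> (2 * n - 1)) = 0 \<and>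
        vacuum_state q t (ladder_word q t h \<epsilon> (2 * n)) =
          (\<Sum>V \<in> pair_partitions (2 * n).
            complex_of_real (q ^ crossings V * t ^ nestings V) *
            (\<Prod>B\<in>V. vacuum_state q t
              (ladder q t (h (Min B)) (\<epsilon> (Min B)) \<circ> ladder q t (h (Max B)) (\<epsilon> (Max B)))))) \<and>
     (\<forall>f :: 'a.
        fock_bounded q t (annihilation q t f) \<and>
        fock_bounded q t (creation f) \<and>
        fock_space_bounded q t (fock_extension q t (annihilation q t f)) \<and>
        fock_space_bounded q t (fock_extension q t (creation f)) \<and>
        fock_space_opnorm q t (fock_extension q t (annihilation q t f)) =
          fock_space_opnorm q t (fock_extension q t (creation f)) \<and>
        (0 \<le> - q \<and> - q < t \<and> t \<le> 1 \<longrightarrow>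
          fock_space_opnorm q t (fock_extension q t (creation f)) = norm f) \<and>
        (0 < q \<and> q < t \<and> t = 1 \<longrightarrow>
          fock_space_opnorm q t (fock_extension q t (creation f)) = 1 / sqrt (1 - q) * norm f) \<and>
        (0 < q \<and> q < t \<and> t < 1 \<longrightarrow>
          (let n = \<lceil>(ln (1 - q) - ln (1 - t)) / (ln t - ln q)\<rceil> in
            fock_space_opnorm q t (fock_extension q t (creation f)) =
              sqrt ((t powi n - q powi n) / (t - q)) * norm f)))"
proof -
  have qt: "\<bar>q\<bar> \<le> t" using assms(2) by simp
  note bdd_a = clinear_annihilation fock_bounded_annihilation[OF assms(2,3)]
  note bdd_c = clinear_creation fock_bounded_creation[OF assms(2,3)]
  show ?thesis
  proof (intro conjI allI ballI impI)
    show "fock_inner q t (annihilation q t f \<xi>) \<eta> = fock_inner q t \<xi> (creation f \<eta>)"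
      for f :: 'a and \<xi> \<eta> by (rule fock_inner_annihilation)
    show "fock_inner q t (creation f \<xi>) \<eta> = fock_inner q t \<xi> (annihilation q t f \<eta>)"
      for f :: 'a and \<xi> \<eta> by (rule fock_inner_creation)
    show "fock_space_inner q t (fock_extension q t (annihilation q t f) X) Y
        = fock_space_inner q t X (fock_extension q t (creation f) Y)"
      if "X \<in> fock_space q t" "Y \<in> fock_space q t" for f :: 'a and X Y
      by (rule fock_space_inner_adjoint[OF qt bdd_a bdd_c fock_inner_annihilation that])
    show "fock_space_inner q t (fock_extension q t (creation f) X) Y
        = fock_space_inner q t X (fock_extension q t (annihilation q t f) Y)"
      if "X \<in> fock_space q t" "Y \<in> fock_space q t" for f :: 'a and X Y
      by (rule fock_space_inner_adjoint[OF qt bdd_c bdd_a fock_inner_creation that])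
    show "annihilation q t f (creation g \<xi>) - complex_of_real q *\<^sub>C creation g (annihilation q t f \<xi>)
        = complex_of_real (inner f g) *\<^sub>C t_power_N t \<xi>" for f g :: 'a and \<xi>
      by (simp add: annihilation_creation)
    show "vacuum_state q t (ladder_word q t h \<epsilon> (2 * n - 1)) = 0"
      if "1 \<le> n" for n and h :: "nat \<Rightarrow> 'a" and \<epsilon>
      using that by (simp add: vacuum_state_ladder_word pair_partitions_on_odd)
    show "vacuum_state q t (ladder_word q t h \<epsilon> (2 * n)) = (\<Sum>V\<in>pair_partitions (2 * n).
        complex_of_real (q ^ crossings V * t ^ nestings V) *
        (\<Prod>B\<in>V. vacuum_state q t
          (ladder q t (h (Min B)) (\<epsilon> (Min B)) \<circ> ladder q t (h (Max B)) (\<epsilon> (Max B)))))"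
      for n and h :: "nat \<Rightarrow> 'a" and \<epsilon>
      unfolding vacuum_state_ladder_word pair_partitions_def pair_partitions_on_def ..
    show "fock_space_opnorm q t (fock_extension q t (creation f)) = norm f"
      if "0 \<le> - q \<and> - q < t \<and> t \<le> 1" for f :: 'a
      using that by (intro fock_space_opnorm_creation_nonpos assms) simp
    show "fock_space_opnorm q t (fock_extension q t (creation f)) = 1 / sqrt (1 - q) * norm f"
      if "0 < q \<and> q < t \<and> t = 1" for f :: 'a
      using fock_space_opnorm_creation_free[of q f] that by simp
    show "let n = \<lceil>(ln (1 - q) - ln (1 - t)) / (ln t - ln q)\<rceil> in
        fock_space_opnorm q t (fock_extension q t (creation f))
          = sqrt ((t powi n - q powi n) / (t - q)) * norm f"
      if "0 < q \<and> q < t \<and> t < 1" for f :: 'a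
      using fock_space_opnorm_creation_max[of q t f] that by (simp add: Let_def)
  qed (simp_all only: bdd_a bdd_c fock_space_bounded_extension[OF qt] fock_space_opnorm_annihilation[OF assms(2,3)])
qed

end
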